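(* Let $D$ be a flag domain of $G_0$ in a flag manifold $Z=G/Q$. If $D$ is generically 1-connected, then $D$ is pseudoconcave.
   Context: Flag domains: $G_0$ is a real simple Lie group embedded in its complexification $G$ (so $\mathfrak g=\mathfrak g_0+i\mathfrak g_0$), and $Z=G/Q$ is a compact $G$-homogeneous projective manifold (a flag manifold). A flag domain $D$ is an open $G_0$-orbit in $Z$. Cycles: let $K_0$ be a maximal compact subgroup of $G_0$ and $K\subset G$ its complexification. There is a unique $K_0$-orbit $C_0$ in $D$ which is a complex submanifold; it is called the base cycle, it is compact, and it is also a $K$-orbit. $G.C_0$ denotes the set of all translates $g(C_0)\subset Z$, $g\in G$; its elements are called cycles. Generic 1-connectedness: let $p\in D$, let $C\in G.C_0$ be a cycle with $p\in C$, and let $G_p$ be the isotropy group of $p$ in $G$. $D$ is called generically 1-connected if $C$ has nonempty intersection with the open $G_p$-orbit in $Z$. This notion does not depend on the choice of $p$ or $C$. Pseudoconcavity: a connected complex manifold $X$ is pseudoconcave if it contains a nonempty relatively compact open set $Y$ such that for every point $p\in\mathrm{cl}(Y)$ there is a holomorphic map $\psi:\Delta\to \mathrm{cl}(Y)$ of the unit disk $\Delta\subset\mathbb C$ (defined up to its boundary $\mathrm{bd}(\Delta)$) with $\psi(0)=p$ and $\psi(\mathrm{bd}(\Delta))\subset Y$. *)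

theory Defs
  imports "HOL-Analysis.Analysis" "HOL-Complex_Analysis.Complex_Analysis"
    "HOL-Algebra.Group_Action"
begin

section \<open>Complex manifolds\<close>

text \<open>A map on an open subset of complex n-space is holomorphic if its real Frechet derivative
  exists and is complex linear at every point.\<close>

definition holo_on :: "(complex^'m \<Rightarrow> complex^'n) \<Rightarrow> (complex^'m) set \<Rightarrow> bool" where
  "holo_on f S \<longleftrightarrow>
     (\<forall>x\<in>S. \<exists>f'. (f has_derivative f') (at x) \<and> (\<forall>c v. f' (c *s v) = c *s f' v))"

text \<open>The underlying set of a manifold is the \<open>topspace\<close> of its topology. A chart is a pair
  \<open>(U, \<phi>)\<close>; the values of \<open>\<phi>\<close> outside \<open>U\<close> are irrelevant. As index types are nonempty, the dimension is positive.\<close>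

record ('a, 'n) mfd =
  mtop :: "'a topology"
  atlas :: "('a set \<times> ('a \<Rightarrow> complex^'n)) set"

definition chart :: "'a topology \<Rightarrow> 'a set \<times> ('a \<Rightarrow> complex^'n) \<Rightarrow> bool" where
  "chart T = (\<lambda>(U, \<phi>). openin T U \<and> open (\<phi> ` U) \<and>
     homeomorphic_map (subtopology T U) (top_of_set (\<phi> ` U)) \<phi>)"

definition transition_holo ::
    "'a set \<times> ('a \<Rightarrow> complex^'n) \<Rightarrow> 'a set \<times> ('a \<Rightarrow> complex^'n) \<Rightarrow> bool" where
  "transition_holo = (\<lambda>(U, \<phi>) (V, \<psi>). holo_on (\<psi> \<circ> inv_into U \<phi>) (\<phi> ` (U \<inter> V)))"

definition complex_manifold :: "('a, 'n::finite) mfd \<Rightarrow> bool" where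
  "complex_manifold X \<longleftrightarrow> Hausdorff_space (mtop X) \<and> second_countable (mtop X) \<and>
     (\<forall>c\<in>atlas X. chart (mtop X) c) \<and> (\<Union>c\<in>atlas X. fst c) = topspace (mtop X) \<and>
     (\<forall>c\<in>atlas X. \<forall>d\<in>atlas X. transition_holo c d)"

text \<open>The charts of the maximal atlas generated by the given one.\<close>

definition holo_chart :: "('a, 'n::finite) mfd \<Rightarrow> 'a set \<times> ('a \<Rightarrow> complex^'n) \<Rightarrow> bool" where
  "holo_chart X c \<longleftrightarrow> chart (mtop X) c \<and>
     (\<forall>d\<in>atlas X. transition_holo c d \<and> transition_holo d c)"

definition holomorphic_map :: "('a, 'm::finite) mfd \<Rightarrow> ('b, 'n::finite) mfd \<Rightarrow> ('a \<Rightarrow> 'b) \<Rightarrow> bool" where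
  "holomorphic_map X Y f \<longleftrightarrow> continuous_map (mtop X) (mtop Y) f \<and>
     (\<forall>(U, \<phi>)\<in>atlas X. \<forall>(V, \<psi>)\<in>atlas Y.
        holo_on (\<psi> \<circ> f \<circ> inv_into U \<phi>) (\<phi> ` (U \<inter> f -` V)))"

definition prod_mfd :: "('a, 'm::finite) mfd \<Rightarrow> ('b, 'n::finite) mfd \<Rightarrow> ('a \<times> 'b, 'm + 'n) mfd" where
  "prod_mfd X Y =
     \<lparr>mtop = prod_topology (mtop X) (mtop Y),
      atlas = {(U \<times> V, \<lambda>(x, y). \<chi> k. case k of Inl i \<Rightarrow> \<phi> x $ i | Inr j \<Rightarrow> \<psi> y $ j) | U V \<phi> \<psi>.
                 (U, \<phi>) \<in> atlas X \<and> (V, \<psi>) \<in> atlas Y}\<rparr>"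

definition open_submanifold :: "('a, 'n::finite) mfd \<Rightarrow> 'a set \<Rightarrow> ('a, 'n::finite) mfd" where
  "open_submanifold X D =
     \<lparr>mtop = subtopology (mtop X) D, atlas = {(U \<inter> D, \<phi>) | U \<phi>. (U, \<phi>) \<in> atlas X}\<rparr>"

text \<open>Embedded complex submanifolds, via slice charts: near each of its points \<open>S\<close> is a complex
  linear subspace in suitable holomorphic coordinates. Neither closedness nor connectedness is
  part of the notion.\<close>

definition complex_submanifold :: "('a, 'n::finite) mfd \<Rightarrow> 'a set \<Rightarrow> bool" where
  "complex_submanifold X S \<longleftrightarrow> S \<subseteq> topspace (mtop X) \<and>
     (\<forall>x\<in>S. \<exists>U \<phi> L. holo_chart X (U, \<phi>) \<and> x \<in> U \<and> vec.subspace L \<and>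
        \<phi> ` (U \<inter> S) = \<phi> ` U \<inter> L)"

text \<open>Points of projective space are the complex lines of \<open>complex^'k\<close>. The map \<open>\<iota>\<close> is a holomorphic
  immersion into projective space iff near each point it has a holomorphic lift \<open>F\<close> (in chart
  coordinates) to nonzero vectors whose derivative is injective modulo the line through \<open>F\<close>. For
  compact \<open>X\<close>, an injective immersion is a closed embedding.\<close>

definition projective_embedding :: "('a, 'n::finite) mfd \<Rightarrow> ('a \<Rightarrow> (complex^'k) set) \<Rightarrow> bool" where
  "projective_embedding X \<iota> \<longleftrightarrow> compact_space (mtop X) \<and> inj_on \<iota> (topspace (mtop X)) \<and>
     (\<forall>x\<in>topspace (mtop X). \<exists>U \<phi> V F. (U, \<phi>) \<in> atlas X \<and> openin (mtop X) V \<and> x \<in> V \<and> V \<subseteq> U \<and>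
        holo_on F (\<phi> ` V) \<and>
        (\<forall>y\<in>V. F (\<phi> y) \<noteq> 0 \<and> \<iota> y = vec.span {F (\<phi> y)}) \<and>
        (\<forall>v. frechet_derivative F (at (\<phi> x)) v \<in> \<iota> x \<longrightarrow> v = 0))"

section \<open>Pseudoconcavity\<close>

text \<open>A holomorphic map of the unit disk defined up to its boundary: it extends holomorphically to
  a neighbourhood of the closed disk. In the definition of pseudoconcavity below it would
  make no difference to ask only for continuity up to the boundary: since \<open>Y\<close> is open, one may
  replace \<open>\<psi>\<close> by \<open>z \<mapsto> \<psi> (r z)\<close> with \<open>r < 1\<close> close to \<open>1\<close>.\<close>

definition holomorphic_disk :: "('a, 'n::finite) mfd \<Rightarrow> (complex \<Rightarrow> 'a) \<Rightarrow> bool" where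
  "holomorphic_disk X \<psi> \<longleftrightarrow>
     (\<exists>W. open W \<and> cball 0 1 \<subseteq> W \<and> continuous_map (top_of_set W) (mtop X) \<psi> \<and>
        (\<forall>(U, \<phi>)\<in>atlas X. \<forall>i. (\<lambda>z. \<phi> (\<psi> z) $ i) holomorphic_on (W \<inter> \<psi> -` U)))"

definition pseudoconcave :: "('a, 'n::finite) mfd \<Rightarrow> bool" where
  "pseudoconcave X \<longleftrightarrow> complex_manifold X \<and> connected_space (mtop X) \<and>
     (\<exists>Y. openin (mtop X) Y \<and> Y \<noteq> {} \<and> compactin (mtop X) (mtop X closure_of Y) \<and>
        (\<forall>p \<in> mtop X closure_of Y. \<exists>\<psi>. holomorphic_disk X \<psi> \<and>
           \<psi> ` cball 0 1 \<subseteq> mtop X closure_of Y \<and> \<psi> 0 = p \<and> \<psi> ` sphere 0 1 \<subseteq> Y))"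

section \<open>Lie groups\<close>

definition complex_lie_group :: "('g, 'r) monoid_scheme \<Rightarrow> ('g, 'm::finite) mfd \<Rightarrow> bool" where
  "complex_lie_group G M \<longleftrightarrow> group G \<and> complex_manifold M \<and> topspace (mtop M) = carrier G \<and>
     holomorphic_map (prod_mfd M M) M (\<lambda>(x, y). x \<otimes>\<^bsub>G\<^esub> y) \<and>
     holomorphic_map M M (\<lambda>x. inv\<^bsub>G\<^esub> x)"

text \<open>The tangent space of \<open>G\<close> at the identity is identified with \<open>complex^'m\<close> by means of a chart
  at the identity, which is chosen once and for all.\<close>

definition unit_chart ::
    "('g, 'r) monoid_scheme \<Rightarrow> ('g, 'm::finite) mfd \<Rightarrow> 'g set \<times> ('g \<Rightarrow> complex^'m)" where
  "unit_chart G M = (SOME c. c \<in> atlas M \<and> \<one>\<^bsub>G\<^esub> \<in> fst c)"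

definition Ad ::
    "('g, 'r) monoid_scheme \<Rightarrow> ('g, 'm::finite) mfd \<Rightarrow> 'g \<Rightarrow> complex^'m \<Rightarrow> complex^'m" where
  "Ad G M g = (case unit_chart G M of (U, \<phi>) \<Rightarrow>
     frechet_derivative (\<lambda>x. \<phi> (g \<otimes>\<^bsub>G\<^esub> inv_into U \<phi> x \<otimes>\<^bsub>G\<^esub> inv\<^bsub>G\<^esub> g)) (at (\<phi> \<one>\<^bsub>G\<^esub>)))"

text \<open>The bracket is \<open>[u, v] = ad u v\<close>, where \<open>ad\<close> is the derivative of \<open>Ad\<close> at the identity.\<close>

definition lie_bracket ::
    "('g, 'r) monoid_scheme \<Rightarrow> ('g, 'm::finite) mfd \<Rightarrow> complex^'m \<Rightarrow> complex^'m \<Rightarrow> complex^'m" where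
  "lie_bracket G M u v = (case unit_chart G M of (U, \<phi>) \<Rightarrow>
     vector_derivative (\<lambda>s::real. Ad G M (inv_into U \<phi> (\<phi> \<one>\<^bsub>G\<^esub> + s *\<^sub>R u)) v) (at 0))"

definition one_parameter_subgroup ::
    "('g, 'r) monoid_scheme \<Rightarrow> ('g, 'm::finite) mfd \<Rightarrow> (real \<Rightarrow> 'g) \<Rightarrow> bool" where
  "one_parameter_subgroup G M \<gamma> \<longleftrightarrow> continuous_map euclideanreal (mtop M) \<gamma> \<and>
     (\<forall>s t. \<gamma> (s + t) = \<gamma> s \<otimes>\<^bsub>G\<^esub> \<gamma> t)"

text \<open>The Lie algebra of a closed subgroup \<open>H\<close>, as a real subspace of the Lie algebra of \<open>G\<close>.\<close>

definition lie_algebra ::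
    "('g, 'r) monoid_scheme \<Rightarrow> ('g, 'm::finite) mfd \<Rightarrow> 'g set \<Rightarrow> (complex^'m) set" where
  "lie_algebra G M H = {v. \<exists>\<gamma>. one_parameter_subgroup G M \<gamma> \<and> range \<gamma> \<subseteq> H \<and>
     ((\<lambda>t. snd (unit_chart G M) (\<gamma> t)) has_vector_derivative v) (at 0)}"

definition closed_connected_subgroup ::
    "('g, 'r) monoid_scheme \<Rightarrow> ('g, 'm::finite) mfd \<Rightarrow> 'g set \<Rightarrow> bool" where
  "closed_connected_subgroup G M H \<longleftrightarrow>
     subgroup H G \<and> closedin (mtop M) H \<and> connectedin (mtop M) H"

definition real_simple_lie_subgroup ::
    "('g, 'r) monoid_scheme \<Rightarrow> ('g, 'm::finite) mfd \<Rightarrow> 'g set \<Rightarrow> bool" where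
  "real_simple_lie_subgroup G M H \<longleftrightarrow> closed_connected_subgroup G M H \<and>
     (\<exists>u\<in>lie_algebra G M H. \<exists>v\<in>lie_algebra G M H. lie_bracket G M u v \<noteq> 0) \<and>
     (\<forall>I. subspace I \<and> I \<subseteq> lie_algebra G M H \<and>
          (\<forall>u\<in>lie_algebra G M H. \<forall>v\<in>I. lie_bracket G M u v \<in> I) \<longrightarrow>
          I = {0} \<or> I = lie_algebra G M H)"

text \<open>\<open>H\<close> is a complexification of \<open>H\<^sub>0\<close> inside \<open>G\<close>: the Lie algebra of \<open>H\<close> is the direct sum of
  that of \<open>H\<^sub>0\<close> and its multiple by the imaginary unit.\<close>

definition complexification ::
    "('g, 'r) monoid_scheme \<Rightarrow> ('g, 'm::finite) mfd \<Rightarrow> 'g set \<Rightarrow> 'g set \<Rightarrow> bool" where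
  "complexification G M H\<^sub>0 H \<longleftrightarrow> closed_connected_subgroup G M H \<and> H\<^sub>0 \<subseteq> H \<and>
     lie_algebra G M H = {u + \<i> *s v | u v. u \<in> lie_algebra G M H\<^sub>0 \<and> v \<in> lie_algebra G M H\<^sub>0} \<and>
     lie_algebra G M H\<^sub>0 \<inter> (\<lambda>v. \<i> *s v) ` lie_algebra G M H\<^sub>0 = {0}"

definition maximal_compact_subgroup ::
    "('g, 'r) monoid_scheme \<Rightarrow> ('g, 'm::finite) mfd \<Rightarrow> 'g set \<Rightarrow> 'g set \<Rightarrow> bool" where
  "maximal_compact_subgroup G M H K\<^sub>0 \<longleftrightarrow>
     subgroup K\<^sub>0 G \<and> K\<^sub>0 \<subseteq> H \<and> compactin (mtop M) K\<^sub>0 \<and>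
     (\<forall>L. subgroup L G \<and> L \<subseteq> H \<and> compactin (mtop M) L \<and> K\<^sub>0 \<subseteq> L \<longrightarrow> L = K\<^sub>0)"

section \<open>Flag domains\<close>

text \<open>The flag manifold \<open>Z = G/Q\<close> is given as a homogeneous \<open>G\<close>-manifold with \<open>Q\<close> the isotropy
  group of a base point.\<close>

definition flag_manifold ::
    "('g, 'r) monoid_scheme \<Rightarrow> ('g, 'm::finite) mfd \<Rightarrow> 'g set \<Rightarrow> ('z, 'n::finite) mfd \<Rightarrow>
     ('g \<Rightarrow> 'z \<Rightarrow> 'z) \<Rightarrow> ('z \<Rightarrow> (complex^'k) set) \<Rightarrow> bool" where
  "flag_manifold G M Q Z act \<iota> \<longleftrightarrow> complex_manifold Z \<and> projective_embedding Z \<iota> \<and>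
     transitive_action G (topspace (mtop Z)) act \<and>
     holomorphic_map (prod_mfd M Z) Z (\<lambda>(g, z). act g z) \<and>
     (\<exists>z\<in>topspace (mtop Z). Q = stabilizer G act z)"

abbreviation subgroup_orbit ::
    "('g, 'r) monoid_scheme \<Rightarrow> 'g set \<Rightarrow> ('g \<Rightarrow> 'z \<Rightarrow> 'z) \<Rightarrow> 'z \<Rightarrow> 'z set" where
  "subgroup_orbit G H act z \<equiv> orbit (G\<lparr>carrier := H\<rparr>) act z"

definition flag_domain ::
    "('g, 'r) monoid_scheme \<Rightarrow> 'g set \<Rightarrow> ('z, 'n::finite) mfd \<Rightarrow> ('g \<Rightarrow> 'z \<Rightarrow> 'z) \<Rightarrow> 'z set \<Rightarrow> bool" where
  "flag_domain G G\<^sub>0 Z act D \<longleftrightarrow> openin (mtop Z) D \<and>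
     (\<exists>z\<in>topspace (mtop Z). D = subgroup_orbit G G\<^sub>0 act z)"

text \<open>There is exactly one \<open>K\<^sub>0\<close>-orbit in \<open>D\<close> which is a complex submanifold, and it is also an orbit
  of the complexification \<open>K\<close> of \<open>K\<^sub>0\<close>; it is compact because \<open>K\<^sub>0\<close> is.\<close>

definition base_cycle ::
    "('g, 'r) monoid_scheme \<Rightarrow> 'g set \<Rightarrow> 'g set \<Rightarrow> ('z, 'n::finite) mfd \<Rightarrow> ('g \<Rightarrow> 'z \<Rightarrow> 'z) \<Rightarrow>
     'z set \<Rightarrow> 'z set \<Rightarrow> bool" where
  "base_cycle G K\<^sub>0 K Z act D C\<^sub>0 \<longleftrightarrow> C\<^sub>0 \<subseteq> D \<and> complex_submanifold Z C\<^sub>0 \<and>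
     (\<exists>z\<in>D. C\<^sub>0 = subgroup_orbit G K\<^sub>0 act z \<and> C\<^sub>0 = subgroup_orbit G K act z)"

definition cycles ::
    "('g, 'r) monoid_scheme \<Rightarrow> ('g \<Rightarrow> 'z \<Rightarrow> 'z) \<Rightarrow> 'z set \<Rightarrow> 'z set set" where
  "cycles G act C\<^sub>0 = {act g ` C\<^sub>0 | g. g \<in> carrier G}"

text \<open>The condition does not depend on \<open>p\<close> and \<open>C\<close>: as \<open>K\<^sub>0\<close> is transitive on \<open>C\<^sub>0\<close>, the group \<open>G\<close>
  permutes the pairs \<open>(p, C)\<close> with \<open>p \<in> C\<close> transitively. The isotropy group of \<open>p\<close> has exactly
  one open orbit in \<open>Z\<close>.\<close>

definition generically_1_connected ::
    "('g, 'r) monoid_scheme \<Rightarrow> ('z, 'n::finite) mfd \<Rightarrow> ('g \<Rightarrow> 'z \<Rightarrow> 'z) \<Rightarrow> 'z set \<Rightarrow> 'z set \<Rightarrow> bool" where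
  "generically_1_connected G Z act C\<^sub>0 D \<longleftrightarrow>
     (\<exists>p\<in>D. \<exists>C\<in>cycles G act C\<^sub>0. p \<in> C \<and>
        (\<exists>q\<in>topspace (mtop Z). openin (mtop Z) (subgroup_orbit G (stabilizer G act p) act q) \<and>
           C \<inter> subgroup_orbit G (stabilizer G act p) act q \<noteq> {}))"

end

theory Submission
  imports Defs
begin

no_notation fps_nth (infixl \<open>$\<close> 75)

text \<open>Call a pair \<open>(p, q)\<close> of points of \<open>Z\<close> generic if its \<open>G\<close>-orbit in \<open>Z \<times> Z\<close> has interior points. By
  homogeneity this means that the derivative of \<open>g \<mapsto> (g p, g q)\<close> is onto, in other words that the Lie
  algebras of the isotropy groups of \<open>p\<close> and \<open>q\<close> together span that of \<open>G\<close>; and this is what it means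
  that \<open>q\<close> lies in the open orbit of the isotropy group of \<open>p\<close>. So generic 1-connectedness provides a
  generic pair in some translate of the base cycle \<open>C\<close>, and since \<open>G\<close> preserves genericity and the maximal compact
  group is transitive on \<open>C\<close>, every \<open>c \<in> C\<close> has a generic partner in \<open>C\<close>.

  Let \<open>B\<close> be a small coordinate ball around the identity of \<open>G\<close>, and let \<open>Y\<close> be the union of the cycles
  \<open>g C\<close> with \<open>g \<in> B\<close>. It is open, and its closure is the union of the \<open>g C\<close> with \<open>g\<close> in the closed
  ball, a compact subset of \<open>D\<close>. Let \<open>p = g c\<close> be a boundary point of \<open>Y\<close>, so that \<open>g\<close> lies on the boundary
  sphere of \<open>B\<close>, and suppose that \<open>(c, d)\<close> is generic for some \<open>d \<in> C\<close>. The fibre \<open>{h. h c = g c}\<close> does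
  not meet \<open>B\<close>, so at \<open>g\<close> it is tangent to the sphere. If also \<open>g d\<close> were outside of \<open>Y\<close>, then the
  fibre \<open>{h. h d = g d}\<close> would be tangent to the sphere as well; but the two tangent spaces together span
  everything. Hence \<open>g d \<in> Y\<close> (\<open>generic_pair_enters_ball\<close>). It remains to find a holomorphic disk in
  \<open>C\<close> with centre \<open>c\<close> whose boundary consists of points generic with respect to \<open>c\<close>
  (\<open>disk_with_generic_boundary\<close>); its translate by \<open>g\<close> is then the required disk through \<open>p\<close>.
  Along a holomorphic curve in \<open>C\<close> that contains a generic point, the points that are not generic are zeros
  of a holomorphic determinant that does not vanish identically (\<open>generic_along_curve\<close>). So the identity theorem, propagated along complex lines in slice
  charts of the connected manifold \<open>C\<close>, shows that generic points are dense in \<open>C\<close>, and on a line from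
  \<open>c\<close> to a generic point nearby some circle around \<open>c\<close> avoids the zeros.

  The passage from orbits with interior points to surjective derivatives
  (\<open>orbit_map_surjective_derivative\<close>) combines a constant rank argument with Baire's theorem, and the
  converse is the open mapping property of maps with surjective derivative. A surjective derivative at a
  single group element is always enough, because left translations move it to any other place.\<close>

section \<open>Holomorphic maps of several variables\<close>

definition holo_curve :: "(complex \<Rightarrow> complex^'n) \<Rightarrow> complex set \<Rightarrow> bool" where
  "holo_curve g W \<longleftrightarrow> (\<forall>i. (\<lambda>\<zeta>. g \<zeta> $ i) holomorphic_on W)"

definition partial :: "(complex^'m \<Rightarrow> complex^'n) \<Rightarrow> complex^'m \<Rightarrow> complex^'m \<Rightarrow> complex^'n" where
  "partial f v z = frechet_derivative f (at z) v"

lemma has_derivative_vecI: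
  fixes f :: "'a::real_normed_vector \<Rightarrow> ('b::euclidean_space)^'n"
  assumes "\<And>i. ((\<lambda>x. f x $ i) has_derivative (\<lambda>h. f' h $ i)) (at x within S)"
  shows "(f has_derivative f') (at x within S)"
  unfolding has_derivative_componentwise_within[of f]
proof
  fix b :: "'b^'n" assume "b \<in> Basis"
  then obtain i u where b: "b = axis i u" by (auto simp: Basis_vec_def)
  show "((\<lambda>x. f x \<bullet> b) has_derivative (\<lambda>x. f' x \<bullet> b)) (at x within S)"
    unfolding b inner_axis by (rule has_derivative_inner_left[OF assms])
qed

lemma holo_on_subset: "holo_on f S \<Longrightarrow> T \<subseteq> S \<Longrightarrow> holo_on f T"
  unfolding holo_on_def by blast

lemma holo_onE:
  assumes "holo_on f S" "z \<in> S"
  obtains f' where "(f has_derivative f') (at z)" "\<And>c v. f' (c *s v) = c *s f' v"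
  using assms unfolding holo_on_def by blast

lemma holo_on_has_derivative:
  assumes "holo_on f S" "z \<in> S"
  shows "(f has_derivative (\<lambda>v. partial f v z)) (at z)"
    and "partial f (c *s v) z = c *s partial f v z"
proof -
  obtain f' where f': "(f has_derivative f') (at z)" "\<And>c v. f' (c *s v) = c *s f' v"
    using holo_onE[OF assms] by metis
  have "frechet_derivative f (at z) = f'"
    using frechet_derivative_at[OF f'(1)] by simp
  then show "(f has_derivative (\<lambda>v. partial f v z)) (at z)"
    and "partial f (c *s v) z = c *s partial f v z"
    unfolding partial_def using f' by auto
qed

lemma holo_on_continuous: "holo_on f S \<Longrightarrow> continuous_on S f"
  unfolding holo_on_def by (intro continuous_at_imp_continuous_on) (auto dest: has_derivative_continuous)

lemma holo_on_transform:
  assumes "holo_on f S" "open S" "\<And>x. x \<in> S \<Longrightarrow> f x = g x"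
  shows "holo_on g S"
  unfolding holo_on_def
proof
  fix x assume x: "x \<in> S"
  obtain f' where f': "(f has_derivative f') (at x)" "\<And>c v. f' (c *s v) = c *s f' v"
    using holo_onE[OF assms(1) x] by metis
  moreover have "(g has_derivative f') (at x)"
    by (rule has_derivative_transform_within_open[OF f'(1) assms(2) x assms(3)])
  ultimately show "\<exists>f'. (g has_derivative f') (at x) \<and> (\<forall>c v. f' (c *s v) = c *s f' v)"
    by blast
qed

lemma holo_on_compose:
  assumes "holo_on f S" "holo_on g T" "f ` S \<subseteq> T"
  shows "holo_on (g \<circ> f) S"
  unfolding holo_on_def
proof
  fix x assume x: "x \<in> S"
  obtain f' where f': "(f has_derivative f') (at x)" "\<And>c v. f' (c *s v) = c *s f' v"
    using holo_onE[OF assms(1) x] by metis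
  obtain g' where g': "(g has_derivative g') (at (f x))" "\<And>c v. g' (c *s v) = c *s g' v"
    using holo_onE[OF assms(2)] x assms(3) by blast
  have "(g \<circ> f has_derivative g' \<circ> f') (at x)"
    using diff_chain_at[OF f'(1) g'(1)] .
  then show "\<exists>f'. (g \<circ> f has_derivative f') (at x) \<and> (\<forall>c v. f' (c *s v) = c *s f' v)"
    by (intro exI[of _ "g' \<circ> f'"]) (simp add: f' g')
qed

lemma holo_curve_subset: "holo_curve g W \<Longrightarrow> V \<subseteq> W \<Longrightarrow> holo_curve g V"
  unfolding holo_curve_def using holomorphic_on_subset by blast

lemma holo_curve_continuous: "holo_curve g W \<Longrightarrow> continuous_on W g"
proof -
  assume "holo_curve g W"
  then have "continuous_on W (\<lambda>\<zeta>. \<chi> i. g \<zeta> $ i)"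
    unfolding holo_curve_def by (intro continuous_on_vec_lambda holomorphic_on_imp_continuous_on) auto
  then show ?thesis by simp
qed

lemma holo_curve_has_derivative:
  assumes "holo_curve g W" "open W" "\<zeta> \<in> W"
  shows "(g has_derivative (\<lambda>c. c *s (\<chi> i. deriv (\<lambda>\<zeta>. g \<zeta> $ i) \<zeta>))) (at \<zeta>)"
proof -
  have "((\<lambda>\<zeta>. g \<zeta> $ i) has_derivative (\<lambda>c. (c *s (\<chi> i. deriv (\<lambda>\<zeta>. g \<zeta> $ i) \<zeta>)) $ i)) (at \<zeta>)" for i
  proof -
    have "((\<lambda>\<zeta>. g \<zeta> $ i) has_field_derivative deriv (\<lambda>\<zeta>. g \<zeta> $ i) \<zeta>) (at \<zeta>)"
      using assms holomorphic_derivI unfolding holo_curve_def by blast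
    then show ?thesis by (simp add: has_field_derivative_def mult.commute mult_commute_abs)
  qed
  then show ?thesis by (rule has_derivative_vecI)
qed

lemma holo_curve_compose:
  assumes "holo_on f S" "holo_curve g W" "open W" "g ` W \<subseteq> S"
  shows "holo_curve (\<lambda>\<zeta>. f (g \<zeta>)) W"
  unfolding holo_curve_def
proof
  fix i
  show "(\<lambda>\<zeta>. f (g \<zeta>) $ i) holomorphic_on W"
    unfolding holomorphic_on_def
  proof
    fix \<zeta> assume z: "\<zeta> \<in> W"
    let ?v = "\<chi> i. deriv (\<lambda>\<zeta>. g \<zeta> $ i) \<zeta>"
    obtain f' where f': "(f has_derivative f') (at (g \<zeta>))" "\<And>c v. f' (c *s v) = c *s f' v"
      using holo_onE[OF assms(1)] assms(4) z by blast
    have "(f \<circ> g has_derivative (f' \<circ> (\<lambda>c. c *s ?v))) (at \<zeta>)"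
      using diff_chain_at[OF holo_curve_has_derivative[OF assms(2,3) z] f'(1)] .
    then have "((\<lambda>x. (f \<circ> g) x $ i) has_derivative (\<lambda>c. (f' \<circ> (\<lambda>c. c *s ?v)) c $ i)) (at \<zeta>)"
      using bounded_linear.has_derivative[OF bounded_linear_vec_nth] by blast
    then have "((\<lambda>x. f (g x) $ i) has_derivative (\<lambda>c. c * f' ?v $ i)) (at \<zeta>)"
      by (simp add: o_def f')
    then have "((\<lambda>x. f (g x) $ i) has_field_derivative f' ?v $ i) (at \<zeta>)"
      by (simp add: has_field_derivative_def mult_commute_abs)
    then show "(\<lambda>x. f (g x) $ i) field_differentiable at \<zeta> within W"
      using field_differentiable_at_within field_differentiable_def by blast
  qed
qed

lemma holo_curve_line: "holo_curve (\<lambda>\<zeta>. z + \<zeta> *s v) W"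
  unfolding holo_curve_def by (auto intro!: holomorphic_intros)

text \<open>Taylor's formula, with the second derivative bounded by Cauchy's inequality. The constant depends on
  \<open>h\<close> only through its bound \<open>B\<close>, hence is uniform over families of functions.\<close>

lemma difference_quotient_estimate:
  assumes h: "h holomorphic_on ball 0 \<rho>" and r: "0 < r" "2 * r < \<rho>"
    and M: "\<And>s. s \<in> ball 0 \<rho> \<Longrightarrow> cmod (h s) \<le> B" and s: "cmod s \<le> r"
  shows "cmod (h s - h 0 - deriv h 0 * s) \<le> 2 * B / r\<^sup>2 * (cmod s)\<^sup>2"
proof -
  have sub: "cball x r \<subseteq> ball 0 \<rho>" if "x \<in> cball 0 r" for x :: complex
  proof
    fix y assume "y \<in> cball x r"
    then show "y \<in> ball 0 \<rho>" using that r norm_triangle_ineq[of x "y - x"]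
      by (simp add: dist_norm norm_minus_commute)
  qed
  have B2: "cmod ((deriv ^^ 2) h x) \<le> 2 * B / r\<^sup>2" if "x \<in> cball 0 r" for x
  proof -
    have "cmod ((deriv ^^ 2) h x) \<le> fact 2 * B / r ^ 2"
    proof (rule Cauchy_inequality)
      show "h holomorphic_on ball x r"
        using h sub[OF that] holomorphic_on_subset ball_subset_cball by (metis subset_trans)
      show "continuous_on (cball x r) h"
        using h sub[OF that] holomorphic_on_imp_continuous_on holomorphic_on_subset by blast
      show "cmod (h y) \<le> B" if "norm (x - y) = r" for y
        using M sub[OF \<open>x \<in> cball 0 r\<close>] that by (metis dist_norm mem_cball order_refl subsetD)
    qed (use r in auto)
    then show ?thesis by simp
  qed
  have "cmod ((deriv ^^ 0) h s - (\<Sum>i\<le>1. (deriv ^^ i) h 0 * (s - 0) ^ i / fact i)) \<le> 2 * B / r\<^sup>2 * cmod (s - 0) ^ Suc 1 / fact 1"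
  proof (rule complex_Taylor[where S = "cball 0 r" and n = 1 and f = "\<lambda>i. (deriv ^^ i) h"])
    show "((deriv ^^ i) h has_field_derivative (deriv ^^ Suc i) h x) (at x within cball 0 r)"
      if "x \<in> cball 0 r" for i x
    proof -
      have "x \<in> ball 0 \<rho>" using that r by auto
      moreover have "(deriv ^^ i) h holomorphic_on ball 0 \<rho>"
        using h holomorphic_higher_deriv by blast
      ultimately show ?thesis
        using holomorphic_derivI[of "(deriv ^^ i) h" "ball 0 \<rho>" x "cball 0 r"] by simp
    qed
    show "cmod ((deriv ^^ Suc 1) h x) \<le> 2 * B / r\<^sup>2" if "x \<in> cball 0 r" for x
      using B2[OF that] by (simp add: numeral_2_eq_2)
  qed (use s r in auto)
  then show ?thesis by (simp add: power2_eq_square algebra_simps numeral_2_eq_2)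
qed

lemma holo_on_line_deriv:
  assumes "holo_on f S" "z \<in> S"
  shows "((\<lambda>s. f (z + s *s v) $ i) has_field_derivative partial f v z $ i) (at 0)"
proof -
  have "((\<lambda>s. z + s *s v) has_derivative (\<lambda>s. s *s v)) (at 0)"
  proof -
    have "(\<chi> i. deriv (\<lambda>\<zeta>. (z + \<zeta> *s v) $ i) 0) = v"
      by (auto simp: vec_eq_iff intro!: DERIV_imp_deriv derivative_eq_intros)
    then show ?thesis
      using holo_curve_has_derivative[OF holo_curve_line[of z v UNIV], of 0] by simp
  qed
  then have "(f \<circ> (\<lambda>s. z + s *s v) has_derivative ((\<lambda>v. partial f v z) \<circ> (\<lambda>s. s *s v))) (at 0)"
    using diff_chain_at[of "\<lambda>s. z + s *s v" _ 0] holo_on_has_derivative(1)[OF assms] by simp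
  then have "((\<lambda>x. (f \<circ> (\<lambda>s. z + s *s v)) x $ i) has_derivative (\<lambda>c. ((\<lambda>v. partial f v z) \<circ> (\<lambda>s. s *s v)) c $ i)) (at 0)"
    using bounded_linear.has_derivative[OF bounded_linear_vec_nth] by blast
  then show ?thesis
    by (simp add: o_def holo_on_has_derivative(2)[OF assms] has_field_derivative_def mult_commute_abs)
qed

lemma norm_scaleC: "norm (c *s (v :: complex^'n)) = cmod c * norm v"
  by (simp add: norm_vec_def norm_mult L2_set_right_distrib)

text \<open>Locally uniform convergence of the difference quotients is what transfers continuity and holomorphy
  from \<open>f\<close> to its derivatives, while \<open>holo_on\<close> only provides a derivative at each single point.\<close>

lemma partial_uniform_limit:
  assumes f: "holo_on f S" and S: "open S" and z0: "z0 \<in> S"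
  obtains r where "0 < r" "cball z0 r \<subseteq> S"
    "\<forall>\<^sub>F n in sequentially. \<forall>z\<in>cball z0 r. z + of_real (1 / Suc n) *s v \<in> S"
    "\<And>i. uniform_limit (cball z0 r)
       (\<lambda>n z. (of_nat (Suc n)) * (f (z + of_real (1 / Suc n) *s v) $ i - f z $ i)) (\<lambda>z. partial f v z $ i) sequentially"
proof -
  obtain R where "0 < R" "cball z0 R \<subseteq> S"
    using S z0 open_contains_cball by blast
  then obtain r where r: "0 < r" "cball z0 (2 * r) \<subseteq> S"
    using that[of "R / 2"] by simp
  \<comment> \<open>for \<open>cmod s < \<rho>\<close> a step \<open>s *s v\<close> from the ball of radius \<open>r\<close> stays in that of radius \<open>2 * r\<close>\<close>
  define \<rho> where "\<rho> = r / (norm v + 1)"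
  have \<rho>: "0 < \<rho>" unfolding \<rho>_def using r by (simp add: add_nonneg_pos)
  have in2: "z + s *s v \<in> cball z0 (2 * r)" if "z \<in> cball z0 r" "cmod s < \<rho>" for z s
  proof -
    have "norm (s *s v) \<le> \<rho> * (norm v + 1)"
      unfolding norm_scaleC using that \<rho> by (intro mult_mono) auto
    also have "\<dots> = r" unfolding \<rho>_def by (simp add: add_nonneg_eq_0_iff)
    finally have "norm (s *s v) \<le> r" .
    moreover have "dist z0 (z + s *s v) \<le> dist z0 z + norm (s *s v)"
      using norm_triangle_ineq4[of "z0 - z" "s *s v"] by (simp add: dist_norm algebra_simps)
    ultimately show ?thesis using that by simp
  qed
  have small: "\<forall>\<^sub>F n in sequentially. 1 / real (Suc n) < e" if "0 < e" for e
    using LIMSEQ_inverse_real_of_nat that by (simp add: tendsto_iff inverse_eq_divide)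
  have "compact (f ` cball z0 (2 * r))"
    using r by (intro compact_continuous_image continuous_on_subset[OF holo_on_continuous[OF f]]) auto
  then obtain B where B: "\<And>z. z \<in> cball z0 (2 * r) \<Longrightarrow> norm (f z) \<le> B"
    using compact_imp_bounded[of "f ` cball z0 (2 * r)"] unfolding bounded_iff by blast
  have B0: "0 \<le> B" using B[of z0] r by (auto intro: order_trans[OF norm_ge_zero])
  show ?thesis
  proof (rule that[of r])
    show "cball z0 r \<subseteq> S" using r subset_cball[of r "2 * r" z0] by auto
    show "\<forall>\<^sub>F n in sequentially. \<forall>z\<in>cball z0 r. z + of_real (1 / Suc n) *s v \<in> S"
      using small[OF \<rho>]
    proof eventually_elim
      case (elim n)
      then show ?case using in2 r(2) by (metis (no_types, lifting) norm_of_real abs_of_nonneg of_nat_0_le_iff divide_nonneg_nonneg zero_le_one subsetD)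
    qed
    fix i
    define C where "C = 2 * B / (\<rho> / 3)\<^sup>2"
    have C0: "0 \<le> C" unfolding C_def using B0 \<rho> by simp
    have est: "norm (of_nat (Suc n) * (f (z + of_real (1 / Suc n) *s v) $ i - f z $ i) - partial f v z $ i) \<le> C * (1 / Suc n)"
      if z: "z \<in> cball z0 r" and n: "1 / real (Suc n) < \<rho> / 3" for z n
    proof -
      define s where "s = complex_of_real (1 / Suc n)"
      define h where "h = (\<lambda>s. f (z + s *s v) $ i)"
      have hh: "h holomorphic_on ball 0 \<rho>"
        using holo_curve_compose[OF f holo_curve_line[of z v "ball 0 \<rho>"]] in2[OF z] r
        unfolding holo_curve_def h_def by force
      have zS: "z \<in> S" using z \<open>cball z0 r \<subseteq> S\<close> by blast
      have d: "deriv h 0 = partial f v z $ i"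
        unfolding h_def using holo_on_line_deriv[OF f zS] by (rule DERIV_imp_deriv)
      have cs: "cmod s = 1 / Suc n" unfolding s_def by (metis norm_of_real abs_of_nonneg of_nat_0_le_iff divide_nonneg_nonneg zero_le_one)
      have "cmod (h s - h 0 - deriv h 0 * s) \<le> C * (cmod s)\<^sup>2"
        unfolding C_def
      proof (rule difference_quotient_estimate[OF hh])
        show "cmod (h s) \<le> B" if "s \<in> ball 0 \<rho>" for s
          using order_trans[OF Finite_Cartesian_Product.norm_nth_le B[OF in2[OF z, of s]]] that
          unfolding h_def by simp
      qed (use \<rho> n cs in auto)
      moreover have "of_nat (Suc n) * (h s - h 0) - deriv h 0 = of_nat (Suc n) * (h s - h 0 - deriv h 0 * s)"
      proof -
        have "of_nat (Suc n) * s = 1" unfolding s_def by (simp add: of_real_divide del: of_nat_Suc)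
        then show ?thesis by (metis (no_types, opaque_lifting) mult.commute mult.left_commute mult.right_neutral right_diff_distrib)
      qed
      ultimately have "cmod (of_nat (Suc n) * (h s - h 0) - deriv h 0) \<le> Suc n * (C * (1 / Suc n)\<^sup>2)"
        unfolding norm_mult cs by (metis (no_types, lifting) mult_left_mono norm_mult norm_of_nat of_nat_0_le_iff)
      also have "\<dots> = C * (1 / Suc n)" by (simp add: power2_eq_square)
      finally show ?thesis unfolding d by (simp add: h_def s_def)
    qed
    show "uniform_limit (cball z0 r)
       (\<lambda>n z. (of_nat (Suc n)) * (f (z + of_real (1 / Suc n) *s v) $ i - f z $ i)) (\<lambda>z. partial f v z $ i) sequentially"
      unfolding uniform_limit_iff
    proof (intro allI impI)
      fix e :: real assume e: "0 < e"
      have eC: "0 < e / (C + 1)" using e C0 by simp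
      show "\<forall>\<^sub>F n in sequentially. \<forall>z\<in>cball z0 r. dist (of_nat (Suc n) * (f (z + of_real (1 / Suc n) *s v) $ i - f z $ i)) (partial f v z $ i) < e"
      proof (rule eventually_mono[OF eventually_conj[OF small small]])
        fix n assume n: "1 / real (Suc n) < \<rho> / 3 \<and> 1 / real (Suc n) < e / (C + 1)"
        have "C * (1 / Suc n) \<le> C * (e / (C + 1))" using n C0 by (intro mult_left_mono) auto
        also have "\<dots> < e" using C0 e by (simp add: field_simps)
        finally have "C * (1 / Suc n) < e" .
        then show "\<forall>z\<in>cball z0 r. dist (of_nat (Suc n) * (f (z + of_real (1 / Suc n) *s v) $ i - f z $ i)) (partial f v z $ i) < e"
          using est[of _ n] n unfolding dist_norm by (meson le_less_trans)
      qed (use \<rho> eC in auto)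
    qed
  qed (use r in auto)
qed

lemma holo_on_partial_continuous:
  assumes f: "holo_on f S" and S: "open S"
  shows "continuous_on S (\<lambda>z. partial f v z)"
proof -
  have "isCont (\<lambda>z. partial f v z $ i) z0" if z0: "z0 \<in> S" for z0 i
  proof -
    obtain r where r: "0 < r" "cball z0 r \<subseteq> S" 
      and ev: "\<forall>\<^sub>F n in sequentially. \<forall>z\<in>cball z0 r. z + of_real (1 / Suc n) *s v \<in> S"
      and ul: "\<And>i. uniform_limit (cball z0 r)
       (\<lambda>n z. (of_nat (Suc n)) * (f (z + of_real (1 / Suc n) *s v) $ i - f z $ i)) (\<lambda>z. partial f v z $ i) sequentially"
      by (rule partial_uniform_limit[OF f S z0, of v]) (rule that)
    have "continuous_on (cball z0 r) (\<lambda>z. partial f v z $ i)"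
    proof (rule uniform_limit_theorem[OF _ ul])
      show "\<forall>\<^sub>F n in sequentially. continuous_on (cball z0 r) (\<lambda>z. of_nat (Suc n) * (f (z + of_real (1 / Suc n) *s v) $ i - f z $ i))"
        using ev
      proof eventually_elim
        case (elim n)
        show ?case
        proof -
          have c1: "continuous_on (cball z0 r) (\<lambda>z. f (z + of_real (1 / Suc n) *s v))"
            by (rule continuous_on_compose2[OF holo_on_continuous[OF f]])
              (use elim in \<open>auto intro!: continuous_intros\<close>)
          have c2: "continuous_on (cball z0 r) f"
            using continuous_on_subset[OF holo_on_continuous[OF f] r(2)] .
          show ?thesis by (intro continuous_intros c1 c2)
        qed
      qed
    qed simp
    then show ?thesis using r
      by (metis (no_types, lifting) ball_subset_cball centre_in_ball continuous_on_eq_continuous_at continuous_on_subset open_ball)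
  qed
  then have "continuous_on S (\<lambda>z. \<chi> i. partial f v z $ i)"
    by (intro continuous_on_vec_lambda continuous_at_imp_continuous_on) auto
  then show ?thesis by simp
qed

lemma holo_curve_partial:
  assumes f: "holo_on f S" and S: "open S" and g: "holo_curve g W" and W: "open W" and gW: "g ` W \<subseteq> S"
  shows "holo_curve (\<lambda>\<zeta>. partial f v (g \<zeta>)) W"
proof -
  have "(\<lambda>\<zeta>. partial f v (g \<zeta>) $ i) field_differentiable (at \<zeta>0)" if \<zeta>0: "\<zeta>0 \<in> W" for \<zeta>0 i
  proof -
    have z0: "g \<zeta>0 \<in> S" using \<zeta>0 gW by auto
    obtain r where r: "0 < r" "cball (g \<zeta>0) r \<subseteq> S" 
      and ev: "\<forall>\<^sub>F n in sequentially. \<forall>z\<in>cball (g \<zeta>0) r. z + of_real (1 / Suc n) *s v \<in> S"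
      and ul: "\<And>i. uniform_limit (cball (g \<zeta>0) r)
       (\<lambda>n z. (of_nat (Suc n)) * (f (z + of_real (1 / Suc n) *s v) $ i - f z $ i)) (\<lambda>z. partial f v z $ i) sequentially"
      by (rule partial_uniform_limit[OF f S z0, of v]) (rule that)
    have "open (W \<inter> g -` ball (g \<zeta>0) r)"
      using holo_curve_continuous[OF g] W by (simp add: continuous_open_preimage)
    then obtain d where d: "0 < d" "cball \<zeta>0 d \<subseteq> W \<inter> g -` ball (g \<zeta>0) r"
      using \<zeta>0 r open_contains_cball by (metis IntI centre_in_ball vimageI)
    let ?q = "\<lambda>n \<zeta>. (of_nat (Suc n)) * (f (g \<zeta> + of_real (1 / Suc n) *s v) $ i - f (g \<zeta>) $ i)"
    have ul2: "uniform_limit (cball \<zeta>0 d) ?q (\<lambda>\<zeta>. partial f v (g \<zeta>) $ i) sequentially"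
      using uniform_limit_compose'[OF ul[of i], of g "cball \<zeta>0 d"] d(2) by (fastforce simp: Pi_def)
    have "(\<lambda>\<zeta>. partial f v (g \<zeta>) $ i) holomorphic_on ball \<zeta>0 d"
    proof (rule holomorphic_uniform_limit[OF _ ul2])
      show "\<forall>\<^sub>F n in sequentially. continuous_on (cball \<zeta>0 d) (?q n) \<and> (?q n) holomorphic_on ball \<zeta>0 d"
        using ev
      proof eventually_elim
        case (elim n)
        let ?V = "W \<inter> g -` ball (g \<zeta>0) r"
        have gV: "holo_curve g ?V" using g holo_curve_subset by blast
        have 1: "(\<lambda>\<zeta>. f (g \<zeta>) $ i) holomorphic_on ?V"
          using holo_curve_compose[OF f gV \<open>open ?V\<close>] r gW unfolding holo_curve_def by blast
        have gV': "holo_curve (\<lambda>\<zeta>. g \<zeta> + of_real (1 / Suc n) *s v) ?V"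
          using gV unfolding holo_curve_def by (auto intro!: holomorphic_intros)
        have 2: "(\<lambda>\<zeta>. f (g \<zeta> + of_real (1 / Suc n) *s v) $ i) holomorphic_on ?V"
        proof -
          have "(\<lambda>\<zeta>. g \<zeta> + of_real (1 / Suc n) *s v) ` ?V \<subseteq> S" using elim by auto
          then show ?thesis
            using holo_curve_compose[OF f gV' \<open>open ?V\<close>] unfolding holo_curve_def by blast
        qed
        have "(?q n) holomorphic_on ?V" using 1 2 by (intro holomorphic_intros)
        then show ?case using d ball_subset_cball
          by (meson dual_order.trans holomorphic_on_imp_continuous_on holomorphic_on_subset)
      qed
    qed auto
    then show ?thesis
      by (rule holomorphic_on_imp_differentiable_at) (use d(1) in auto)
  qed
  then show ?thesis unfolding holo_curve_def holomorphic_on_def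
    by (simp add: field_differentiable_at_within)
qed

section \<open>Images under maps whose derivative is nowhere surjective\<close>

lemma linear_kernel_trivial_if_dim_le:
  fixes s :: "'a::euclidean_space \<Rightarrow> 'b::euclidean_space"
  assumes s: "linear s" and V: "subspace V" and d: "dim V \<le> dim (s ` V)" and w: "w \<in> V" "s w = 0"
  shows "w = 0"
proof -
  obtain t where t: "range t \<subseteq> V" "linear t" "\<And>y. y \<in> s ` V \<Longrightarrow> s (t y) = y"
    using linear_exists_right_inverse_on[OF s V] by blast
  have sV: "subspace (s ` V)" using linear_subspace_image[OF s V] .
  have inj: "inj_on t (s ` V)" using t(3) by (metis inj_onI)
  have "dim (t ` (s ` V)) = dim (s ` V)"
    using t(2) inj sV by (intro dim_image_eq) (auto simp: span_eq_iff[THEN iffD2])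
  then have "t ` (s ` V) = V"
    using d t(1) V sV t(2) s by (intro subspace_dim_equal linear_subspace_image) auto
  then obtain u where u: "u \<in> V" "w = t (s u)" using w(1) by blast
  then have "s u = 0" using t(3) w(2) by auto
  then show ?thesis using u t(2) linear_0 by metis
qed

lemma linear_generalized_inverse:
  fixes A :: "'a::euclidean_space \<Rightarrow> 'b::euclidean_space"
  assumes A: "linear A"
  obtains s where "linear s" "\<And>x. A (s (A x)) = A x" "\<And>y. s (A (s y)) = s y"
proof -
  obtain t where t: "linear t" "\<And>y. y \<in> range A \<Longrightarrow> A (t y) = y"
    using linear_exists_right_inverse_on[OF A subspace_UNIV] by blast
  show ?thesis
  proof (rule that[of "t \<circ> A \<circ> t"])
    show "linear (t \<circ> A \<circ> t)" using t(1) A by (intro linear_compose)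
  qed (use t in auto)
qed

lemma constant_on_kernel_directions:
  fixes h :: "'a::euclidean_space \<Rightarrow> 'b::euclidean_space"
  assumes S: "convex S" and h: "\<And>y. y \<in> S \<Longrightarrow> (h has_derivative h' y) (at y)"
    and z: "\<And>y. y \<in> S \<Longrightarrow> h' y (b - a) = 0" and ab: "a \<in> S" "b \<in> S"
  shows "h a = h b"
proof -
  define l where "l = (\<lambda>t::real. a + t *\<^sub>R (b - a))"
  have lS: "l t \<in> S" if "t \<in> {0..1}" for t
    using convexD_alt[OF S ab, of t] that unfolding l_def by (simp add: algebra_simps)
  have dl: "(l has_derivative (\<lambda>t. t *\<^sub>R (b - a))) (at t)" for t
    unfolding l_def by (auto intro!: derivative_eq_intros)
  have "(h \<circ> l) 0 = (h \<circ> l) 1"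
  proof (rule has_derivative_zero_unique[of "{0..1::real}"])
    fix t :: real assume t: "t \<in> {0..1}"
    have "(h \<circ> l has_derivative h' (l t) \<circ> (\<lambda>t. t *\<^sub>R (b - a))) (at t)"
      using diff_chain_at[OF dl h[OF lS[OF t]]] .
    moreover have "h' (l t) \<circ> (\<lambda>t. t *\<^sub>R (b - a)) = (\<lambda>_. 0)"
      using z[OF lS[OF t]] h[OF lS[OF t], THEN has_derivative_linear] by (auto simp: linear_cmul)
    ultimately show "(h \<circ> l has_derivative (\<lambda>_. 0)) (at t within {0..1})"
      by (simp add: has_derivative_at_withinI)
  qed auto
  then show ?thesis by (simp add: l_def)
qed

text \<open>The constant rank theorem in the form needed here. With a generalized inverse \<open>s\<close> of the derivative
  at \<open>x0\<close> and \<open>\<pi> = s \<circ> f' x0\<close>, the map \<open>\<Theta> = s \<circ> f + id - \<pi>\<close> is a local diffeomorphism; maximality of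
  the rank forces \<open>f \<circ> \<Theta>\<inverse>\<close> to be constant in the directions of the kernel of \<open>\<pi>\<close>. So locally the image of
  \<open>f\<close> is the differentiable image of a piece of the proper subspace \<open>range (f' x0)\<close>.\<close>

lemma negligible_image_near_max_rank:
  fixes f :: "'a::euclidean_space \<Rightarrow> 'b::euclidean_space" and f' :: "'a \<Rightarrow> 'a \<Rightarrow>\<^sub>L 'b"
  assumes S: "open S" and der: "\<And>x. x \<in> S \<Longrightarrow> (f has_derivative blinfun_apply (f' x)) (at x)"
    and cont: "continuous_on S f'" and x0: "x0 \<in> S"
    and mx: "\<And>x. x \<in> S \<Longrightarrow> dim (range (blinfun_apply (f' x))) \<le> dim (range (blinfun_apply (f' x0)))"
    and low: "dim (range (blinfun_apply (f' x0))) < DIM('b)"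
  obtains T where "open T" "x0 \<in> T" "T \<subseteq> S" "negligible (f ` T)"
proof -
  let ?A = "blinfun_apply (f' x0)"
  have linA: "linear ?A" by (simp add: blinfun.bounded_linear_right bounded_linear.linear)
  obtain s where s: "linear s" "\<And>x. ?A (s (?A x)) = ?A x" "\<And>y. s (?A (s y)) = s y"
    using linear_generalized_inverse[OF linA] by metis
  define \<pi> where "\<pi> = s \<circ> ?A"
  have lin\<pi>: "linear \<pi>" unfolding \<pi>_def using linear_compose[OF linA s(1)] .
  have idem: "\<pi> (\<pi> x) = \<pi> x" for x by (simp add: \<pi>_def s)
  have \<pi>s: "\<pi> (s y) = s y" for y by (simp add: \<pi>_def s)
  have A\<pi>: "?A (\<pi> x) = ?A x" for x by (simp add: \<pi>_def s)
  have rank\<pi>: "dim (range \<pi>) = dim (range ?A)"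
  proof (rule antisym)
    show "dim (range \<pi>) \<le> dim (range ?A)"
      unfolding \<pi>_def image_comp[symmetric] by (rule dim_image_le[OF s(1)])
    have "range ?A = ?A ` range \<pi>" using A\<pi> by (metis (no_types, lifting) image_cong image_image)
    then show "dim (range ?A) \<le> dim (range \<pi>)" using dim_image_le[OF linA, of "range \<pi>"] by simp
  qed
  define \<Theta> where "\<Theta> = (\<lambda>x. s (f x) + x - \<pi> x)"
  have bs: "bounded_linear s" and bp: "bounded_linear \<pi>"
    using s(1) lin\<pi> linear_conv_bounded_linear by auto
  define \<Theta>' where "\<Theta>' = (\<lambda>x. (Blinfun s o\<^sub>L f' x) + id_blinfun - Blinfun \<pi>)"
  have \<Theta>'app: "blinfun_apply (\<Theta>' x) v = s (blinfun_apply (f' x) v) + v - \<pi> v" for x v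
    unfolding \<Theta>'_def by (simp add: blinfun.add_left blinfun.diff_left bounded_linear_Blinfun_apply bs bp)
  have der\<Theta>: "(\<Theta> has_derivative blinfun_apply (\<Theta>' x)) (at x)" if "x \<in> S" for x
    unfolding \<Theta>_def \<Theta>'app
    by (intro has_derivative_diff has_derivative_add has_derivative_ident
        bounded_linear.has_derivative[OF bs] der that bounded_linear_imp_has_derivative bp)
  have cont\<Theta>: "continuous_on S \<Theta>'"
    unfolding \<Theta>'_def by (intro continuous_intros cont)
  have "id_blinfun o\<^sub>L \<Theta>' x0 = id_blinfun"
    by (rule blinfun_eqI) (simp add: \<Theta>'app \<pi>_def)
  from inverse_function_theorem[OF S der\<Theta> cont\<Theta> x0 this]
  obtain U V g g' where U: "open U" "U \<subseteq> S" "x0 \<in> U" and V: "open V" "\<Theta> x0 \<in> V" and hom: "homeomorphism U V \<Theta> g"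
    and g: "\<And>y. y \<in> V \<Longrightarrow> (g has_derivative (g' y)) (at y)"
      "\<And>y. y \<in> V \<Longrightarrow> g' y = inv_into UNIV (blinfun_apply (\<Theta>'(g y)))" "\<And>y. y \<in> V \<Longrightarrow> bij (blinfun_apply (\<Theta>'(g y)))"
    by metis
  have gU: "g y \<in> U" if "y \<in> V" for y using hom that unfolding homeomorphism_def by blast
  define h where "h = f \<circ> g"
  have derh: "(h has_derivative (\<lambda>v. blinfun_apply (f' (g y)) (g' y v))) (at y)" if "y \<in> V" for y
    using diff_chain_at[OF g(1)[OF that] der[of "g y"]] gU[OF that] U(2) unfolding h_def o_def by blast
  have kern: "blinfun_apply (f' (g y)) (g' y v) = 0" if y: "y \<in> V" and v: "\<pi> v = 0" for y v
  proof -
    let ?B = "blinfun_apply (f' (g y))" and ?T = "blinfun_apply (\<Theta>' (g y))"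
    have linB: "linear ?B" by (simp add: blinfun.bounded_linear_right bounded_linear.linear)
    have piT: "\<pi> (?T u) = s (?B u)" for u
      unfolding \<Theta>'app using lin\<pi> by (simp add: linear_add linear_diff idem \<pi>s)
    define u where "u = g' y v"
    have "?T u = v" unfolding u_def g(2)[OF y] using g(3)[OF y] by (simp add: bij_is_surj surj_f_inv_f)
    then have su: "s (?B u) = 0" using piT[of u] v by simp
    have "range \<pi> = s ` range ?B"
      using piT bij_is_surj[OF g(3)[OF y]] by (metis (no_types, lifting) image_cong image_image)
    then have "dim (range ?B) \<le> dim (s ` range ?B)"
      using mx[of "g y"] gU[OF y] U(2) rank\<pi> by auto
    then show ?thesis
      using linear_kernel_trivial_if_dim_le[OF s(1) linear_subspace_image[OF linB subspace_UNIV] _ _ su]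
      unfolding u_def by blast
  qed
  define y0 where "y0 = \<Theta> x0"
  obtain d where d: "0 < d" "ball y0 d \<subseteq> V" using V unfolding y0_def open_contains_ball by blast
  \<comment> \<open>the projection along the kernel of \<open>\<pi>\<close>, normalized to fix \<open>y0\<close>; \<open>h\<close> factors through it\<close>
  define p where "p = (\<lambda>y. y0 + \<pi> (y - y0))"
  have contp: "continuous_on UNIV p"
    unfolding p_def by (intro continuous_on_add continuous_on_const bounded_linear.continuous_on[OF bp]
        continuous_on_diff continuous_on_id)
  have "p y0 = y0" unfolding p_def using lin\<pi> by (simp add: linear_0)
  define V' where "V' = ball y0 d \<inter> p -` ball y0 d"
  have V': "open V'" "y0 \<in> V'"
    unfolding V'_def using contp d(1) \<open>p y0 = y0\<close> by (auto intro!: open_Int open_vimage)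
  have hp: "h y = h (p y)" if "y \<in> V'" for y
  proof (rule constant_on_kernel_directions[of "ball y0 d" h "\<lambda>y v. blinfun_apply (f' (g y)) (g' y v)"])
    show "blinfun_apply (f' (g z)) (g' z (p y - y)) = 0" if "z \<in> ball y0 d" for z
      by (rule kern) (use that d(2) lin\<pi> in \<open>auto simp: p_def linear_diff linear_add idem\<close>)
  qed (use that d(2) derh in \<open>auto simp: V'_def\<close>)
  define W where "W = range ?A \<inter> (\<lambda>w. y0 + s w) -` ball y0 d"
  have "dim W \<le> dim (range ?A)" unfolding W_def by (intro dim_subset) auto
  then have negW: "negligible W" using low by (intro negligible_lowdim) auto
  have "(\<lambda>w. h (y0 + s w)) differentiable_on W"
    unfolding differentiable_on_def differentiable_def
  proof
    fix w assume w: "w \<in> W"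
    have 1: "((\<lambda>w. y0 + s w) has_derivative s) (at w)"
      using bs by (auto intro!: derivative_eq_intros bounded_linear_imp_has_derivative)
    have "y0 + s w \<in> V" using w d(2) unfolding W_def by auto
    from diff_chain_at[OF 1 derh[OF this]]
    show "\<exists>D. ((\<lambda>w. h (y0 + s w)) has_derivative D) (at w within W)"
      unfolding o_def using has_derivative_at_withinI by blast
  qed
  then have neg: "negligible ((\<lambda>w. h (y0 + s w)) ` W)"
    using negligible_differentiable_image_negligible[OF order_refl negW] by blast
  define T where "T = U \<inter> \<Theta> -` V'"
  have cT: "continuous_on U \<Theta>" using hom unfolding homeomorphism_def by blast
  show ?thesis
  proof (rule that)
    show "open T" unfolding T_def using cT U(1) V'(1) by (rule continuous_open_preimage)
    show "x0 \<in> T" "T \<subseteq> S" unfolding T_def using U V'(2) y0_def by auto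
    show "negligible (f ` T)"
    proof (rule negligible_subset[OF neg], rule)
      fix z assume "z \<in> f ` T"
      then obtain x where x: "x \<in> U" "\<Theta> x \<in> V'" "z = f x" unfolding T_def by blast
      define y where "y = \<Theta> x"
      have "g y = x" using hom x(1) unfolding y_def homeomorphism_def by blast
      then have "z = h (p y)" using hp[of y] x unfolding y_def h_def by simp
      moreover have "p y = y0 + s (?A (y - y0))" unfolding p_def \<pi>_def by simp
      moreover have "?A (y - y0) \<in> W"
        using x(2) \<open>p y = _\<close> unfolding W_def V'_def y_def by auto
      ultimately show "z \<in> (\<lambda>w. h (y0 + s w)) ` W" by auto
    qed
  qed
qed

text \<open>As ranks are bounded, there is a point of maximal rank. For the image of all of \<open>S\<close> the conclusion may
  fail, as \<open>f\<close> is only continuously differentiable and the source may have the larger dimension.\<close>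

lemma negligible_image_nowhere_surjective:
  fixes f :: "'a::euclidean_space \<Rightarrow> 'b::euclidean_space"
  assumes S: "open S" "S \<noteq> {}" and der: "\<And>x. x \<in> S \<Longrightarrow> (f has_derivative f' x) (at x)"
    and cont: "\<And>v. continuous_on S (\<lambda>x. f' x v)" and nsurj: "\<And>x. x \<in> S \<Longrightarrow> \<not> surj (f' x)"
  obtains T where "open T" "T \<noteq> {}" "T \<subseteq> S" "negligible (f ` T)"
proof -
  define F where "F = (\<lambda>x. Blinfun (f' x))"
  have F: "blinfun_apply (F x) = f' x" if "x \<in> S" for x
    unfolding F_def using der[OF that] has_derivative_bounded_linear bounded_linear_Blinfun_apply by blast
  have cF: "continuous_on S F"
  proof (rule continuous_on_blinfun_componentwise)
    fix i :: 'a
    show "continuous_on S (\<lambda>x. blinfun_apply (F x) i)"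
      using continuous_on_cong[of S S "\<lambda>x. blinfun_apply (F x) i" "\<lambda>x. f' x i"] cont F by simp
  qed
  have lin: "linear (blinfun_apply (F x))" for x
    by (simp add: blinfun.bounded_linear_right bounded_linear.linear)
  define r where "r = (\<lambda>x. dim (range (blinfun_apply (F x))))"
  have le: "r x \<le> DIM('b)" for x unfolding r_def by (rule dim_subset_UNIV)
  define R where "R = Max (r ` S)"
  have fin: "finite (r ` S)" by (rule finite_subset[of _ "{..DIM('b)}"]) (use le in auto)
  obtain x0 where x0: "x0 \<in> S" "r x0 = R" unfolding R_def using Max_in[OF fin] S(2) by (metis (no_types, lifting) image_iff image_is_empty)
  have mx: "r x \<le> r x0" if "x \<in> S" for x unfolding x0(2) R_def using fin that by auto
  have "r x0 < DIM('b)"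
  proof (rule ccontr)
    assume "\<not> r x0 < DIM('b)"
    then have "dim (range (blinfun_apply (F x0))) = DIM('b)" using le[of x0] unfolding r_def by linarith
    then have "span (range (blinfun_apply (F x0))) = UNIV" using dim_eq_full by blast
    moreover have "span (range (blinfun_apply (F x0))) = range (blinfun_apply (F x0))"
      using linear_subspace_image[OF lin subspace_UNIV] by (simp add: span_eq_iff)
    ultimately show False using nsurj[OF x0(1)] F[OF x0(1)] by simp
  qed
  then obtain T where "open T" "x0 \<in> T" "T \<subseteq> S" "negligible (f ` T)"
    using negligible_image_near_max_rank[OF S(1) _ cF x0(1)] der F mx unfolding r_def by metis
  then show ?thesis using that by blast
qed

section \<open>Charts and products of manifolds\<close>

definition vjoin :: "complex^'m \<Rightarrow> complex^'n \<Rightarrow> complex^('m::finite + 'n::finite)" where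
  "vjoin x y = (\<chi> k. case k of Inl i \<Rightarrow> x $ i | Inr j \<Rightarrow> y $ j)"

definition vfst :: "complex^('m::finite + 'n::finite) \<Rightarrow> complex^'m" where
  "vfst w = (\<chi> i. w $ Inl i)"

definition vsnd :: "complex^('m::finite + 'n::finite) \<Rightarrow> complex^'n" where
  "vsnd w = (\<chi> j. w $ Inr j)"

lemma vfst_vjoin [simp]: "vfst (vjoin x y) = x" and vsnd_vjoin [simp]: "vsnd (vjoin x y) = y"
  by (simp_all add: vfst_def vsnd_def vjoin_def)

lemma vjoin_vfst_vsnd [simp]: "vjoin (vfst w) (vsnd w) = w"
  by (auto simp: vjoin_def vfst_def vsnd_def vec_eq_iff split: sum.split)

lemma vjoin_eq_iff [simp]: "vjoin x y = vjoin x' y' \<longleftrightarrow> x = x' \<and> y = y'"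
  by (metis vfst_vjoin vsnd_vjoin)

lemma vjoin_nth [simp]: "vjoin x y $ Inl i = x $ i" "vjoin x y $ Inr j = y $ j"
  by (simp_all add: vjoin_def)

lemma vjoin_scale: "vjoin (c *s x) (c *s y) = c *s vjoin x y"
  by (auto simp: vjoin_def vec_eq_iff split: sum.split)

lemma continuous_on_vfst: "continuous_on S vfst" and continuous_on_vsnd: "continuous_on S vsnd"
  unfolding vfst_def vsnd_def by (auto intro!: continuous_on_vec_lambda continuous_intros)

lemma has_derivative_vjoin:
  assumes "(f has_derivative f') (at x within S)" "(g has_derivative g') (at x within S)"
  shows "((\<lambda>x. vjoin (f x) (g x)) has_derivative (\<lambda>h. vjoin (f' h) (g' h))) (at x within S)"
proof (rule has_derivative_vecI)
  fix k show "((\<lambda>x. vjoin (f x) (g x) $ k) has_derivative (\<lambda>h. vjoin (f' h) (g' h) $ k)) (at x within S)"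
    by (cases k) (auto intro!: bounded_linear.has_derivative[OF bounded_linear_vec_nth] assms)
qed

lemma holo_on_vjoin:
  assumes "holo_on f S" "holo_on g S"
  shows "holo_on (\<lambda>x. vjoin (f x) (g x)) S"
  unfolding holo_on_def
proof
  fix x assume x: "x \<in> S"
  obtain f' where f': "(f has_derivative f') (at x)" "\<And>c v. f' (c *s v) = c *s f' v"
    using holo_onE[OF assms(1) x] by metis
  obtain g' where g': "(g has_derivative g') (at x)" "\<And>c v. g' (c *s v) = c *s g' v"
    using holo_onE[OF assms(2) x] by metis
  show "\<exists>d. ((\<lambda>x. vjoin (f x) (g x)) has_derivative d) (at x) \<and> (\<forall>c v. d (c *s v) = c *s d v)"
    using has_derivative_vjoin[OF f'(1) g'(1)] f'(2) g'(2)
    by (intro exI[of _ "\<lambda>h. vjoin (f' h) (g' h)"]) (auto simp: vjoin_scale)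
qed

lemma holo_on_const: "holo_on (\<lambda>x. c) S" and holo_on_id: "holo_on (\<lambda>x. x) S"
  unfolding holo_on_def
  by (auto intro!: exI[of _ "\<lambda>v. 0"] exI[of _ "\<lambda>v. v"] derivative_eq_intros)

lemma holo_curve_vjoin:
  assumes "holo_curve f S" "holo_curve g S"
  shows "holo_curve (\<lambda>x. vjoin (f x) (g x)) S"
  unfolding holo_curve_def
proof
  fix k show "(\<lambda>x. vjoin (f x) (g x) $ k) holomorphic_on S"
    using assms unfolding holo_curve_def by (cases k) auto
qed

lemma chart_openin: "chart T (U, \<phi>) \<Longrightarrow> openin T U"
  and chart_open_range: "chart T (U, \<phi>) \<Longrightarrow> open (\<phi> ` U)"
  and chart_homeo: "chart T (U, \<phi>) \<Longrightarrow> homeomorphic_map (subtopology T U) (top_of_set (\<phi> ` U)) \<phi>"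
  by (simp_all add: chart_def)

lemma chart_topspace: "chart T (U, \<phi>) \<Longrightarrow> U \<subseteq> topspace T"
  using chart_openin openin_subset by blast

lemma chart_inj: "chart T (U, \<phi>) \<Longrightarrow> inj_on \<phi> U"
  using homeomorphic_imp_injective_map[OF chart_homeo] chart_topspace by (fastforce simp: inj_on_def)

lemma chart_inv [simp]: "chart T (U, \<phi>) \<Longrightarrow> x \<in> U \<Longrightarrow> inv_into U \<phi> (\<phi> x) = x"
  using chart_inj inv_into_f_f by metis

lemma chart_continuous: "chart T (U, \<phi>) \<Longrightarrow> continuous_map (subtopology T U) euclidean \<phi>"
  using homeomorphic_imp_continuous_map[OF chart_homeo] continuous_map_in_subtopology by blast

lemma chart_inv_continuous:
  assumes c: "chart T (U, \<phi>)"
  shows "continuous_map (top_of_set (\<phi> ` U)) T (inv_into U \<phi>)"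
proof -
  obtain g where g: "homeomorphic_maps (subtopology T U) (top_of_set (\<phi> ` U)) \<phi> g"
    using chart_homeo[OF c] homeomorphic_map_maps by blast
  have "g y = inv_into U \<phi> y" if "y \<in> topspace (top_of_set (\<phi> ` U))" for y
    using that g c chart_topspace[OF c] unfolding homeomorphic_maps_def by auto
  moreover have "continuous_map (top_of_set (\<phi> ` U)) T g"
    using g unfolding homeomorphic_maps_def continuous_map_in_subtopology by blast
  ultimately show ?thesis by (metis (no_types, lifting) continuous_map_eq)
qed

lemma chart_open_image:
  assumes c: "chart T (U, \<phi>)" and V: "openin T V"
  shows "open (\<phi> ` (U \<inter> V))"
proof -
  have "openin (subtopology T U) (U \<inter> V)" using V by (metis inf_commute openin_subtopology_Int)
  then have "openin (top_of_set (\<phi> ` U)) (\<phi> ` (U \<inter> V))"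
    using homeomorphic_imp_open_map[OF chart_homeo[OF c]] open_map_def by blast
  then show ?thesis using chart_open_range[OF c] by (metis openin_open_eq)
qed

lemma chart_open_preimage:
  assumes c: "chart T (U, \<phi>)" and V: "open V"
  shows "openin T {x \<in> U. \<phi> x \<in> V}"
proof -
  have "openin (subtopology T U) {x \<in> topspace (subtopology T U). \<phi> x \<in> V}"
    using chart_continuous[OF c] V open_openin openin_continuous_map_preimage by blast
  moreover have "topspace (subtopology T U) = U" using chart_topspace[OF c] by auto
  then have "{x \<in> topspace (subtopology T U). \<phi> x \<in> V} = {x \<in> U. \<phi> x \<in> V}" by auto
  ultimately show ?thesis using chart_openin[OF c] by (simp only: openin_open_subtopology)
qed

lemma chart_compact:
  assumes c: "chart T (U, \<phi>)" and S: "compact S" "S \<subseteq> \<phi> ` U"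
  shows "compactin T (inv_into U \<phi> ` S)"
proof (rule image_compactin[OF _ chart_inv_continuous[OF c]])
  show "compactin (top_of_set (\<phi> ` U)) S"
    using S by (simp add: compactin_subtopology)
qed

lemma chart_Int:
  assumes c: "chart T (U, \<phi>)" and V: "openin T V"
  shows "chart T (U \<inter> V, \<phi>)"
  unfolding chart_def
proof (intro case_prodI conjI)
  show "openin T (U \<inter> V)" using chart_openin[OF c] V by blast
  show "open (\<phi> ` (U \<inter> V))" using chart_open_image[OF c V] .
  have "homeomorphic_map (subtopology (subtopology T U) (U \<inter> V)) (subtopology (top_of_set (\<phi> ` U)) (\<phi> ` (U \<inter> V))) \<phi>"
    by (rule homeomorphic_map_subtopologies_alt[OF chart_homeo[OF c]])
      (use chart_topspace[OF c] chart_inj[OF c] in \<open>auto simp: inj_on_def\<close>)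
  then show "homeomorphic_map (subtopology T (U \<inter> V)) (top_of_set (\<phi> ` (U \<inter> V))) \<phi>"
    by (metis Int_left_absorb image_mono inf_le1 inf.absorb2 subtopology_subtopology)
qed

lemma chart_prod:
  assumes c: "chart T (U, \<phi>)" and d: "chart T' (V, \<psi>)"
  shows "chart (prod_topology T T') (U \<times> V, \<lambda>(x, y). vjoin (\<phi> x) (\<psi> y))"
  unfolding chart_def
proof (intro case_prodI conjI)
  let ?k = "\<lambda>(x, y). vjoin (\<phi> x) (\<psi> y)" and ?W = "U \<times> V"
  have im: "?k ` ?W = vfst -` (\<phi> ` U) \<inter> vsnd -` (\<psi> ` V)"
  proof (intro equalityI subsetI)
    fix w assume "w \<in> vfst -` (\<phi> ` U) \<inter> vsnd -` (\<psi> ` V)"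
    then obtain x y where xy: "x \<in> U" "y \<in> V" "vfst w = \<phi> x" "vsnd w = \<psi> y" by auto
    then have "w = ?k (x, y)" using vjoin_vfst_vsnd[of w] by simp
    then show "w \<in> ?k ` ?W" using xy by blast
  qed auto
  show "openin (prod_topology T T') ?W"
    using chart_openin[OF c] chart_openin[OF d] openin_prod_Times_iff by blast
  show "open (?k ` ?W)"
    unfolding im using chart_open_range[OF c] chart_open_range[OF d]
    by (intro open_Int open_vimage continuous_on_vfst continuous_on_vsnd)
  let ?P = "subtopology (prod_topology T T') ?W" and ?Q = "top_of_set (?k ` ?W)"
  let ?g = "\<lambda>w. (inv_into U \<phi> (vfst w), inv_into V \<psi> (vsnd w))"
  have "homeomorphic_maps ?P ?Q ?k ?g"
    unfolding homeomorphic_maps_def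
  proof (intro conjI ballI)
    have P: "?P = prod_topology (subtopology T U) (subtopology T' V)" by (simp add: subtopology_Times)
    have "continuous_map ?P euclidean ?k"
      unfolding continuous_map_atin
    proof
      fix p assume p: "p \<in> topspace ?P"
      have 1: "limitin euclidean (\<phi> \<circ> fst) ((\<phi> \<circ> fst) p) (atin ?P p)"
        using continuous_map_compose[OF continuous_map_fst chart_continuous[OF c], of "subtopology T' V"] p
        unfolding P continuous_map_atin by blast
      have 2: "limitin euclidean (\<psi> \<circ> snd) ((\<psi> \<circ> snd) p) (atin ?P p)"
        using continuous_map_compose[OF continuous_map_snd chart_continuous[OF d], of "subtopology T U"] p
        unfolding P continuous_map_atin by blast
      have "((\<lambda>q. ?k q $ i) \<longlongrightarrow> ?k p $ i) (atin ?P p)" for i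
        using tendsto_vec_nth[OF 1[simplified]] tendsto_vec_nth[OF 2[simplified]]
        by (cases i; cases p) (auto simp: case_prod_beta)
      then show "limitin euclidean ?k (?k p) (atin ?P p)"
        by (simp add: vec_tendstoI)
    qed
    then show "continuous_map ?P ?Q ?k"
      by (rule continuous_map_into_subtopology) auto
    have f: "continuous_map ?Q (top_of_set (\<phi> ` U)) vfst" and s: "continuous_map ?Q (top_of_set (\<psi> ` V)) vsnd"
      unfolding im continuous_map_in_subtopology by (auto simp: continuous_on_vfst continuous_on_vsnd)
    have "continuous_map ?Q (prod_topology T T') ?g"
      using continuous_map_compose[OF f chart_inv_continuous[OF c]]
        continuous_map_compose[OF s chart_inv_continuous[OF d]]
      by (simp add: continuous_map_pairwise o_def)
    moreover have "?g w \<in> ?W" if "w \<in> ?k ` ?W" for w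
      using that unfolding im by (auto intro: inv_into_into)
    ultimately show "continuous_map ?Q ?P ?g"
      by (intro continuous_map_into_subtopology) auto
  next
    fix p assume "p \<in> topspace ?P" then show "?g (?k p) = p" using c d by auto
  next
    fix w assume "w \<in> topspace ?Q" then show "?k (?g w) = w" unfolding im by (auto simp: f_inv_into_f)
  qed
  then show "homeomorphic_map ?P ?Q ?k" using homeomorphic_map_maps by blast
qed

lemma complex_manifold_chart: "complex_manifold X \<Longrightarrow> (U, \<phi>) \<in> atlas X \<Longrightarrow> chart (mtop X) (U, \<phi>)"
  unfolding complex_manifold_def by blast

lemma complex_manifold_chart_at:
  assumes "complex_manifold X" "x \<in> topspace (mtop X)"
  obtains U \<phi> where "(U, \<phi>) \<in> atlas X" "chart (mtop X) (U, \<phi>)" "x \<in> U"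
  using assms unfolding complex_manifold_def by fastforce

lemma locally_compact_complex_manifold:
  assumes X: "complex_manifold X"
  shows "locally_compact_space (mtop X)"
  unfolding locally_compact_space_def
proof
  fix x assume x: "x \<in> topspace (mtop X)"
  obtain U \<phi> where c: "(U, \<phi>) \<in> atlas X" "chart (mtop X) (U, \<phi>)" "x \<in> U"
    by (rule complex_manifold_chart_at[OF X x]) (rule that)
  note c = c(2,3)
  obtain e where e: "0 < e" "cball (\<phi> x) e \<subseteq> \<phi> ` U"
    using chart_open_range[OF c(1)] c(2) unfolding open_contains_cball by blast
  let ?V = "{y \<in> U. \<phi> y \<in> ball (\<phi> x) e}" and ?K = "inv_into U \<phi> ` cball (\<phi> x) e"
  have "?V \<subseteq> ?K"
  proof
    fix y assume y: "y \<in> ?V"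
    then have "y = inv_into U \<phi> (\<phi> y)" using c(1) by simp
    then show "y \<in> ?K" using y by (metis (no_types, lifting) ball_subset_cball image_eqI mem_Collect_eq subsetD)
  qed
  then show "\<exists>V K. openin (mtop X) V \<and> compactin (mtop X) K \<and> x \<in> V \<and> V \<subseteq> K"
    using chart_open_preimage[OF c(1) open_ball] chart_compact[OF c(1) compact_cball e(2)] c(2) e(1)
    by (intro exI[of _ ?V] exI[of _ ?K]) auto
qed

text \<open>As \<open>\<Omega>\<close> is open, the derivatives of the representing map \<open>A\<close> on it are determined by \<open>f\<close>.\<close>

lemma holomorphic_map_prod_in_charts:
  assumes X: "complex_manifold X" and Y: "complex_manifold Y" and W: "complex_manifold W"
    and f: "holomorphic_map (prod_mfd X Y) W f"
    and U: "(U, \<phi>) \<in> atlas X" and V: "(V, \<psi>) \<in> atlas Y" and V': "(V', \<psi>') \<in> atlas W"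
  obtains A \<Omega> where "open \<Omega>" "holo_on A \<Omega>"
    "\<Omega> = {vjoin (\<phi> x) (\<psi> y) | x y. x \<in> U \<and> y \<in> V \<and> f (x, y) \<in> V'}"
    "\<And>x y. x \<in> U \<Longrightarrow> y \<in> V \<Longrightarrow> f (x, y) \<in> V' \<Longrightarrow> A (vjoin (\<phi> x) (\<psi> y)) = \<psi>' (f (x, y))"
proof -
  let ?k = "\<lambda>(x, y). vjoin (\<phi> x) (\<psi> y)" and ?T = "prod_topology (mtop X) (mtop Y)"
  define \<Omega> where "\<Omega> = {vjoin (\<phi> x) (\<psi> y) | x y. x \<in> U \<and> y \<in> V \<and> f (x, y) \<in> V'}"
  define A where "A = \<psi>' \<circ> f \<circ> inv_into (U \<times> V) ?k"
  have c: "chart ?T (U \<times> V, ?k)"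
    by (rule chart_prod[OF complex_manifold_chart[OF X U] complex_manifold_chart[OF Y V]])
  have cf: "continuous_map ?T (mtop W) f" using f unfolding holomorphic_map_def prod_mfd_def by simp
  have \<Omega>: "\<Omega> = ?k ` (U \<times> V \<inter> f -` V')" unfolding \<Omega>_def by auto
  have "(U \<times> V, ?k) \<in> atlas (prod_mfd X Y)"
    unfolding prod_mfd_def vjoin_def using U V by auto
  then have hol: "holo_on A \<Omega>"
    using f V' unfolding holomorphic_map_def A_def \<Omega> by fastforce
  have "openin ?T {p \<in> topspace ?T. f p \<in> V'}"
    using cf chart_openin[OF complex_manifold_chart[OF W V']] openin_continuous_map_preimage by blast
  from chart_open_image[OF c this]
  have "open (?k ` (U \<times> V \<inter> {p \<in> topspace ?T. f p \<in> V'}))" .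
  moreover have "U \<times> V \<inter> {p \<in> topspace ?T. f p \<in> V'} = U \<times> V \<inter> f -` V'"
    using chart_topspace[OF c] by blast
  ultimately have "open \<Omega>" unfolding \<Omega> by metis
  moreover have "A (vjoin (\<phi> x) (\<psi> y)) = \<psi>' (f (x, y))" if "x \<in> U" "y \<in> V" for x y
    using chart_inv[OF c, of "(x, y)"] that unfolding A_def by simp
  ultimately show ?thesis using that hol \<Omega>_def by blast
qed

section \<open>Orbit maps with large image have surjective derivative somewhere\<close>

locale complex_lie = group G for G (structure) +
  fixes M :: "('a, 'm::finite) mfd"
  assumes lie: "complex_lie_group G M"
begin

lemma mfdM: "complex_manifold M" and topM [simp]: "topspace (mtop M) = carrier G"
  and mult_holomorphic: "holomorphic_map (prod_mfd M M) M (\<lambda>(x, y). x \<otimes> y)"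
  and inv_holomorphic: "holomorphic_map M M (\<lambda>x. inv x)"
  using lie unfolding complex_lie_group_def by auto

lemma mult_continuous: "continuous_map (prod_topology (mtop M) (mtop M)) (mtop M) (\<lambda>(x, y). x \<otimes> y)"
  using mult_holomorphic unfolding holomorphic_map_def prod_mfd_def by simp

lemma inv_continuous: "continuous_map (mtop M) (mtop M) (\<lambda>x. inv x)"
  using inv_holomorphic unfolding holomorphic_map_def by simp

lemma left_mult_continuous:
  assumes "g \<in> carrier G" shows "continuous_map (mtop M) (mtop M) (\<lambda>x. g \<otimes> x)"
proof -
  have "continuous_map (mtop M) (prod_topology (mtop M) (mtop M)) (\<lambda>x. (g, x))"
    using assms by (simp add: continuous_map_pairwise o_def)
  from continuous_map_compose[OF this mult_continuous] show ?thesis by (simp add: o_def)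
qed

lemma open_left_translate:
  assumes W: "openin (mtop M) W" and h: "h \<in> carrier G"
  shows "openin (mtop M) {k \<in> carrier G. inv h \<otimes> k \<in> W}"
  using openin_continuous_map_preimage[OF left_mult_continuous[OF inv_closed[OF h]] W] by simp

text \<open>A second countable space has the Lindelof property.\<close>

lemma countable_translates_cover:
  assumes W: "openin (mtop M) W" "W \<noteq> {}"
  obtains H where "countable H" "H \<subseteq> carrier G" "\<And>k. k \<in> carrier G \<Longrightarrow> \<exists>h\<in>H. inv h \<otimes> k \<in> W"
proof -
  obtain w where w: "w \<in> W" "w \<in> carrier G" using W openin_subset by fastforce
  define t where "t = (\<lambda>h. {k \<in> carrier G. inv h \<otimes> k \<in> W})"
  have L: "Lindelof_space (mtop M)"
    using mfdM second_countable_imp_Lindelof_space unfolding complex_manifold_def by blast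
  have "k \<in> t (k \<otimes> inv w)" if "k \<in> carrier G" for k
    using that w by (simp add: t_def inv_mult_group m_assoc)
  then have "\<Union> (t ` carrier G) = topspace (mtop M)"
    using w(2) by (fastforce simp: t_def)
  moreover have "openin (mtop M) U" if "U \<in> t ` carrier G" for U
    using that open_left_translate[OF W(1)] unfolding t_def by blast
  ultimately obtain \<V> where V: "countable \<V>" "\<V> \<subseteq> t ` carrier G" "\<Union> \<V> = topspace (mtop M)"
    using Lindelof_spaceD[OF L] by metis
  obtain H where H: "countable H" "H \<subseteq> carrier G" "\<V> = t ` H"
    using V(1,2) by (metis countable_subset_image)
  show ?thesis
  proof (rule that[OF H(1,2)])
    show "\<exists>h\<in>H. inv h \<otimes> k \<in> W" if "k \<in> carrier G" for k
      using that V(3) H(3) unfolding t_def topM by blast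
  qed
qed

text \<open>Otherwise some compact piece of \<open>G\<close> with nonempty interior would have a negligible, hence nowhere dense,
  compact image in \<open>X\<close>. The orbit is a countable union of translates of this image, so by Baire's theorem
  it would have no interior points. The map \<open>F\<close> is the orbit map of \<open>x\<close> read in charts.\<close>

lemma orbit_map_surjective_derivative:
  fixes a :: "'a \<Rightarrow> 'x \<Rightarrow> 'x" and \<kappa> :: "'x \<Rightarrow> complex^'k::finite"
  assumes X: "Hausdorff_space X" "locally_compact_space X"
    and cont: "\<And>g. g \<in> carrier G \<Longrightarrow> continuous_map X X (a g)"
    and a1: "\<And>y. y \<in> topspace X \<Longrightarrow> a \<one> y = y"
    and am: "\<And>g h y. g \<in> carrier G \<Longrightarrow> h \<in> carrier G \<Longrightarrow> y \<in> topspace X \<Longrightarrow> a (g \<otimes> h) y = a g (a h y)"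
    and x: "x \<in> topspace X"
    and W: "openin X W" "W \<noteq> {}" "W \<subseteq> {a g x | g. g \<in> carrier G}"
    and U: "chart (mtop M) (U, \<phi>)" and V: "chart X (V, \<kappa>)"
    and U': "openin (mtop M) U'" "U' \<noteq> {}" "U' \<subseteq> U" and U'V: "\<And>g. g \<in> U' \<Longrightarrow> a g x \<in> V"
    and F: "holo_on F (\<phi> ` U')" "\<And>g. g \<in> U' \<Longrightarrow> F (\<phi> g) = \<kappa> (a g x)"
  shows "\<exists>g\<in>U'. surj (\<lambda>v. partial F v (\<phi> g))"
proof (rule ccontr)
  assume neg: "\<not> ?thesis"
  have oS: "open (\<phi> ` U')" using chart_open_image[OF U U'(1)] U'(3) by (simp add: Int_absorb1)
  obtain T where T: "open T" "T \<noteq> {}" "T \<subseteq> \<phi> ` U'" "negligible (F ` T)"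
  proof (rule negligible_image_nowhere_surjective[OF oS, of F "\<lambda>z v. partial F v z"])
    show "(F has_derivative (\<lambda>v. partial F v z)) (at z)" if "z \<in> \<phi> ` U'" for z
      using holo_on_has_derivative(1)[OF F(1) that] .
    show "continuous_on (\<phi> ` U') (\<lambda>z. partial F v z)" for v
      using holo_on_partial_continuous[OF F(1) oS] .
  qed (use U' neg that in auto)
  obtain c e where e: "0 < e" "cball c e \<subseteq> T" using T(1,2) open_contains_cball by blast
  define N where "N = inv_into V \<kappa> ` (F ` cball c e)"
  have cU: "cball c e \<subseteq> \<phi> ` U'" using e(2) T(3) by blast
  have FV: "F ` cball c e \<subseteq> \<kappa> ` V" using cU F(2) U'V by fastforce
  have "compact (F ` cball c e)"
    by (intro compact_continuous_image compact_cball continuous_on_subset[OF holo_on_continuous[OF F(1)] cU])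
  then have compN: "compactin X N" unfolding N_def using chart_compact[OF V _ FV] by blast
  have NV: "N \<subseteq> V" unfolding N_def using FV inv_into_into[of _ \<kappa> V] by blast
  have noint: "P = {}" if P: "openin X P" "P \<subseteq> N" for P
  proof (rule ccontr)
    assume ne: "P \<noteq> {}"
    have PV: "P \<subseteq> V" using P(2) NV by blast
    have "\<kappa> ` P \<subseteq> F ` T"
    proof
      fix w assume "w \<in> \<kappa> ` P"
      then obtain y where "y \<in> F ` cball c e" "w = \<kappa> (inv_into V \<kappa> y)" using P(2) unfolding N_def by blast
      then show "w \<in> F ` T" using FV e(2) by (metis f_inv_into_f image_mono subsetD)
    qed
    then have "negligible (\<kappa> ` P)" using T(4) negligible_subset by blast
    moreover have "open (\<kappa> ` P)"
      using chart_open_image[OF V P(1)] PV by (simp add: Int_absorb1)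
    ultimately show False using open_not_negligible ne by blast
  qed
  \<comment> \<open>a nonempty open subset of \<open>G\<close> that is mapped into \<open>N\<close>\<close>
  define B where "B = {g \<in> U. \<phi> g \<in> ball c e}"
  have B: "openin (mtop M) B" unfolding B_def using chart_open_preimage[OF U open_ball] .
  have "c \<in> \<phi> ` U'" using cU e(1) by auto
  then have "B \<noteq> {}" using U'(3) e(1) unfolding B_def by auto
  then obtain H where H: "countable H" "H \<subseteq> carrier G" "\<And>k. k \<in> carrier G \<Longrightarrow> \<exists>h\<in>H. inv h \<otimes> k \<in> B"
    using countable_translates_cover[OF B] by metis
  have BN: "a g x \<in> N" if "g \<in> B" for g
  proof -
    have g: "g \<in> U" "\<phi> g \<in> cball c e" using that unfolding B_def by auto
    then obtain g' where "g' \<in> U'" "\<phi> g' = \<phi> g" using cU by (metis imageE subsetD)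
    then have "g \<in> U'" using chart_inj[OF U] g(1) U'(3) by (metis inj_onD subsetD)
    then have "a g x = inv_into V \<kappa> (F (\<phi> g))" using F(2) V U'V by simp
    then show ?thesis unfolding N_def using g(2) by blast
  qed
  have Wsub: "W \<subseteq> \<Union> ((\<lambda>h. a h ` N) ` H)"
  proof
    fix y assume "y \<in> W"
    then obtain k where k: "k \<in> carrier G" "y = a k x" using W(3) by blast
    then obtain h where h: "h \<in> H" "inv h \<otimes> k \<in> B" using H(3) by blast
    have hc: "h \<in> carrier G" using h H(2) by blast
    have "y = a h (a (inv h \<otimes> k) x)"
      using k hc x am[of h "inv h \<otimes> k" x] by (simp add: m_assoc[symmetric])
    then show "y \<in> \<Union> ((\<lambda>h. a h ` N) ` H)" using h BN by blast
  qed
  have "X interior_of \<Union> ((\<lambda>h. a h ` N) ` H) = {}"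
  proof (rule Baire_category_alt)
    show "completely_metrizable_space X \<or> locally_compact_space X \<and> regular_space X"
      using X locally_compact_Hausdorff_imp_regular_space by blast
    show "countable ((\<lambda>h. a h ` N) ` H)" using H(1) by blast
    fix S assume "S \<in> (\<lambda>h. a h ` N) ` H"
    then obtain h where h: "h \<in> carrier G" "S = a h ` N" using H(2) by blast
    have "closedin X S"
      unfolding h(2) using image_compactin[OF compN cont[OF h(1)]] X(1) compactin_imp_closedin by blast
    moreover have "X interior_of S = {}"
    proof -
      define O' where "O' = {y \<in> topspace X. a h y \<in> X interior_of S}"
      have "openin X O'" unfolding O'_def
        by (rule openin_continuous_map_preimage[OF cont[OF h(1)] openin_interior_of])
      moreover have "O' \<subseteq> N"
      proof
        fix y assume y: "y \<in> O'"
        then obtain n where n: "n \<in> N" "a h y = a h n"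
          using interior_of_subset[of X S] unfolding O'_def h(2) by auto
        have nt: "n \<in> topspace X" and yt: "y \<in> topspace X"
          using n(1) compactin_subset_topspace[OF compN] y unfolding O'_def by auto
        have "y = a (inv h \<otimes> h) y" using h(1) a1[OF yt] by simp
        also have "\<dots> = a (inv h \<otimes> h) n" using n(2) am[of "inv h" h] h(1) nt yt by simp
        also have "\<dots> = n" using h(1) a1[OF nt] by simp
        finally show "y \<in> N" using n(1) by simp
      qed
      ultimately have "O' = {}" using noint by blast
      moreover have "\<exists>y\<in>O'. a h y = s" if s: "s \<in> X interior_of S" for s
      proof -
        obtain n where "n \<in> N" "s = a h n" using s interior_of_subset[of X S] unfolding h(2) by blast
        then show ?thesis using s compactin_subset_topspace[OF compN] unfolding O'_def by blast
      qed
      ultimately show ?thesis by blast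
    qed
    ultimately show "closedin X S \<and> X interior_of S = {}" by blast
  qed
  moreover have "W \<subseteq> X interior_of \<Union> ((\<lambda>h. a h ` N) ` H)"
    using interior_of_maximal[OF Wsub W(1)] .
  ultimately show False using W(2) by blast
qed

end

section \<open>Generic pairs of points\<close>

lemma linear_surj_bounded_right_inverse:
  fixes f :: "'a::euclidean_space \<Rightarrow> 'b::euclidean_space"
  assumes "linear f" "surj f"
  obtains g where "bounded_linear g" "f \<circ> g = id"
  using linear_surjective_right_inverse[OF assms] linear_conv_bounded_linear by blast

text \<open>The open mapping property at a point with surjective derivative, transported to manifolds.\<close>

lemma interior_image_in_charts:
  assumes U: "chart T (U, \<phi>)" and V: "chart X (V, \<kappa>)"
    and S: "openin T S" "S \<subseteq> U" and f: "\<And>g. g \<in> S \<Longrightarrow> f g \<in> V"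
    and F: "holo_on F (\<phi> ` S)" "\<And>g. g \<in> S \<Longrightarrow> F (\<phi> g) = \<kappa> (f g)"
    and g: "g \<in> S" and surj: "surj (\<lambda>v. partial F v (\<phi> g))"
  obtains W where "openin X W" "f g \<in> W" "W \<subseteq> f ` S"
proof -
  have oS: "open (\<phi> ` S)" using chart_open_image[OF U S(1)] S(2) by (simp add: Int_absorb1)
  have der: "(F has_derivative (\<lambda>v. partial F v (\<phi> g))) (at (\<phi> g))"
    using holo_on_has_derivative(1)[OF F(1)] g by blast
  obtain r where r: "bounded_linear r" "(\<lambda>v. partial F v (\<phi> g)) \<circ> r = id"
    using linear_surj_bounded_right_inverse[OF has_derivative_linear[OF der] surj] by blast
  have int: "F (\<phi> g) \<in> interior (F ` \<phi> ` S)"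
    by (rule sussmann_open_mapping[OF oS holo_on_continuous[OF F(1)] _ der r order_refl])
      (use g oS in \<open>auto simp: interior_open\<close>)
  define W where "W = {y \<in> V. \<kappa> y \<in> interior (F ` \<phi> ` S)}"
  show ?thesis
  proof (rule that)
    show "openin X W" unfolding W_def by (rule chart_open_preimage[OF V open_interior])
    show "f g \<in> W" using int f[OF g] F(2)[OF g] unfolding W_def by simp
    show "W \<subseteq> f ` S"
    proof
      fix y assume "y \<in> W"
      then have y: "y \<in> V" "\<kappa> y \<in> F ` \<phi> ` S" using interior_subset unfolding W_def by auto
      then obtain h where h: "h \<in> S" "\<kappa> y = \<kappa> (f h)" using F(2) by auto
      then have "y = f h" using chart_inj[OF V] y(1) f by (meson inj_onD)
      then show "y \<in> f ` S" using h(1) by blast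
    qed
  qed
qed

lemma partial_eqI:
  assumes "(f has_derivative f') (at z)"
  shows "partial f v z = f' v"
  using frechet_derivative_at[OF assms] unfolding partial_def by simp

lemma partial_vjoin:
  assumes "holo_on f S" "holo_on g S" "z \<in> S"
  shows "partial (\<lambda>x. vjoin (f x) (g x)) v z = vjoin (partial f v z) (partial g v z)"
  by (rule partial_eqI[OF has_derivative_vjoin[OF holo_on_has_derivative(1) holo_on_has_derivative(1)]])
    (use assms in auto)

lemma partial_matrix:
  assumes f: "holo_on f S" "z \<in> S"
  shows "matrix (\<lambda>v. partial f v z) *v v = partial f v z"
proof (rule matrix_works)
  have "linear (\<lambda>v. partial f v z)" using holo_on_has_derivative(1)[OF f] has_derivative_linear by blast
  then show "Vector_Spaces.linear (*s) (*s) (\<lambda>v. partial f v z)"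
    using holo_on_has_derivative(2)[OF f] linear_add by unfold_locales blast+
qed

locale holomorphic_action =
  complex_lie G M + transitive_action G "topspace (mtop Z)" act
  for G (structure) and M :: "('a, 'm::finite) mfd" and Z :: "('z, 'n::finite) mfd" and act +
  assumes mfdZ: "complex_manifold Z"
    and act_holomorphic: "holomorphic_map (prod_mfd M Z) Z (\<lambda>(g, z). act g z)"
begin

abbreviation "points \<equiv> topspace (mtop Z)"

lemma act_closed: "g \<in> carrier G \<Longrightarrow> z \<in> points \<Longrightarrow> act g z \<in> points"
  using element_image by blast

lemma act_one [simp]: "z \<in> points \<Longrightarrow> act \<one> z = z"
  by (metis id_eq_one restrict_apply')

lemma act_mult: "g \<in> carrier G \<Longrightarrow> h \<in> carrier G \<Longrightarrow> z \<in> points \<Longrightarrow> act (g \<otimes> h) z = act g (act h z)"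
  using composition_rule by blast

lemma act_inv [simp]:
  "g \<in> carrier G \<Longrightarrow> z \<in> points \<Longrightarrow> act (inv g) (act g z) = z"
  "g \<in> carrier G \<Longrightarrow> z \<in> points \<Longrightarrow> act g (act (inv g) z) = z"
  by (metis act_mult act_one inv_closed l_inv, metis act_mult act_one inv_closed r_inv)

lemma act_continuous_prod: "continuous_map (prod_topology (mtop M) (mtop Z)) (mtop Z) (\<lambda>(g, z). act g z)"
  using act_holomorphic unfolding holomorphic_map_def prod_mfd_def by simp

lemma act_continuous: "g \<in> carrier G \<Longrightarrow> continuous_map (mtop Z) (mtop Z) (act g)"
  using continuous_map_compose[of "mtop Z" _ "\<lambda>z. (g, z)", OF _ act_continuous_prod]
  by (simp add: continuous_map_pairwise o_def)

lemma orbit_map_continuous: "z \<in> points \<Longrightarrow> continuous_map (mtop M) (mtop Z) (\<lambda>g. act g z)"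
  using continuous_map_compose[of "mtop M" _ "\<lambda>g. (g, z)", OF _ act_continuous_prod]
  by (simp add: continuous_map_pairwise o_def)

text \<open>For a transitive action this says that \<open>q\<close> lies in an open orbit of the isotropy group of \<open>p\<close>. Stated in
  terms of the \<open>G\<close>-orbit of the pair it is symmetric, visibly invariant under \<open>G\<close>, and independent of
  charts.\<close>

definition generic_pair :: "'z \<Rightarrow> 'z \<Rightarrow> bool" where
  "generic_pair p q \<longleftrightarrow> (\<exists>W. openin (prod_topology (mtop Z) (mtop Z)) W \<and> W \<noteq> {} \<and>
     W \<subseteq> {(act g p, act g q) | g. g \<in> carrier G})"

lemma generic_pair_translate:
  assumes "generic_pair p q" "k \<in> carrier G" "p \<in> points" "q \<in> points"
  shows "generic_pair (act k p) (act k q)"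
proof -
  have "{(act g p, act g q) | g. g \<in> carrier G} \<subseteq> {(act g (act k p), act g (act k q)) | g. g \<in> carrier G}"
  proof clarify
    fix g assume g: "g \<in> carrier G"
    have "act g x = act (g \<otimes> inv k) (act k x)" if "x \<in> points" for x
      using act_mult[of g "inv k" "act k x"] assms g that act_closed by simp
    then show "\<exists>h. (act g p, act g q) = (act h (act k p), act h (act k q)) \<and> h \<in> carrier G"
      using assms g by (intro exI[of _ "g \<otimes> inv k"]) auto
  qed
  then show ?thesis using assms(1) unfolding generic_pair_def by (meson order_trans)
qed

definition orbit_in_chart :: "'a set \<Rightarrow> ('a \<Rightarrow> complex^'m) \<Rightarrow> ('z \<Rightarrow> complex^'n) \<Rightarrow> 'z \<Rightarrow> complex^'m \<Rightarrow> complex^'n" where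
  "orbit_in_chart U \<phi> \<psi> z x = \<psi> (act (inv_into U \<phi> x) z)"

lemma chartM: "(U, \<phi>) \<in> atlas M \<Longrightarrow> chart (mtop M) (U, \<phi>)"
  using complex_manifold_chart[OF mfdM] .

lemma chartZ: "(V, \<psi>) \<in> atlas Z \<Longrightarrow> chart (mtop Z) (V, \<psi>)"
  using complex_manifold_chart[OF mfdZ] .

lemma orbit_in_chart_apply:
  "(U, \<phi>) \<in> atlas M \<Longrightarrow> g \<in> U \<Longrightarrow> orbit_in_chart U \<phi> \<psi> z (\<phi> g) = \<psi> (act g z)"
  using chart_inv[OF chartM] unfolding orbit_in_chart_def by simp

lemma action_in_charts:
  assumes U: "(U, \<phi>) \<in> atlas M" and V: "(V, \<psi>) \<in> atlas Z" and V': "(V', \<psi>') \<in> atlas Z"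
  obtains A \<Omega> where "open \<Omega>" "holo_on A \<Omega>"
    "\<Omega> = {vjoin (\<phi> g) (\<psi> z) | g z. g \<in> U \<and> z \<in> V \<and> act g z \<in> V'}"
    "\<And>g z. g \<in> U \<Longrightarrow> z \<in> V \<Longrightarrow> act g z \<in> V' \<Longrightarrow> A (vjoin (\<phi> g) (\<psi> z)) = \<psi>' (act g z)"
proof -
  obtain A \<Omega> where a: "open \<Omega>" "holo_on A \<Omega>"
    "\<Omega> = {vjoin (\<phi> g) (\<psi> z) | g z. g \<in> U \<and> z \<in> V \<and> (case (g, z) of (g, z) \<Rightarrow> act g z) \<in> V'}"
    "\<And>g z. g \<in> U \<Longrightarrow> z \<in> V \<Longrightarrow> (case (g, z) of (g, z) \<Rightarrow> act g z) \<in> V' \<Longrightarrow>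
      A (vjoin (\<phi> g) (\<psi> z)) = \<psi>' (case (g, z) of (g, z) \<Rightarrow> act g z)"
    by (rule holomorphic_map_prod_in_charts[OF mfdM mfdZ mfdZ act_holomorphic U V V']) (rule that)
  show thesis by (rule that[OF a(1,2)]) (use a(3,4) in simp_all)
qed

lemma open_orbit_preimage:
  assumes U: "(U, \<phi>) \<in> atlas M" and V: "(V, \<psi>) \<in> atlas Z" and z: "z \<in> points"
  shows "openin (mtop M) {g \<in> U. act g z \<in> V}"
proof -
  have "openin (mtop M) (U \<inter> {g \<in> topspace (mtop M). act g z \<in> V})"
    using openin_continuous_map_preimage[OF orbit_map_continuous[OF z] chart_openin[OF chartZ[OF V]]]
      chart_openin[OF chartM[OF U]] by blast
  moreover have "U \<inter> {g \<in> topspace (mtop M). act g z \<in> V} = {g \<in> U. act g z \<in> V}"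
    using chart_topspace[OF chartM[OF U]] by blast
  ultimately show ?thesis by simp
qed

lemma orbit_in_chart_holo:
  assumes U: "(U, \<phi>) \<in> atlas M" and V: "(V, \<psi>) \<in> atlas Z" and z: "z \<in> points"
  shows "holo_on (orbit_in_chart U \<phi> \<psi> z) (\<phi> ` {g \<in> U. act g z \<in> V})"
proof -
  obtain V0 \<psi>0 where V0: "(V0, \<psi>0) \<in> atlas Z" "chart (mtop Z) (V0, \<psi>0)" "z \<in> V0"
    by (rule complex_manifold_chart_at[OF mfdZ z]) (rule that)
  obtain A \<Omega> where A: "open \<Omega>" "holo_on A \<Omega>"
    "\<Omega> = {vjoin (\<phi> g) (\<psi>0 z) | g z. g \<in> U \<and> z \<in> V0 \<and> act g z \<in> V}"
    "\<And>g z. g \<in> U \<Longrightarrow> z \<in> V0 \<Longrightarrow> act g z \<in> V \<Longrightarrow> A (vjoin (\<phi> g) (\<psi>0 z)) = \<psi> (act g z)"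
    by (rule action_in_charts[OF U V0(1) V]) (rule that)
  let ?S = "\<phi> ` {g \<in> U. act g z \<in> V}"
  have "holo_on (A \<circ> (\<lambda>x. vjoin x (\<psi>0 z))) ?S"
    by (rule holo_on_compose[OF holo_on_vjoin[OF holo_on_id holo_on_const] A(2)]) (use A(3) V0 in auto)
  moreover have "open ?S"
  proof -
    have "open (\<phi> ` (U \<inter> {g \<in> U. act g z \<in> V}))"
      by (rule chart_open_image[OF chartM[OF U] open_orbit_preimage[OF U V z]])
    moreover have "U \<inter> {g \<in> U. act g z \<in> V} = {g \<in> U. act g z \<in> V}" by blast
    ultimately show ?thesis by simp
  qed
  moreover have "(A \<circ> (\<lambda>x. vjoin x (\<psi>0 z))) x = orbit_in_chart U \<phi> \<psi> z x" if "x \<in> ?S" for x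
    using that A(4) V0(3) orbit_in_chart_apply[OF U] by auto
  ultimately show ?thesis by (rule holo_on_transform)
qed

definition pair_orbit_in_chart ::
    "'a set \<Rightarrow> ('a \<Rightarrow> complex^'m) \<Rightarrow> ('z \<Rightarrow> complex^'n) \<Rightarrow> ('z \<Rightarrow> complex^'n) \<Rightarrow> 'z \<Rightarrow> 'z \<Rightarrow>
      complex^'m \<Rightarrow> complex^('n + 'n)" where
  "pair_orbit_in_chart U \<phi> \<psi>1 \<psi>2 p q x = vjoin (orbit_in_chart U \<phi> \<psi>1 p x) (orbit_in_chart U \<phi> \<psi>2 q x)"

lemma pair_orbit_in_chart_holo:
  assumes U: "(U, \<phi>) \<in> atlas M" and V1: "(V1, \<psi>1) \<in> atlas Z" and V2: "(V2, \<psi>2) \<in> atlas Z"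
    and pq: "p \<in> points" "q \<in> points"
  shows "holo_on (pair_orbit_in_chart U \<phi> \<psi>1 \<psi>2 p q) (\<phi> ` {g \<in> U. act g p \<in> V1 \<and> act g q \<in> V2})"
  unfolding pair_orbit_in_chart_def
  by (rule holo_on_vjoin[OF holo_on_subset[OF orbit_in_chart_holo[OF U V1 pq(1)]]
        holo_on_subset[OF orbit_in_chart_holo[OF U V2 pq(2)]]]) auto

lemma generic_pair_if_surjective:
  assumes U: "(U, \<phi>) \<in> atlas M" and V1: "(V1, \<psi>1) \<in> atlas Z" and V2: "(V2, \<psi>2) \<in> atlas Z"
    and pq: "p \<in> points" "q \<in> points" and g: "g \<in> U" "act g p \<in> V1" "act g q \<in> V2"
    and surj: "surj (\<lambda>v. partial (pair_orbit_in_chart U \<phi> \<psi>1 \<psi>2 p q) v (\<phi> g))"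
  shows "generic_pair p q"
proof -
  define S where "S = {g \<in> U. act g p \<in> V1} \<inter> {g \<in> U. act g q \<in> V2}"
  have S: "openin (mtop M) S" "S \<subseteq> U" "S = {g \<in> U. act g p \<in> V1 \<and> act g q \<in> V2}"
    unfolding S_def using open_orbit_preimage[OF U V1 pq(1)] open_orbit_preimage[OF U V2 pq(2)] by auto
  obtain W where W: "openin (prod_topology (mtop Z) (mtop Z)) W" "(act g p, act g q) \<in> W"
    "W \<subseteq> (\<lambda>g. (act g p, act g q)) ` S"
  proof (rule interior_image_in_charts[OF chartM[OF U] chart_prod[OF chartZ[OF V1] chartZ[OF V2]] S(1,2)])
    show "(act g p, act g q) \<in> V1 \<times> V2" if "g \<in> S" for g using that S(3) by auto
    show "holo_on (pair_orbit_in_chart U \<phi> \<psi>1 \<psi>2 p q) (\<phi> ` S)"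
      unfolding S(3) by (rule pair_orbit_in_chart_holo[OF U V1 V2 pq])
    show "pair_orbit_in_chart U \<phi> \<psi>1 \<psi>2 p q (\<phi> g) = (case (act g p, act g q) of (x, y) \<Rightarrow> vjoin (\<psi>1 x) (\<psi>2 y))"
      if "g \<in> S" for g
      using that S(2) orbit_in_chart_apply[OF U] unfolding pair_orbit_in_chart_def by auto
    show "g \<in> S" using S(3) g by auto
  qed (use surj that in auto)
  have "S \<subseteq> carrier G" using openin_subset[OF S(1)] by simp
  then have "W \<subseteq> {(act g p, act g q) | g. g \<in> carrier G}" using W(3) by blast
  then show ?thesis using W(1,2) unfolding generic_pair_def by blast
qed

lemma surjective_if_generic_pair:
  assumes gen: "generic_pair p q"
    and U: "(U, \<phi>) \<in> atlas M" and V1: "(V1, \<psi>1) \<in> atlas Z" and V2: "(V2, \<psi>2) \<in> atlas Z"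
    and pq: "p \<in> points" "q \<in> points"
    and U': "openin (mtop M) U'" "U' \<noteq> {}" "U' \<subseteq> U"
    and U'V: "\<And>g. g \<in> U' \<Longrightarrow> act g p \<in> V1" "\<And>g. g \<in> U' \<Longrightarrow> act g q \<in> V2"
  shows "\<exists>g\<in>U'. surj (\<lambda>v. partial (pair_orbit_in_chart U \<phi> \<psi>1 \<psi>2 p q) v (\<phi> g))"
proof -
  let ?X = "prod_topology (mtop Z) (mtop Z)" and ?a = "\<lambda>g (x, y). (act g x, act g y)"
  obtain W where W: "openin ?X W" "W \<noteq> {}" "W \<subseteq> {(act g p, act g q) | g. g \<in> carrier G}"
    using gen unfolding generic_pair_def by blast
  show ?thesis
  proof (rule orbit_map_surjective_derivative[where X = ?X and a = ?a and x = "(p, q)" and W = W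
        and V = "V1 \<times> V2" and \<kappa> = "\<lambda>(x, y). vjoin (\<psi>1 x) (\<psi>2 y)" and U = U])
    show "Hausdorff_space ?X"
      using mfdZ unfolding complex_manifold_def Hausdorff_space_prod_topology by blast
    show "locally_compact_space ?X"
      using locally_compact_complex_manifold[OF mfdZ] locally_compact_space_prod_topology by blast
    show "continuous_map ?X ?X (?a g)" if "g \<in> carrier G" for g
      using continuous_map_compose[OF continuous_map_fst act_continuous[OF that], of "mtop Z"]
        continuous_map_compose[OF continuous_map_snd act_continuous[OF that], of "mtop Z"]
      by (simp add: continuous_map_pairwise o_def case_prod_beta)
    show "chart ?X (V1 \<times> V2, \<lambda>(x, y). vjoin (\<psi>1 x) (\<psi>2 y))"
      by (rule chart_prod[OF chartZ[OF V1] chartZ[OF V2]])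
    show "holo_on (pair_orbit_in_chart U \<phi> \<psi>1 \<psi>2 p q) (\<phi> ` U')"
      by (rule holo_on_subset[OF pair_orbit_in_chart_holo[OF U V1 V2 pq]]) (use U' U'V in auto)
    show "pair_orbit_in_chart U \<phi> \<psi>1 \<psi>2 p q (\<phi> g) = (case ?a g (p, q) of (x, y) \<Rightarrow> vjoin (\<psi>1 x) (\<psi>2 y))"
      if "g \<in> U'" for g
      using that U'(3) orbit_in_chart_apply[OF U] unfolding pair_orbit_in_chart_def by auto
  qed (use W U' U'V pq chartM[OF U] act_mult in auto)
qed

lemma surjective_orbit_map:
  assumes U: "(U, \<phi>) \<in> atlas M" and V: "(V, \<psi>) \<in> atlas Z" and z: "z \<in> points"
    and U': "openin (mtop M) U'" "U' \<noteq> {}" "U' \<subseteq> U" and U'V: "\<And>g. g \<in> U' \<Longrightarrow> act g z \<in> V"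
  shows "\<exists>g\<in>U'. surj (\<lambda>v. partial (orbit_in_chart U \<phi> \<psi> z) v (\<phi> g))"
proof (rule orbit_map_surjective_derivative[where X = "mtop Z" and a = act and x = z and W = points
        and V = V and \<kappa> = \<psi> and U = U])
  show "Hausdorff_space (mtop Z)" using mfdZ unfolding complex_manifold_def by blast
  show "points \<subseteq> {act g z | g. g \<in> carrier G}" using unique_orbit[OF z] by blast
  show "holo_on (orbit_in_chart U \<phi> \<psi> z) (\<phi> ` U')"
    by (rule holo_on_subset[OF orbit_in_chart_holo[OF U V z]]) (use U' U'V in auto)
  show "orbit_in_chart U \<phi> \<psi> z (\<phi> g) = \<psi> (act g z)" if "g \<in> U'" for g
    using that U'(3) orbit_in_chart_apply[OF U] by blast
qed (use U' U'V z chartM[OF U] chartZ[OF V] act_mult act_continuous locally_compact_complex_manifold[OF mfdZ] in auto)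

text \<open>Near \<open>(act g p, act g q)\<close> a point \<open>(x, y)\<close> can be moved in two steps: some \<open>h\<close> near \<open>g\<close> takes \<open>p\<close> to
  \<open>x\<close>, since the orbit map of \<open>p\<close> is open at a suitable \<open>g\<close>, and the isotropy group of \<open>p\<close> takes \<open>q\<close>
  to \<open>act (inv h) y\<close>.\<close>

lemma generic_pair_if_open_stabilizer_orbit:
  assumes pq: "p \<in> points" "q \<in> points"
    and op: "openin (mtop Z) (subgroup_orbit G (stabilizer G act p) act q)"
  shows "generic_pair p q"
proof -
  let ?Om = "subgroup_orbit G (stabilizer G act p) act q"
  have Om: "?Om = {act k q | k. k \<in> carrier G \<and> act k p = p}"
    unfolding orbit_def stabilizer_def by auto
  obtain U \<phi> where U: "(U, \<phi>) \<in> atlas M" "chart (mtop M) (U, \<phi>)" "\<one> \<in> U"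
    by (rule complex_manifold_chart_at[OF mfdM, of \<one>]) (use that in auto)
  obtain V \<psi> where V: "(V, \<psi>) \<in> atlas Z" "chart (mtop Z) (V, \<psi>)" "p \<in> V"
    by (rule complex_manifold_chart_at[OF mfdZ pq(1)]) (rule that)
  let ?U' = "{g \<in> U. act g p \<in> V}"
  have U': "openin (mtop M) ?U'" by (rule open_orbit_preimage[OF U(1) V(1) pq(1)])
  have "\<one> \<in> ?U'" using U(3) V(3) pq(1) by simp
  then obtain g where g: "g \<in> ?U'" "surj (\<lambda>v. partial (orbit_in_chart U \<phi> \<psi> p) v (\<phi> g))"
    using surjective_orbit_map[OF U(1) V(1) pq(1) U'] by blast
  have gc: "g \<in> carrier G" using g(1) openin_subset[OF U'] by auto
  \<comment> \<open>For \<open>h\<close> near \<open>g\<close> and \<open>y\<close> near \<open>act g q\<close> the point \<open>act (inv h) y\<close> stays in the open orbit.\<close>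
  let ?X = "prod_topology (mtop M) (mtop Z)"
  let ?T = "{x \<in> topspace ?X. (\<lambda>(h, y). act (inv h) y) x \<in> ?Om}"
  have "continuous_map ?X ?X (\<lambda>(h, y). (inv h, y))"
    using continuous_map_compose[OF continuous_map_fst inv_continuous, of "mtop Z"]
    by (simp add: continuous_map_pairwise o_def case_prod_beta continuous_map_snd)
  from continuous_map_compose[OF this act_continuous_prod]
  have "continuous_map ?X (mtop Z) (\<lambda>(h, y). act (inv h) y)" by (simp add: o_def case_prod_unfold)
  then have "openin ?X ?T" using op by (rule openin_continuous_map_preimage)
  then have "\<forall>h y. (h, y) \<in> ?T \<longrightarrow> (\<exists>N B. openin (mtop M) N \<and> openin (mtop Z) B \<and> h \<in> N \<and> y \<in> B \<and> N \<times> B \<subseteq> ?T)"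
    unfolding openin_prod_topology_alt .
  moreover have "(g, act g q) \<in> ?T"
    using gc pq act_closed unfolding Om by (auto intro!: exI[of _ \<one>])
  ultimately obtain N B where NB: "openin (mtop M) N" "openin (mtop Z) B" "g \<in> N" "act g q \<in> B" "N \<times> B \<subseteq> ?T"
    by meson
  have hol: "holo_on (orbit_in_chart U \<phi> \<psi> p) (\<phi> ` (?U' \<inter> N))"
    by (rule holo_on_subset[OF orbit_in_chart_holo[OF U(1) V(1) pq(1)]]) auto
  have ap: "orbit_in_chart U \<phi> \<psi> p (\<phi> h) = \<psi> (act h p)" if "h \<in> ?U' \<inter> N" for h
    using orbit_in_chart_apply[OF U(1)] that by simp
  obtain A where A: "openin (mtop Z) A" "act g p \<in> A" "A \<subseteq> (\<lambda>h. act h p) ` (?U' \<inter> N)"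
    by (rule interior_image_in_charts[OF U(2) V(2) openin_Int[OF U' NB(1)] _ _ hol ap _ g(2)])
      (use g(1) NB(3) that in auto)
  have "A \<times> B \<subseteq> {(act h p, act h q) | h. h \<in> carrier G}"
  proof clarify
    fix x y assume x: "x \<in> A" and y: "y \<in> B"
    obtain h where h: "h \<in> N" "x = act h p" using A(3) x by blast
    have hc: "h \<in> carrier G" using h(1) openin_subset[OF NB(1)] by auto
    have yZ: "y \<in> points" using y openin_subset[OF NB(2)] by auto
    have "act (inv h) y \<in> ?Om" using NB(5) h(1) y by auto
    then obtain k where k: "k \<in> carrier G" "act k p = p" "act (inv h) y = act k q" unfolding Om by auto
    have "x = act (h \<otimes> k) p" using act_mult[OF hc k(1) pq(1)] h(2) k(2) by simp
    moreover have "y = act (h \<otimes> k) q"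
      using act_mult[OF hc k(1) pq(2)] act_inv(2)[OF hc yZ] k(3) by simp
    ultimately show "\<exists>h. (x, y) = (act h p, act h q) \<and> h \<in> carrier G" using hc k(1) by blast
  qed
  moreover have "openin (prod_topology (mtop Z) (mtop Z)) (A \<times> B)"
    using A(1) NB(2) by (simp add: openin_prod_Times_iff)
  ultimately show ?thesis using A(2) NB(4) unfolding generic_pair_def by blast
qed

end

section \<open>Genericity along holomorphic curves\<close>

lemma holomorphic_on_det:
  fixes A :: "complex \<Rightarrow> complex^'k^'k"
  assumes "\<And>i j. (\<lambda>z. A z $ i $ j) holomorphic_on S"
  shows "(\<lambda>z. det (A z)) holomorphic_on S"
  unfolding det_def using assms by (intro holomorphic_intros)

lemma surj_if_det_nonzero:
  fixes A :: "complex^'m^'k" and B :: "complex^'k^'m"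
  assumes "det (A ** B) \<noteq> 0"
  shows "surj ((*v) A)"
proof -
  obtain C where "(A ** B) ** C = mat 1"
    using assms invertible_det_nz[of "A ** B"] unfolding invertible_def by blast
  then have "A ** (B ** C) = mat 1" by (simp add: matrix_mul_assoc)
  then show ?thesis using matrix_right_invertible_surjective by blast
qed

context holomorphic_action
begin

lemma compact_moved_in_open:
  assumes K: "compactin (mtop Z) K" and V: "openin (mtop Z) V" and KV: "K \<subseteq> V"
  obtains N where "openin (mtop M) N" "\<one> \<in> N" "\<And>g k. g \<in> N \<Longrightarrow> k \<in> K \<Longrightarrow> act g k \<in> V"
proof -
  let ?X = "prod_topology (mtop M) (mtop Z)"
  let ?T = "{x \<in> topspace ?X. (\<lambda>(g, z). act g z) x \<in> V}"
  have T: "openin ?X ?T" using openin_continuous_map_preimage[OF act_continuous_prod V] .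
  have c1: "compactin (mtop M) {\<one>}" by simp
  have KT: "{\<one>} \<times> K \<subseteq> ?T" using KV compactin_subset_topspace[OF K] by (auto simp: subset_iff)
  obtain N B where NB: "openin (mtop M) N" "{\<one>} \<subseteq> N" "K \<subseteq> B" "N \<times> B \<subseteq> ?T"
    by (rule Wallace_theorem_prod_topology[OF c1 K T KT]) (rule that)
  have "act g k \<in> V" if "g \<in> N" "k \<in> K" for g k
  proof -
    have "(g, k) \<in> ?T" using that NB(3,4) by blast
    then show ?thesis by simp
  qed
  then show ?thesis using that[of N] NB(1,2) by simp
qed

text \<open>Here \<open>A\<close> is the action read in charts. The formula shows how the derivative depends on the second
  point \<open>z\<close>: only through the base point of a partial derivative of one holomorphic map.\<close>

lemma partial_pair_orbit_in_chart:
  assumes U: "(U, \<phi>) \<in> atlas M" and V1: "(V1, \<psi>1) \<in> atlas Z" and V: "(V, \<psi>) \<in> atlas Z"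
    and A: "open \<Omega>" "holo_on A \<Omega>"
      "\<Omega> = {vjoin (\<phi> g) (\<psi> z) | g z. g \<in> U \<and> z \<in> V \<and> act g z \<in> V}"
      "\<And>g z. g \<in> U \<Longrightarrow> z \<in> V \<Longrightarrow> act g z \<in> V \<Longrightarrow> A (vjoin (\<phi> g) (\<psi> z)) = \<psi> (act g z)"
    and c: "c \<in> points" and g: "g \<in> U" "act g c \<in> V1" and z: "z \<in> V" "act g z \<in> V"
  shows "partial (pair_orbit_in_chart U \<phi> \<psi>1 \<psi> c z) v (\<phi> g) =
     vjoin (partial (orbit_in_chart U \<phi> \<psi>1 c) v (\<phi> g)) (partial A (vjoin v 0) (vjoin (\<phi> g) (\<psi> z)))"
proof -
  have zp: "z \<in> points" using z(1) chart_topspace[OF chartZ[OF V]] by blast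
  have 1: "(orbit_in_chart U \<phi> \<psi>1 c has_derivative (\<lambda>v. partial (orbit_in_chart U \<phi> \<psi>1 c) v (\<phi> g))) (at (\<phi> g))"
    by (rule holo_on_has_derivative(1)[OF orbit_in_chart_holo[OF U V1 c]]) (use g in auto)
  have j: "((\<lambda>x. vjoin x (\<psi> z)) has_derivative (\<lambda>v. vjoin v 0)) (at (\<phi> g))"
    by (rule has_derivative_vjoin[OF has_derivative_ident has_derivative_const])
  have "(A has_derivative (\<lambda>w. partial A w (vjoin (\<phi> g) (\<psi> z)))) (at (vjoin (\<phi> g) (\<psi> z)))"
    by (rule holo_on_has_derivative(1)[OF A(2)]) (use A(3) g z in auto)
  from diff_chain_at[OF j this]
  have "(A \<circ> (\<lambda>x. vjoin x (\<psi> z)) has_derivative (\<lambda>v. partial A (vjoin v 0) (vjoin (\<phi> g) (\<psi> z)))) (at (\<phi> g))"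
    by (simp add: o_def)
  then have 2: "(orbit_in_chart U \<phi> \<psi> z has_derivative (\<lambda>v. partial A (vjoin v 0) (vjoin (\<phi> g) (\<psi> z)))) (at (\<phi> g))"
  proof (rule has_derivative_transform_within_open)
    have "open (\<phi> ` (U \<inter> {g \<in> U. act g z \<in> V}))"
      by (rule chart_open_image[OF chartM[OF U] open_orbit_preimage[OF U V zp]])
    then show "open (\<phi> ` {g \<in> U. act g z \<in> V})" by (simp add: Int_def)
    show "\<phi> g \<in> \<phi> ` {g \<in> U. act g z \<in> V}" using g z by blast
    show "(A \<circ> (\<lambda>x. vjoin x (\<psi> z))) x = orbit_in_chart U \<phi> \<psi> z x" if "x \<in> \<phi> ` {g \<in> U. act g z \<in> V}" for x
      using that A(4) z orbit_in_chart_apply[OF U] by auto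
  qed
  show ?thesis
    unfolding pair_orbit_in_chart_def
    by (rule partial_eqI[OF has_derivative_vjoin[OF 1 2]])
qed

text \<open>Take the derivative of the orbit map of \<open>(c, q \<zeta>)\<close> at one group element near the identity, chosen so that
  this derivative is onto for \<open>\<zeta> = \<zeta>0\<close>. The function \<open>D\<close> is the determinant of this derivative composed
  with a fixed right inverse belonging to \<open>\<zeta>0\<close>. As \<open>K\<close> is compact, a group element near the identity
  keeps the whole curve inside the chart.\<close>

lemma generic_along_curve:
  assumes c: "c \<in> points" and V: "(V, \<psi>) \<in> atlas Z" and K: "compactin (mtop Z) K" "K \<subseteq> V"
    and W: "open W" and qK: "\<And>\<zeta>. \<zeta> \<in> W \<Longrightarrow> q \<zeta> \<in> K" and q: "holo_curve (\<lambda>\<zeta>. \<psi> (q \<zeta>)) W"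
    and \<zeta>0: "\<zeta>0 \<in> W" "generic_pair c (q \<zeta>0)"
  obtains D where "D holomorphic_on W" "D \<zeta>0 \<noteq> 0" "\<And>\<zeta>. \<zeta> \<in> W \<Longrightarrow> D \<zeta> \<noteq> 0 \<Longrightarrow> generic_pair c (q \<zeta>)"
proof -
  obtain U \<phi> where U: "(U, \<phi>) \<in> atlas M" "chart (mtop M) (U, \<phi>)" "\<one> \<in> U"
    by (rule complex_manifold_chart_at[OF mfdM, of \<one>]) (use that in auto)
  obtain V1 \<psi>1 where V1: "(V1, \<psi>1) \<in> atlas Z" "chart (mtop Z) (V1, \<psi>1)" "c \<in> V1"
    by (rule complex_manifold_chart_at[OF mfdZ c]) (rule that)
  obtain N where N: "openin (mtop M) N" "\<one> \<in> N" "\<And>g k. g \<in> N \<Longrightarrow> k \<in> K \<Longrightarrow> act g k \<in> V"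
    by (rule compact_moved_in_open[OF K(1) chart_openin[OF chartZ[OF V]] K(2)]) (rule that)
  define U' where "U' = {g \<in> U. act g c \<in> V1} \<inter> N"
  have U': "openin (mtop M) U'" "U' \<noteq> {}" "U' \<subseteq> U"
    using open_orbit_preimage[OF U(1) V1(1) c] N U(3) V1(3) c unfolding U'_def by auto
  have qV: "q \<zeta> \<in> V" and qZ: "q \<zeta> \<in> points" if "\<zeta> \<in> W" for \<zeta>
    using qK[OF that] K compactin_subset_topspace by blast+
  have "\<exists>g\<in>U'. surj (\<lambda>v. partial (pair_orbit_in_chart U \<phi> \<psi>1 \<psi> c (q \<zeta>0)) v (\<phi> g))"
    by (rule surjective_if_generic_pair[OF \<zeta>0(2) U(1) V1(1) V c qZ[OF \<zeta>0(1)] U'])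
      (use N(3) qK[OF \<zeta>0(1)] in \<open>auto simp: U'_def\<close>)
  then obtain g where g: "g \<in> U'" "surj (\<lambda>v. partial (pair_orbit_in_chart U \<phi> \<psi>1 \<psi> c (q \<zeta>0)) v (\<phi> g))" by blast
  have gU: "g \<in> U" "act g c \<in> V1" and gN: "\<And>\<zeta>. \<zeta> \<in> W \<Longrightarrow> act g (q \<zeta>) \<in> V"
    using g(1) N(3) qK unfolding U'_def by auto
  obtain A \<Omega> where A: "open \<Omega>" "holo_on A \<Omega>"
    "\<Omega> = {vjoin (\<phi> g) (\<psi> z) | g z. g \<in> U \<and> z \<in> V \<and> act g z \<in> V}"
    "\<And>g z. g \<in> U \<Longrightarrow> z \<in> V \<Longrightarrow> act g z \<in> V \<Longrightarrow> A (vjoin (\<phi> g) (\<psi> z)) = \<psi> (act g z)"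
    by (rule action_in_charts[OF U(1) V V]) (rule that)
  define P where "P = (\<lambda>\<zeta> v. partial (pair_orbit_in_chart U \<phi> \<psi>1 \<psi> c (q \<zeta>)) v (\<phi> g))"
  have Pm: "matrix (P \<zeta>) *v v = P \<zeta> v" if "\<zeta> \<in> W" for \<zeta> v
    unfolding P_def
    by (rule partial_matrix[OF pair_orbit_in_chart_holo[OF U(1) V1(1) V c qZ[OF that]]])
      (use gU gN[OF that] in auto)
  have hol: "(\<lambda>\<zeta>. matrix (P \<zeta>) $ i $ j) holomorphic_on W" for i j
  proof -
    have cv: "holo_curve (\<lambda>\<zeta>. vjoin (\<phi> g) (\<psi> (q \<zeta>))) W"
      by (rule holo_curve_vjoin[OF _ q]) (auto simp: holo_curve_def)
    have "holo_curve (\<lambda>\<zeta>. vjoin (partial (orbit_in_chart U \<phi> \<psi>1 c) (axis j 1) (\<phi> g))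
            (partial A (vjoin (axis j 1) 0) (vjoin (\<phi> g) (\<psi> (q \<zeta>))))) W"
      by (rule holo_curve_vjoin[OF _ holo_curve_partial[OF A(2,1) cv W]])
        (use A(3) gU gN qV in \<open>auto simp: holo_curve_def\<close>)
    then have "(\<lambda>\<zeta>. vjoin (partial (orbit_in_chart U \<phi> \<psi>1 c) (axis j 1) (\<phi> g))
            (partial A (vjoin (axis j 1) 0) (vjoin (\<phi> g) (\<psi> (q \<zeta>)))) $ i) holomorphic_on W"
      unfolding holo_curve_def by blast
    moreover have "matrix (P \<zeta>) $ i $ j = vjoin (partial (orbit_in_chart U \<phi> \<psi>1 c) (axis j 1) (\<phi> g))
            (partial A (vjoin (axis j 1) 0) (vjoin (\<phi> g) (\<psi> (q \<zeta>)))) $ i" if "\<zeta> \<in> W" for \<zeta>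
      unfolding matrix_def P_def
      using partial_pair_orbit_in_chart[OF U(1) V1(1) V A c gU qV[OF that] gN[OF that]] by simp
    ultimately show ?thesis by (simp cong: holomorphic_cong)
  qed
  have "surj ((*v) (matrix (P \<zeta>0)))" using g(2) Pm[OF \<zeta>0(1)] unfolding P_def by simp
  then obtain B where B: "matrix (P \<zeta>0) ** B = mat 1"
    using matrix_right_invertible_surjective by blast
  show ?thesis
  proof (rule that[of "\<lambda>\<zeta>. det (matrix (P \<zeta>) ** B)"])
    show "(\<lambda>\<zeta>. det (matrix (P \<zeta>) ** B)) holomorphic_on W"
      by (rule holomorphic_on_det) (auto simp: matrix_matrix_mult_def intro!: holomorphic_intros hol)
    show "det (matrix (P \<zeta>0) ** B) \<noteq> 0" by (simp add: B)
    fix \<zeta> assume \<zeta>: "\<zeta> \<in> W" "det (matrix (P \<zeta>) ** B) \<noteq> 0"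
    have "surj (P \<zeta>)" using surj_if_det_nonzero[OF \<zeta>(2)] Pm[OF \<zeta>(1)] by (simp add: fun_eq_iff cong: image_cong)
    then show "generic_pair c (q \<zeta>)"
      using generic_pair_if_surjective[OF U(1) V1(1) V c qZ gU gN] \<zeta>(1) unfolding P_def by blast
  qed
qed


text \<open>The closed ball lies in a chart of the atlas as well, so that curves in the ball stay in a compact part
  of that chart, as required for \<open>generic_along_curve\<close>.\<close>

lemma slice_ball:
  assumes C: "complex_submanifold Z C" and a: "a \<in> C"
  obtains S \<sigma> L V \<psi> \<delta> where "holo_chart Z (S, \<sigma>)" "a \<in> S" "(V, \<psi>) \<in> atlas Z" "vec.subspace L"
    "\<sigma> ` (S \<inter> C) = \<sigma> ` S \<inter> L" "0 < \<delta>" "cball (\<sigma> a) \<delta> \<subseteq> \<sigma> ` (S \<inter> V)"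
proof -
  obtain S \<sigma> L where S: "holo_chart Z (S, \<sigma>)" "a \<in> S" "vec.subspace L" "\<sigma> ` (S \<inter> C) = \<sigma> ` S \<inter> L"
    using C a unfolding complex_submanifold_def by blast
  have "a \<in> points" using C a unfolding complex_submanifold_def by blast
  then obtain V \<psi> where V: "(V, \<psi>) \<in> atlas Z" "chart (mtop Z) (V, \<psi>)" "a \<in> V"
    by (rule complex_manifold_chart_at[OF mfdZ]) (rule that)
  have "chart (mtop Z) (S, \<sigma>)" using S(1) unfolding holo_chart_def by blast
  then have "open (\<sigma> ` (S \<inter> V))" using chart_open_image chart_openin[OF V(2)] by blast
  moreover have "\<sigma> a \<in> \<sigma> ` (S \<inter> V)" using S(2) V(3) by blast
  ultimately obtain \<delta> where "0 < \<delta>" "cball (\<sigma> a) \<delta> \<subseteq> \<sigma> ` (S \<inter> V)"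
    using open_contains_cball by blast
  then show ?thesis using that S V(1) by blast
qed

definition slice_line :: "'z set \<Rightarrow> ('z \<Rightarrow> complex^'n) \<Rightarrow> complex^'n \<Rightarrow> complex^'n \<Rightarrow> complex \<Rightarrow> 'z" where
  "slice_line S \<sigma> y0 y1 \<zeta> = inv_into S \<sigma> (y0 + \<zeta> *s (y1 - y0))"

lemma slice_line_properties:
  assumes S: "holo_chart Z (S, \<sigma>)" and V: "(V, \<psi>) \<in> atlas Z" and L: "vec.subspace L"
    and SC: "\<sigma> ` (S \<inter> C) = \<sigma> ` S \<inter> L" and \<delta>: "cball y \<delta> \<subseteq> \<sigma> ` (S \<inter> V)"
    and y: "y0 \<in> ball y \<delta>" "y1 \<in> ball y \<delta>" "y0 \<in> L" "y1 \<in> L"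
  defines "W \<equiv> {\<zeta>. y0 + \<zeta> *s (y1 - y0) \<in> ball y \<delta>}" and "q \<equiv> slice_line S \<sigma> y0 y1"
  shows "open W" "connected W" "0 \<in> W" "1 \<in> W"
    "q 0 = inv_into S \<sigma> y0" "q 1 = inv_into S \<sigma> y1"
    "continuous_map (top_of_set W) (mtop Z) q" "q ` W \<subseteq> C" "q ` W \<subseteq> V"
    "holo_curve (\<lambda>\<zeta>. \<psi> (q \<zeta>)) W"
    "c \<in> points \<Longrightarrow> \<zeta>0 \<in> W \<Longrightarrow> generic_pair c (q \<zeta>0) \<Longrightarrow>
      \<exists>D. D holomorphic_on W \<and> D \<zeta>0 \<noteq> 0 \<and> (\<forall>\<zeta>\<in>W. D \<zeta> \<noteq> 0 \<longrightarrow> generic_pair c (q \<zeta>))"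
proof -
  let ?l = "\<lambda>\<zeta>. y0 + \<zeta> *s (y1 - y0)"
  have cS: "chart (mtop Z) (S, \<sigma>)" and tr: "transition_holo (S, \<sigma>) (V, \<psi>)"
    using S V unfolding holo_chart_def by auto
  have cl: "continuous_on UNIV ?l"
    by (rule holo_curve_continuous[OF holo_curve_line])
  show oW: "open W" unfolding W_def using open_vimage[OF open_ball cl] by (simp add: vimage_def)
  have "linear (\<lambda>\<zeta>::complex. \<zeta> *s (y1 - y0))"
    by (rule linearI) (auto simp: vec_eq_iff algebra_simps)
  moreover have "W = (\<lambda>\<zeta>. \<zeta> *s (y1 - y0)) -` ball (y - y0) \<delta>"
    unfolding W_def by (auto simp: dist_norm algebra_simps)
  ultimately have "convex W" using convex_linear_vimage convex_ball by metis
  then show "connected W" by (rule convex_connected)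
  show "0 \<in> W" "1 \<in> W" using y unfolding W_def by auto
  show "q 0 = inv_into S \<sigma> y0" "q 1 = inv_into S \<sigma> y1" unfolding q_def slice_line_def by simp_all
  have lW: "?l \<zeta> \<in> cball y \<delta>" if "\<zeta> \<in> W" for \<zeta> using that unfolding W_def by simp
  have lS: "?l \<zeta> \<in> \<sigma> ` (S \<inter> V)" if "\<zeta> \<in> W" for \<zeta> using lW[OF that] \<delta> by blast
  have "continuous_map (top_of_set W) (top_of_set (\<sigma> ` S)) ?l"
    unfolding continuous_map_in_subtopology using lS cl
    by (auto intro: continuous_on_subset)
  from continuous_map_compose[OF this chart_inv_continuous[OF cS]]
  show "continuous_map (top_of_set W) (mtop Z) q" unfolding q_def slice_line_def o_def .
  show "q ` W \<subseteq> C"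
  proof clarify
    fix \<zeta> assume \<zeta>: "\<zeta> \<in> W"
    have "?l \<zeta> \<in> L" using L y(3,4) by (intro vec.subspace_add vec.subspace_scale vec.subspace_diff)
    then obtain x where "x \<in> S \<inter> C" "?l \<zeta> = \<sigma> x" using lS[OF \<zeta>] SC by blast
    then show "q \<zeta> \<in> C" using cS unfolding q_def slice_line_def by simp
  qed
  show qV: "q ` W \<subseteq> V"
  proof clarify
    fix \<zeta> assume \<zeta>: "\<zeta> \<in> W"
    obtain x where "x \<in> S \<inter> V" "?l \<zeta> = \<sigma> x" using lS[OF \<zeta>] by blast
    then show "q \<zeta> \<in> V" using cS unfolding q_def slice_line_def by simp
  qed
  have "holo_curve (\<lambda>\<zeta>. (\<psi> \<circ> inv_into S \<sigma>) (?l \<zeta>)) W"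
    by (rule holo_curve_compose[OF _ holo_curve_line oW, of _ "\<sigma> ` (S \<inter> V)"])
      (use tr lS in \<open>auto simp: transition_holo_def o_def\<close>)
  then show hc: "holo_curve (\<lambda>\<zeta>. \<psi> (q \<zeta>)) W" unfolding q_def slice_line_def by simp
  let ?K = "inv_into S \<sigma> ` cball y \<delta>"
  have K: "compactin (mtop Z) ?K" using chart_compact[OF cS compact_cball] \<delta> by blast
  have KV: "?K \<subseteq> V" using \<delta> cS by force
  have qK: "q \<zeta> \<in> ?K" if "\<zeta> \<in> W" for \<zeta> unfolding q_def slice_line_def using lW[OF that] by blast
  show "\<exists>D. D holomorphic_on W \<and> D \<zeta>0 \<noteq> 0 \<and> (\<forall>\<zeta>\<in>W. D \<zeta> \<noteq> 0 \<longrightarrow> generic_pair c (q \<zeta>))"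
    if c: "c \<in> points" "\<zeta>0 \<in> W" "generic_pair c (q \<zeta>0)"
    by (rule generic_along_curve[OF c(1) V K KV oW qK hc c(2,3)]) auto
qed

text \<open>The limits of generic points form a closed subset of \<open>C\<close>. It is open as well: in a slice ball around
  such a limit there is a generic point, and on the complex line from it to any other point of \<open>C\<close> in the
  ball the points that are not generic are isolated.\<close>

lemma generic_dense_in_submanifold:
  assumes C: "complex_submanifold Z C" "connectedin (mtop Z) C" and c: "c \<in> points"
    and q0: "q0 \<in> C" "generic_pair c q0" and a: "a \<in> C" and N: "openin (mtop Z) N" "a \<in> N"
  shows "\<exists>q\<in>C \<inter> N. generic_pair c q"
proof -
  define E where "E = {q \<in> C. generic_pair c q}"
  define A where "A = C \<inter> mtop Z closure_of E"
  have CZ: "C \<subseteq> points" using C(1) unfolding complex_submanifold_def by blast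
  have EA: "E \<subseteq> A" unfolding A_def using closure_of_subset[of E "mtop Z"] CZ unfolding E_def by blast
  have nbhd: "\<exists>N. openin (mtop Z) N \<and> a \<in> N \<and> C \<inter> N \<subseteq> A" if a: "a \<in> A" for a
  proof -
    have aC: "a \<in> C" using a unfolding A_def by blast
    obtain S \<sigma> L V \<psi> \<delta> where S: "holo_chart Z (S, \<sigma>)" "a \<in> S" and V: "(V, \<psi>) \<in> atlas Z"
      and L: "vec.subspace L" "\<sigma> ` (S \<inter> C) = \<sigma> ` S \<inter> L" and \<delta>: "0 < \<delta>" "cball (\<sigma> a) \<delta> \<subseteq> \<sigma> ` (S \<inter> V)"
      by (rule slice_ball[OF C(1) aC]) (rule that)
    have cS: "chart (mtop Z) (S, \<sigma>)" using S unfolding holo_chart_def by auto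
    define N where "N = {x \<in> S. \<sigma> x \<in> ball (\<sigma> a) \<delta>}"
    have N: "openin (mtop Z) N" "a \<in> N"
      unfolding N_def using chart_open_preimage[OF cS open_ball] S(2) \<delta>(1) by auto
    obtain q0 where q0: "q0 \<in> E" "q0 \<in> N"
    proof -
      have "a \<in> mtop Z closure_of E" using a unfolding A_def by blast
      then show thesis using that N unfolding in_closure_of by blast
    qed
    have yq: "\<sigma> x \<in> ball (\<sigma> a) \<delta>" "\<sigma> x \<in> L" "inv_into S \<sigma> (\<sigma> x) = x" if "x \<in> C \<inter> N" for x
      using that L(2) cS unfolding N_def by auto
    have q0': "q0 \<in> C \<inter> N" "generic_pair c q0" using q0 unfolding E_def by auto
    have "C \<inter> N \<subseteq> A"
    proof
      fix x assume x: "x \<in> C \<inter> N"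
      let ?W = "{\<zeta>. \<sigma> q0 + \<zeta> *s (\<sigma> x - \<sigma> q0) \<in> ball (\<sigma> a) \<delta>}" and ?q = "slice_line S \<sigma> (\<sigma> q0) (\<sigma> x)"
      note P = slice_line_properties[OF S(1) V L \<delta>(2) yq(1)[OF q0'(1)] yq(1)[OF x] yq(2)[OF q0'(1)] yq(2)[OF x]]
      have "generic_pair c (?q 0)" using P(5) yq(3)[OF q0'(1)] q0'(2) by simp
      then obtain D where D: "D holomorphic_on ?W" "D 0 \<noteq> 0" "\<forall>\<zeta>\<in>?W. D \<zeta> \<noteq> 0 \<longrightarrow> generic_pair c (?q \<zeta>)"
        using P(11)[OF c P(3)] by blast
      have "x \<in> mtop Z closure_of E"
        unfolding in_closure_of
      proof (intro conjI allI impI)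
        show "x \<in> points" using x CZ by blast
        fix T assume T: "x \<in> T \<and> openin (mtop Z) T"
        define B where "B = {\<zeta> \<in> ?W. ?q \<zeta> \<in> T}"
        have "openin (top_of_set ?W) {\<zeta> \<in> topspace (top_of_set ?W). ?q \<zeta> \<in> T}"
          using openin_continuous_map_preimage[OF P(7)] T by blast
        then have oB: "open B" unfolding B_def using P(1) by (simp add: openin_open_eq)
        have "1 \<in> B" unfolding B_def using P(4,6) yq(3)[OF x] T by simp
        then have "B \<noteq> {}" by blast
        have BW: "B \<subseteq> ?W" unfolding B_def by (rule Collect_restrict)
        have "\<exists>\<zeta>\<in>B. D \<zeta> \<noteq> 0"
        proof (rule ccontr)
          assume "\<not> ?thesis"
          then have "D \<zeta> = 0" if "\<zeta> \<in> B" for \<zeta> using that by blast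
          from analytic_continuation_open[OF oB P(1) \<open>B \<noteq> {}\<close> P(2) BW D(1) holomorphic_on_const this P(3)]
          show False using D(2) by simp
        qed
        then obtain \<zeta> where "\<zeta> \<in> ?W" "?q \<zeta> \<in> T" "D \<zeta> \<noteq> 0" unfolding B_def by blast
        then show "\<exists>y. y \<in> E \<and> y \<in> T" using D(3) P(8) unfolding E_def by blast
      qed
      then show "x \<in> A" using x unfolding A_def by blast
    qed
    then show ?thesis using N by blast
  qed
  have "openin (subtopology (mtop Z) C) A"
    unfolding openin_subopen[of _ A]
  proof
    fix x assume x: "x \<in> A"
    obtain N where N: "openin (mtop Z) N" "x \<in> N" "C \<inter> N \<subseteq> A" using nbhd[OF x] by blast
    show "\<exists>T. openin (subtopology (mtop Z) C) T \<and> x \<in> T \<and> T \<subseteq> A"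
      using openin_subtopology_Int2[OF N(1), of C] N(2,3) x unfolding A_def by blast
  qed
  moreover have "closedin (subtopology (mtop Z) C) A"
    unfolding A_def using closedin_subtopology_Int_closed[OF closedin_closure_of] by blast
  ultimately have "A = {} \<or> A = topspace (subtopology (mtop Z) C)"
    using C(2) unfolding connectedin_def connected_space_clopen_in by blast
  moreover have "A \<noteq> {}" using EA q0 unfolding E_def by blast
  ultimately have "A = C" using CZ by auto
  then have "a \<in> mtop Z closure_of E" using a unfolding A_def by blast
  then show ?thesis using N unfolding in_closure_of E_def by blast
qed

text \<open>On the complex line through \<open>c\<close> and a generic point nearby, the points that are not generic are zeros
  of a holomorphic function that does not vanish identically. So some circle around \<open>c\<close> avoids them.\<close>

lemma disk_with_generic_boundary:
  assumes C: "complex_submanifold Z C" "connectedin (mtop Z) C" and c: "c \<in> C"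
    and q0: "q0 \<in> C" "generic_pair c q0"
  obtains h W V \<psi> where "open W" "cball 0 1 \<subseteq> W" "continuous_map (top_of_set W) (mtop Z) h" "h ` W \<subseteq> C" "h 0 = c"
    "\<And>t. t \<in> sphere 0 1 \<Longrightarrow> generic_pair c (h t)" "(V, \<psi>) \<in> atlas Z" "h ` W \<subseteq> V" "holo_curve (\<lambda>t. \<psi> (h t)) W"
proof -
  have cZ: "c \<in> points" using C(1) c unfolding complex_submanifold_def by blast
  obtain S \<sigma> L V \<psi> \<delta> where S: "holo_chart Z (S, \<sigma>)" "c \<in> S" and V: "(V, \<psi>) \<in> atlas Z"
    and L: "vec.subspace L" "\<sigma> ` (S \<inter> C) = \<sigma> ` S \<inter> L" and \<delta>: "0 < \<delta>" "cball (\<sigma> c) \<delta> \<subseteq> \<sigma> ` (S \<inter> V)"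
    by (rule slice_ball[OF C(1) c]) (rule that)
  have cS: "chart (mtop Z) (S, \<sigma>)" using S unfolding holo_chart_def by auto
  define N where "N = {x \<in> S. \<sigma> x \<in> ball (\<sigma> c) \<delta>}"
  have N: "openin (mtop Z) N" "c \<in> N"
    unfolding N_def using chart_open_preimage[OF cS open_ball] S(2) \<delta>(1) by auto
  obtain q1 where q1: "q1 \<in> C \<inter> N" "generic_pair c q1"
    using generic_dense_in_submanifold[OF C cZ q0 c N] by blast
  have yq: "\<sigma> x \<in> ball (\<sigma> c) \<delta>" "\<sigma> x \<in> L" "inv_into S \<sigma> (\<sigma> x) = x" if "x \<in> C \<inter> N" for x
    using that L(2) cS unfolding N_def by auto
  have cN: "c \<in> C \<inter> N" using c N by blast
  let ?W = "{\<zeta>. \<sigma> c + \<zeta> *s (\<sigma> q1 - \<sigma> c) \<in> ball (\<sigma> c) \<delta>}" and ?q = "slice_line S \<sigma> (\<sigma> c) (\<sigma> q1)"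
  note P = slice_line_properties[OF S(1) V L \<delta>(2) yq(1)[OF cN] yq(1)[OF q1(1)] yq(2)[OF cN] yq(2)[OF q1(1)]]
  have "generic_pair c (?q 1)" using P(6) yq(3)[OF q1(1)] q1(2) by simp
  then obtain D where D: "D holomorphic_on ?W" "D 1 \<noteq> 0" "\<forall>\<zeta>\<in>?W. D \<zeta> \<noteq> 0 \<longrightarrow> generic_pair c (?q \<zeta>)"
    using P(11)[OF cZ P(4)] by blast
  have cb: "cball 0 1 \<subseteq> ?W"
  proof
    fix \<zeta> :: complex assume "\<zeta> \<in> cball 0 1"
    then have "norm (\<zeta> *s (\<sigma> q1 - \<sigma> c)) \<le> norm (\<sigma> q1 - \<sigma> c)"
      unfolding norm_scaleC by (simp add: mult_left_le_one_le)
    also have "\<dots> < \<delta>" using yq(1)[OF q1(1)] by (simp add: dist_norm norm_minus_commute)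
    finally have "norm (\<zeta> *s (\<sigma> q1 - \<sigma> c)) < \<delta>" .
    moreover have "dist (\<sigma> c) (\<sigma> c + v) = norm v" for v by (simp add: dist_norm)
    ultimately show "\<zeta> \<in> ?W" by (simp only: mem_Collect_eq mem_ball)
  qed
  \<comment> \<open>finitely many zeros leave room for a circle \<open>cmod \<zeta> = r\<close> without zeros\<close>
  have fin: "finite {\<zeta> \<in> cball 0 1. D \<zeta> = 0}"
  proof (cases "D constant_on ?W")
    case True
    then obtain k where k: "D \<zeta> = k" if "\<zeta> \<in> ?W" for \<zeta> unfolding constant_on_def by blast
    have "D \<zeta> \<noteq> 0" if "\<zeta> \<in> cball 0 1" for \<zeta>
      using k[OF P(4)] k[OF subsetD[OF cb that]] D(2) by simp
    then have "{\<zeta> \<in> cball 0 1. D \<zeta> = 0} = {}" by blast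
    then show ?thesis by (simp only: finite.emptyI)
  next
    case False
    then show ?thesis by (rule holomorphic_compact_finite_zeros[OF D(1) P(1,2) compact_cball cb])
  qed
  have "infinite ({0<..<1::real} - cmod ` {\<zeta> \<in> cball 0 1. D \<zeta> = 0})"
    using fin infinite_Ioo[of 0 "1::real"] by (simp add: Diff_infinite_finite)
  then obtain r where r: "0 < r" "r < 1" "r \<notin> cmod ` {\<zeta> \<in> cball 0 1. D \<zeta> = 0}"
    by (metis (no_types, lifting) DiffE infinite_imp_nonempty ex_in_conv greaterThanLessThan_iff)
  let ?s = "\<lambda>t. complex_of_real r * t"
  have sW: "?s t \<in> ?W" if "t \<in> ball 0 (1 / r)" for t
  proof -
    have "cmod (?s t) \<le> 1" using that r(1) by (simp add: norm_mult field_simps)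
    then show ?thesis using cb by (meson mem_cball_0 subsetD)
  qed
  show ?thesis
  proof (rule that)
    show "open (ball (0::complex) (1 / r))" by simp
    show "cball (0::complex) 1 \<subseteq> ball 0 (1 / r)" 
    proof -
      have "1 < 1 / r" using r(1,2) by simp
      then show ?thesis by auto
    qed
    have "continuous_map (top_of_set (ball 0 (1 / r))) (top_of_set ?W) ?s"
      unfolding continuous_map_in_subtopology using sW by (auto intro!: continuous_intros)
    from continuous_map_compose[OF this P(7)]
    show "continuous_map (top_of_set (ball 0 (1 / r))) (mtop Z) (\<lambda>t. ?q (?s t))" by (simp add: o_def)
    show "(\<lambda>t. ?q (?s t)) ` ball 0 (1 / r) \<subseteq> C" "(\<lambda>t. ?q (?s t)) ` ball 0 (1 / r) \<subseteq> V"
      using P(8,9) sW by blast+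
    show "?q (?s 0) = c" using P(5) yq(3)[OF cN] by simp
    show "(V, \<psi>) \<in> atlas Z" by (rule V)
    have "(\<lambda>t. (\<psi> (?q t)) $ i) \<circ> ?s holomorphic_on ball 0 (1 / r)" for i
      by (rule holomorphic_on_compose_gen[of _ _ _ ?W])
        (use P(10) sW in \<open>auto simp: holo_curve_def intro!: holomorphic_intros\<close>)
    then show "holo_curve (\<lambda>t. \<psi> (?q (?s t))) (ball 0 (1 / r))" unfolding holo_curve_def by (simp add: o_def)
    fix t :: complex assume t: "t \<in> sphere 0 1"
    have "cmod (?s t) = r" using t r(1) by (simp add: norm_mult)
    then have st: "?s t \<in> cball 0 1" "cmod (?s t) = r" using r(2) by simp_all
    have "D (?s t) \<noteq> 0"
    proof
      assume "D (?s t) = 0"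
      then have "cmod (?s t) \<in> cmod ` {\<zeta> \<in> cball 0 1. D \<zeta> = 0}" using st(1) by blast
      then show False using r(3) st(2) by simp
    qed
    then show "generic_pair c (?q (?s t))" using D(3) subsetD[OF cb st(1)] by blast
  qed
qed

end

section \<open>Pushing points off the boundary of a family of cycles\<close>

lemma surj_if_onto: "(\<And>y. \<exists>x. f x = y) \<Longrightarrow> surj f"
  unfolding surj_def by metis

lemma (in complex_lie) left_mult_in_chart:
  assumes U: "(U, \<phi>) \<in> atlas M" and a: "a \<in> carrier G"
  shows "open (\<phi> ` {y \<in> U. a \<otimes> y \<in> U})"
    "holo_on (\<lambda>x. \<phi> (a \<otimes> inv_into U \<phi> x)) (\<phi> ` {y \<in> U. a \<otimes> y \<in> U})"
proof -
  let ?S = "\<phi> ` {y \<in> U. a \<otimes> y \<in> U}"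
  have cU: "chart (mtop M) (U, \<phi>)" using complex_manifold_chart[OF mfdM U] .
  have "openin (mtop M) {y \<in> topspace (mtop M). a \<otimes> y \<in> U}"
    using openin_continuous_map_preimage[OF left_mult_continuous[OF a] chart_openin[OF cU]] .
  from chart_open_image[OF cU this] have "open (\<phi> ` (U \<inter> {y \<in> topspace (mtop M). a \<otimes> y \<in> U}))" .
  moreover have "U \<inter> {y \<in> topspace (mtop M). a \<otimes> y \<in> U} = {y \<in> U. a \<otimes> y \<in> U}"
    using chart_topspace[OF cU] by blast
  ultimately show oS: "open ?S" by simp
  have am: "a \<in> topspace (mtop M)" using a by simp
  obtain V \<psi> where V: "(V, \<psi>) \<in> atlas M" "chart (mtop M) (V, \<psi>)" "a \<in> V"
    by (rule complex_manifold_chart_at[OF mfdM am]) (rule that)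
  obtain A \<Omega> where A: "open \<Omega>" "holo_on A \<Omega>"
    "\<Omega> = {vjoin (\<psi> x) (\<phi> y) | x y. x \<in> V \<and> y \<in> U \<and> (case (x, y) of (x, y) \<Rightarrow> x \<otimes> y) \<in> U}"
    "\<And>x y. x \<in> V \<Longrightarrow> y \<in> U \<Longrightarrow> (case (x, y) of (x, y) \<Rightarrow> x \<otimes> y) \<in> U \<Longrightarrow>
       A (vjoin (\<psi> x) (\<phi> y)) = \<phi> (case (x, y) of (x, y) \<Rightarrow> x \<otimes> y)"
    by (rule holomorphic_map_prod_in_charts[OF mfdM mfdM mfdM mult_holomorphic V(1) U U]) (rule that)
  have "holo_on (A \<circ> (\<lambda>x. vjoin (\<psi> a) x)) ?S"
    by (rule holo_on_compose[OF holo_on_vjoin[OF holo_on_const holo_on_id] A(2)]) (use A(3) V in auto)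
  then show "holo_on (\<lambda>x. \<phi> (a \<otimes> inv_into U \<phi> x)) ?S"
    by (rule holo_on_transform[OF _ oS]) (use A(4) V(3) cU in auto)
qed

context holomorphic_action
begin

text \<open>A surjective derivative at one group element suffices, since left translations carry it around.\<close>

lemma orbit_map_open:
  assumes z: "z \<in> points" and N: "openin (mtop M) N"
  shows "openin (mtop Z) ((\<lambda>g. act g z) ` N)"
  unfolding openin_subopen[of _ "(\<lambda>g. act g z) ` N"]
proof
  fix y assume "y \<in> (\<lambda>g. act g z) ` N"
  then obtain g where g: "g \<in> N" "y = act g z" by blast
  have gc: "g \<in> carrier G" using g(1) openin_subset[OF N] by auto
  have om: "\<one> \<in> topspace (mtop M)" by simp
  obtain U \<phi> where U: "(U, \<phi>) \<in> atlas M" "chart (mtop M) (U, \<phi>)" "\<one> \<in> U"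
    by (rule complex_manifold_chart_at[OF mfdM om]) (rule that)
  obtain V \<psi> where V: "(V, \<psi>) \<in> atlas Z" "chart (mtop Z) (V, \<psi>)" "z \<in> V"
    by (rule complex_manifold_chart_at[OF mfdZ z]) (rule that)
  let ?U' = "{g \<in> U. act g z \<in> V}"
  have U': "openin (mtop M) ?U'" by (rule open_orbit_preimage[OF U(1) V(1) z])
  have "\<one> \<in> ?U'" using U(3) V(3) z by simp
  then obtain g1 where g1: "g1 \<in> ?U'" "surj (\<lambda>v. partial (orbit_in_chart U \<phi> \<psi> z) v (\<phi> g1))"
    using surjective_orbit_map[OF U(1) V(1) z U'] by blast
  have g1c: "g1 \<in> carrier G" using g1(1) openin_subset[OF U'] by auto
  define a where "a = g \<otimes> inv g1"
  have ac: "a \<in> carrier G" and ag1: "a \<otimes> g1 = g" unfolding a_def using gc g1c by (auto simp: m_assoc)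
  define S where "S = ?U' \<inter> {y \<in> carrier G. a \<otimes> y \<in> N}"
  have oS: "openin (mtop M) S"
    unfolding S_def using openin_continuous_map_preimage[OF left_mult_continuous[OF ac] N] U' by auto
  have g1S: "g1 \<in> S" unfolding S_def using g1 g1c ag1 g by simp
  have SU: "S \<subseteq> U" and SV: "\<And>h. h \<in> S \<Longrightarrow> act h z \<in> V" unfolding S_def by auto
  have hol: "holo_on (orbit_in_chart U \<phi> \<psi> z) (\<phi> ` S)"
    by (rule holo_on_subset[OF orbit_in_chart_holo[OF U(1) V(1) z]]) (auto simp: S_def)
  have ap: "orbit_in_chart U \<phi> \<psi> z (\<phi> h) = \<psi> (act h z)" if "h \<in> S" for h
    using orbit_in_chart_apply[OF U(1)] that SU by blast
  have "\<exists>W. openin (mtop Z) W \<and> act g1 z \<in> W \<and> W \<subseteq> (\<lambda>h. act h z) ` S"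
    by (rule interior_image_in_charts[OF U(2) V(2) oS SU SV hol ap g1S g1(2)]) blast+
  then obtain W where W: "openin (mtop Z) W" "act g1 z \<in> W" "W \<subseteq> (\<lambda>h. act h z) ` S" by blast
  let ?T = "{y \<in> points. act (inv a) y \<in> W}"
  have "openin (mtop Z) ?T"
    using openin_continuous_map_preimage[OF act_continuous[OF inv_closed[OF ac]] W(1)] .
  moreover have "y \<in> ?T"
    using g(2) ag1 act_mult[OF ac g1c z] ac g1c z W(2) act_closed by auto
  moreover have "?T \<subseteq> (\<lambda>g. act g z) ` N"
  proof
    fix x assume x: "x \<in> ?T"
    then obtain h where h: "h \<in> S" "act (inv a) x = act h z" using W(3) by auto
    have hc: "h \<in> carrier G" "a \<otimes> h \<in> N" using h(1) unfolding S_def by auto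
    have "x = act a (act h z)" using act_inv(2)[OF ac, of x] x h(2) by simp
    then have "x = act (a \<otimes> h) z" using act_mult[OF ac hc(1) z] by simp
    then show "x \<in> (\<lambda>g. act g z) ` N" using hc(2) by blast
  qed
  ultimately show "\<exists>T. openin (mtop Z) T \<and> y \<in> T \<and> T \<subseteq> (\<lambda>g. act g z) ` N" by blast
qed

text \<open>The map combining the orbit map of \<open>c\<close> with the squared distance from \<open>x0\<close> is open at \<open>g1\<close>, because the
  distance is not stationary in the direction \<open>v\<close> tangent to the fibre. So the distance can be
  decreased without moving the image point. The derivatives are taken at \<open>g1\<close> rather than \<open>g\<close>, as
  generic rank arguments only provide some point with surjective derivative; left translation by
  \<open>g \<otimes> inv g1\<close> turns the conclusion into one about \<open>g\<close>.\<close>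

lemma enters_ball_along_kernel:
  assumes U: "(U, \<phi>) \<in> atlas M" and V: "(V, \<psi>) \<in> atlas Z" and c: "c \<in> points"
    and g: "g \<in> U" and g1: "g1 \<in> U" "act g1 c \<in> V" and e: "0 < \<epsilon>" "norm (\<phi> g - x0) = \<epsilon>"
    and \<rho>: "((\<lambda>y. (\<phi> ((g \<otimes> inv g1) \<otimes> inv_into U \<phi> y) - x0) \<bullet> (\<phi> ((g \<otimes> inv g1) \<otimes> inv_into U \<phi> y) - x0)) has_derivative \<rho>') (at (\<phi> g1))"
    and surj: "surj (\<lambda>v. partial (orbit_in_chart U \<phi> \<psi> c) v (\<phi> g1))"
    and v: "partial (orbit_in_chart U \<phi> \<psi> c) v (\<phi> g1) = 0" "\<rho>' v \<noteq> 0"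
  shows "\<exists>h\<in>U. \<phi> h \<in> ball x0 \<epsilon> \<and> act h c = act g c"
proof -
  define a where "a = g \<otimes> inv g1"
  have UG: "U \<subseteq> carrier G" using chart_topspace[OF chartM[OF U]] by simp
  have gc: "g \<in> carrier G" "g1 \<in> carrier G" using g g1 UG by auto
  have ac: "a \<in> carrier G" and ag1: "a \<otimes> g1 = g" unfolding a_def using gc by (auto simp: m_assoc)
  define r where "r = (\<lambda>y. (\<phi> (a \<otimes> inv_into U \<phi> y) - x0) \<bullet> (\<phi> (a \<otimes> inv_into U \<phi> y) - x0))"
  let ?F = "orbit_in_chart U \<phi> \<psi> c"
  define \<Psi> where "\<Psi> = (\<lambda>y. (?F y, r y))"
  define S where "S = \<phi> ` {h \<in> U. act h c \<in> V} \<inter> \<phi> ` {h \<in> U. a \<otimes> h \<in> U}"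
  have "open (\<phi> ` (U \<inter> {h \<in> U. act h c \<in> V}))"
    by (rule chart_open_image[OF chartM[OF U] open_orbit_preimage[OF U V c]])
  moreover have "U \<inter> {h \<in> U. act h c \<in> V} = {h \<in> U. act h c \<in> V}" by blast
  ultimately have "open (\<phi> ` {h \<in> U. act h c \<in> V})" by simp
  then have oS: "open S" unfolding S_def by (intro open_Int left_mult_in_chart(1)[OF U ac])
  have yS: "\<phi> g1 \<in> S" unfolding S_def using g g1 ag1 by auto
  have cont: "continuous_on S \<Psi>"
    unfolding \<Psi>_def r_def
  proof (intro continuous_on_Pair continuous_on_inner continuous_on_diff continuous_on_const)
    show "continuous_on S ?F"
      by (rule holo_on_continuous[OF holo_on_subset[OF orbit_in_chart_holo[OF U V c]]]) (simp add: S_def)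
    show "continuous_on S (\<lambda>x. \<phi> (a \<otimes> inv_into U \<phi> x))"
      by (rule holo_on_continuous[OF holo_on_subset[OF left_mult_in_chart(2)[OF U ac]]]) (simp add: S_def)
    then show "continuous_on S (\<lambda>x. \<phi> (a \<otimes> inv_into U \<phi> x))" .
  qed
  define D where "D = (\<lambda>v. (partial ?F v (\<phi> g1), \<rho>' v))"
  have dF: "(?F has_derivative (\<lambda>v. partial ?F v (\<phi> g1))) (at (\<phi> g1))"
    by (rule holo_on_has_derivative(1)[OF orbit_in_chart_holo[OF U V c]]) (use g1 in auto)
  have der: "(\<Psi> has_derivative D) (at (\<phi> g1))"
    unfolding \<Psi>_def D_def r_def a_def by (rule has_derivative_Pair[OF dF \<rho>])
  have linD: "linear D" using has_derivative_linear[OF der] .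
  have "surj D"
  proof (rule surj_if_onto)
    fix w :: "(complex^'n) \<times> real"
    obtain u where u: "partial ?F u (\<phi> g1) = fst w" using surj by (metis surjD)
    define s where "s = (snd w - \<rho>' u) / \<rho>' v"
    have "D (u + s *\<^sub>R v) = D u + s *\<^sub>R D v" using linD by (simp add: linear_add linear_cmul)
    also have "\<dots> = w" unfolding D_def u v(1) s_def using v(2) by (simp add: prod_eq_iff)
    finally show "\<exists>x. D x = w" by blast
  qed
  then obtain k where k: "bounded_linear k" "D \<circ> k = id"
    using linear_surj_bounded_right_inverse[OF linD] by blast
  have "\<Psi> (\<phi> g1) \<in> interior (\<Psi> ` S)"
    by (rule sussmann_open_mapping[OF oS cont yS der k order_refl]) (use yS oS in \<open>simp add: interior_open\<close>)
  then obtain d where d: "0 < d" "ball (\<Psi> (\<phi> g1)) d \<subseteq> \<Psi> ` S" unfolding mem_interior by blast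
  have "(?F (\<phi> g1), r (\<phi> g1) - d / 2) \<in> ball (\<Psi> (\<phi> g1)) d"
    using d(1) unfolding \<Psi>_def by (simp add: dist_Pair_Pair dist_real_def)
  then obtain y where y: "y \<in> S" "?F y = ?F (\<phi> g1)" "r y = r (\<phi> g1) - d / 2"
    using d(2) unfolding \<Psi>_def by auto
  obtain h where h: "h \<in> U" "act h c \<in> V" "y = \<phi> h" using y(1) unfolding S_def by blast
  obtain h' where h': "h' \<in> U" "a \<otimes> h' \<in> U" "y = \<phi> h'" using y(1) unfolding S_def by blast
  have "h' = h" using chart_inj[OF chartM[OF U]] h h' by (metis inj_onD)
  then have ahU: "a \<otimes> h \<in> U" using h' by simp
  have hc: "h \<in> carrier G" using h UG by blast
  have "\<psi> (act h c) = \<psi> (act g1 c)" using y(2) orbit_in_chart_apply[OF U] h g1 by simp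
  then have "act h c = act g1 c" using chart_inj[OF chartZ[OF V]] h(2) g1(2) by (meson inj_onD)
  then have "act (a \<otimes> h) c = act g c"
    using act_mult[OF ac hc c] act_mult[OF ac gc(2) c] ag1 by simp
  moreover have "r (\<phi> g1) = \<epsilon>\<^sup>2"
    unfolding r_def using chart_inv[OF chartM[OF U] g1(1)] ag1 e(2) by (simp add: dot_square_norm)
  then have "(norm (\<phi> (a \<otimes> h) - x0))\<^sup>2 < \<epsilon>\<^sup>2"
    using y(3) d(1) chart_inv[OF chartM[OF U] h(1)] unfolding r_def h(3) by (simp add: dot_square_norm)
  then have "norm (\<phi> (a \<otimes> h) - x0) < \<epsilon>" using e(1) by (metis less_imp_le power2_less_imp_less)
  then have "\<phi> (a \<otimes> h) \<in> ball x0 \<epsilon>" by (simp add: dist_norm norm_minus_commute)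
  ultimately show ?thesis using ahU by blast
qed

text \<open>The fibres through \<open>g\<close> of the orbit maps of \<open>c\<close> and \<open>d\<close> cannot both be tangent to the sphere, because
  their tangent spaces together span the tangent space of \<open>G\<close>. The fibre that is not tangent enters the
  ball.\<close>

lemma generic_pair_enters_ball:
  assumes gen: "generic_pair c d" and U: "(U, \<phi>) \<in> atlas M" and c: "c \<in> points" and d: "d \<in> points"
    and g: "g \<in> U" and e: "0 < \<epsilon>" "norm (\<phi> g - x0) = \<epsilon>"
  shows "(\<exists>h\<in>U. \<phi> h \<in> ball x0 \<epsilon> \<and> act h c = act g c) \<or> (\<exists>h\<in>U. \<phi> h \<in> ball x0 \<epsilon> \<and> act h d = act g d)"
proof -
  have UG: "U \<subseteq> carrier G" using chart_topspace[OF chartM[OF U]] by simp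
  have gcar: "g \<in> carrier G" using g UG by blast
  obtain V1 \<psi>1 where V1: "(V1, \<psi>1) \<in> atlas Z" "chart (mtop Z) (V1, \<psi>1)" "act g c \<in> V1"
    by (rule complex_manifold_chart_at[OF mfdZ act_closed[OF gcar c]]) (rule that)
  obtain V2 \<psi>2 where V2: "(V2, \<psi>2) \<in> atlas Z" "chart (mtop Z) (V2, \<psi>2)" "act g d \<in> V2"
    by (rule complex_manifold_chart_at[OF mfdZ act_closed[OF gcar d]]) (rule that)
  define U' where "U' = {h \<in> U. act h c \<in> V1} \<inter> {h \<in> U. act h d \<in> V2}"
  have U': "openin (mtop M) U'" "U' \<noteq> {}" "U' \<subseteq> U"
    unfolding U'_def using open_orbit_preimage[OF U V1(1) c] open_orbit_preimage[OF U V2(1) d] g V1(3) V2(3) by auto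
  have "\<exists>g1\<in>U'. surj (\<lambda>v. partial (pair_orbit_in_chart U \<phi> \<psi>1 \<psi>2 c d) v (\<phi> g1))"
    by (rule surjective_if_generic_pair[OF gen U V1(1) V2(1) c d U']) (auto simp: U'_def)
  then obtain g1 where g1: "g1 \<in> U'" and sP: "surj (\<lambda>v. partial (pair_orbit_in_chart U \<phi> \<psi>1 \<psi>2 c d) v (\<phi> g1))"
    by blast
  have g1U: "g1 \<in> U" "act g1 c \<in> V1" "act g1 d \<in> V2" using g1 unfolding U'_def by auto
  have g1c: "g1 \<in> carrier G" using g1U UG by blast
  define a where "a = g \<otimes> inv g1"
  have ac: "a \<in> carrier G" and ag1: "a \<otimes> g1 = g" and iag: "inv a \<otimes> g = g1"
    unfolding a_def using gcar g1c by (auto simp: m_assoc inv_mult_group)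
  let ?T1 = "\<lambda>v. partial (orbit_in_chart U \<phi> \<psi>1 c) v (\<phi> g1)"
  let ?T2 = "\<lambda>v. partial (orbit_in_chart U \<phi> \<psi>2 d) v (\<phi> g1)"
  have "partial (pair_orbit_in_chart U \<phi> \<psi>1 \<psi>2 c d) v (\<phi> g1) = vjoin (?T1 v) (?T2 v)" for v
    unfolding pair_orbit_in_chart_def
    by (rule partial_vjoin[where S = "\<phi> ` U'"])
      (use g1 in \<open>auto intro!: holo_on_subset[OF orbit_in_chart_holo[OF U V1(1) c]]
        holo_on_subset[OF orbit_in_chart_holo[OF U V2(1) d]] simp: U'_def\<close>)
  then have sj: "surj (\<lambda>v. vjoin (?T1 v) (?T2 v))" using sP by simp
  have onto: "\<exists>v. ?T1 v = x \<and> ?T2 v = y" for x y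
  proof -
    obtain v where "vjoin x y = vjoin (?T1 v) (?T2 v)" using surjD[OF sj] by blast
    then show ?thesis by auto
  qed
  have s1: "surj ?T1"
  proof (rule surj_if_onto)
    show "\<exists>v. ?T1 v = x" for x using onto[of x 0] by blast
  qed
  have s2: "surj ?T2"
  proof (rule surj_if_onto)
    show "\<exists>v. ?T2 v = x" for x using onto[of 0 x] by blast
  qed
  \<comment> \<open>left translation by \<open>a\<close> and its inverse in the chart\<close>
  define l where "l = (\<lambda>y. \<phi> (a \<otimes> inv_into U \<phi> y))"
  define l' where "l' = (\<lambda>y. \<phi> (inv a \<otimes> inv_into U \<phi> y))"
  have dl: "(l has_derivative (\<lambda>v. partial l v (\<phi> g1))) (at (\<phi> g1))"
    unfolding l_def by (rule holo_on_has_derivative(1)[OF left_mult_in_chart(2)[OF U ac]]) (use g1U ag1 g in auto)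
  have gin: "\<phi> g \<in> \<phi> ` {y \<in> U. inv a \<otimes> y \<in> U}" using g1U iag g by auto
  have dl': "(l' has_derivative (\<lambda>v. partial l' v (\<phi> g))) (at (\<phi> g))"
    unfolding l'_def by (rule holo_on_has_derivative(1)[OF left_mult_in_chart(2)[OF U inv_closed[OF ac]] gin])
  have l'g: "l' (\<phi> g) = \<phi> g1" and lg1: "l (\<phi> g1) = \<phi> g"
    unfolding l'_def l_def using chart_inv[OF chartM[OF U]] g g1U iag ag1 by auto
  have "(l \<circ> l' has_derivative (\<lambda>v. partial l v (\<phi> g1)) \<circ> (\<lambda>v. partial l' v (\<phi> g))) (at (\<phi> g))"
    by (rule diff_chain_at[OF dl']) (use dl l'g in simp)
  then have "((\<lambda>x. x) has_derivative (\<lambda>v. partial l v (\<phi> g1)) \<circ> (\<lambda>v. partial l' v (\<phi> g))) (at (\<phi> g))"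
  proof (rule has_derivative_transform_within_open[OF _ left_mult_in_chart(1)[OF U inv_closed[OF ac]] gin])
    fix x assume "x \<in> \<phi> ` {y \<in> U. inv a \<otimes> y \<in> U}"
    then obtain y where y: "y \<in> U" "inv a \<otimes> y \<in> U" "x = \<phi> y" by blast
    have "a \<otimes> (inv a \<otimes> y) = y" using y(1) UG ac by (simp add: m_assoc[symmetric] subset_iff)
    then show "(l \<circ> l') x = x"
      unfolding l_def l'_def y(3) using chart_inv[OF chartM[OF U]] y(1,2) by simp
  qed
  then have "(\<lambda>v. partial l v (\<phi> g1)) \<circ> (\<lambda>v. partial l' v (\<phi> g)) = (\<lambda>v. v)"
    using has_derivative_unique has_derivative_ident by blast
  then have ll': "partial l (partial l' w (\<phi> g)) (\<phi> g1) = w" for w by (metis comp_apply)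
  define \<rho>' where "\<rho>' = (\<lambda>v. (\<phi> g - x0) \<bullet> partial l v (\<phi> g1) + partial l v (\<phi> g1) \<bullet> (\<phi> g - x0))"
  have "((\<lambda>y. (l y - x0) \<bullet> (l y - x0)) has_derivative
      (\<lambda>v. (l (\<phi> g1) - x0) \<bullet> (partial l v (\<phi> g1) - 0) + (partial l v (\<phi> g1) - 0) \<bullet> (l (\<phi> g1) - x0))) (at (\<phi> g1))"
    by (intro has_derivative_inner has_derivative_diff dl has_derivative_const)
  then have d\<rho>: "((\<lambda>y. (l y - x0) \<bullet> (l y - x0)) has_derivative \<rho>') (at (\<phi> g1))"
    unfolding \<rho>'_def lg1 by simp
  \<comment> \<open>the radial direction at \<open>g\<close>, pulled back to \<open>g1\<close>\<close>
  define v0 where "v0 = partial l' (\<phi> g - x0) (\<phi> g)"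
  have "\<rho>' v0 = 2 * \<epsilon>\<^sup>2"
    unfolding \<rho>'_def v0_def ll' using e(2) by (simp add: power2_norm_eq_inner[symmetric])
  then have v0: "\<rho>' v0 \<noteq> 0" using e(1) by simp
  \<comment> \<open>splitting \<open>v0 = u + (v0 - u)\<close> into directions tangent to the fibres of \<open>c\<close> and of \<open>d\<close>\<close>
  obtain u where u: "?T1 u = 0" "?T2 u = ?T2 v0" using onto by blast
  have lin\<rho>: "linear \<rho>'" using has_derivative_linear[OF d\<rho>] .
  have lin2: "linear ?T2"
    by (rule has_derivative_linear[OF holo_on_has_derivative(1)[OF orbit_in_chart_holo[OF U V2(1) d]]])
      (use g1U in auto)
  have w: "?T2 (v0 - u) = 0" using linear_diff[OF lin2, of v0 u] u(2) by simp
  have "\<rho>' v0 = \<rho>' u + \<rho>' (v0 - u)" using lin\<rho> by (simp add: linear_diff)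
  then consider "\<rho>' u \<noteq> 0" | "\<rho>' (v0 - u) \<noteq> 0" using v0 by fastforce
  then show ?thesis
  proof cases
    case 1
    show ?thesis
      by (rule disjI1, rule enters_ball_along_kernel[OF U V1(1) c g g1U(1,2) e d\<rho>[unfolded l_def a_def] s1 u(1) 1])
  next
    case 2
    show ?thesis
      by (rule disjI2, rule enters_ball_along_kernel[OF U V2(1) d g g1U(1,3) e d\<rho>[unfolded l_def a_def] s2 w 2])
  qed
qed

end

section \<open>Pseudoconcavity\<close>

lemma chart_subtopology:
  assumes c: "chart T (U, \<phi>)" and D: "openin T D" and UD: "U \<subseteq> D"
  shows "chart (subtopology T D) (U, \<phi>)"
proof -
  have "D \<inter> U = U" using UD by blast
  then show ?thesis
    using c UD D unfolding chart_def by (simp add: subtopology_subtopology openin_open_subtopology)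
qed

lemma complex_manifold_open_submanifold:
  assumes Z: "complex_manifold Z" and D: "openin (mtop Z) D"
  shows "complex_manifold (open_submanifold Z D)"
  unfolding complex_manifold_def
proof (intro conjI ballI)
  let ?T = "subtopology (mtop Z) D"
  have [simp]: "mtop (open_submanifold Z D) = ?T"
    and at: "atlas (open_submanifold Z D) = {(U \<inter> D, \<phi>) | U \<phi>. (U, \<phi>) \<in> atlas Z}"
    unfolding open_submanifold_def by simp_all
  show "Hausdorff_space (mtop (open_submanifold Z D))" "second_countable (mtop (open_submanifold Z D))"
    using Z Hausdorff_space_subtopology second_countable_subtopology unfolding complex_manifold_def by auto
  show "chart (mtop (open_submanifold Z D)) c" if "c \<in> atlas (open_submanifold Z D)" for c
  proof -
    obtain U \<phi> where U: "c = (U \<inter> D, \<phi>)" "(U, \<phi>) \<in> atlas Z" using \<open>c \<in> _\<close> unfolding at by blast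
    show ?thesis
      unfolding U(1) using chart_subtopology[OF chart_Int[OF complex_manifold_chart[OF Z U(2)] D] D] by simp
  qed
  have "(\<Union>c\<in>atlas (open_submanifold Z D). fst c) = (\<Union>c\<in>atlas Z. fst c) \<inter> D"
  proof (intro equalityI subsetI)
    fix x assume "x \<in> (\<Union>c\<in>atlas Z. fst c) \<inter> D"
    then obtain U \<phi> where "(U, \<phi>) \<in> atlas Z" "x \<in> U" "x \<in> D" by auto
    then have "(U \<inter> D, \<phi>) \<in> atlas (open_submanifold Z D)" "x \<in> fst (U \<inter> D, \<phi>)" unfolding at by auto
    then show "x \<in> (\<Union>c\<in>atlas (open_submanifold Z D). fst c)" by blast
  qed (force simp: at)
  then show "(\<Union>c\<in>atlas (open_submanifold Z D). fst c) = topspace (mtop (open_submanifold Z D))"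
    using Z unfolding complex_manifold_def by simp
  fix c d assume "c \<in> atlas (open_submanifold Z D)" "d \<in> atlas (open_submanifold Z D)"
  then obtain U \<phi> V \<psi> where U: "c = (U \<inter> D, \<phi>)" "(U, \<phi>) \<in> atlas Z" and V: "d = (V \<inter> D, \<psi>)" "(V, \<psi>) \<in> atlas Z"
    unfolding at by blast
  let ?S = "\<phi> ` (U \<inter> D \<inter> (V \<inter> D))"
  have cU: "chart (mtop Z) (U, \<phi>)" and cU': "chart (mtop Z) (U \<inter> D, \<phi>)" and cV: "chart (mtop Z) (V, \<psi>)"
    using complex_manifold_chart[OF Z] U V chart_Int[OF _ D] by auto
  have "transition_holo (U, \<phi>) (V, \<psi>)" using Z U V unfolding complex_manifold_def by blast
  then have "holo_on (\<psi> \<circ> inv_into U \<phi>) ?S"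
    unfolding transition_holo_def by (auto intro: holo_on_subset)
  moreover have "open ?S"
    by (rule chart_open_image[OF cU']) (use chart_openin[OF cV] D in blast)
  moreover have "(\<psi> \<circ> inv_into U \<phi>) x = (\<psi> \<circ> inv_into (U \<inter> D) \<phi>) x" if "x \<in> ?S" for x
    using that chart_inv[OF cU] chart_inv[OF cU'] by auto
  ultimately have "holo_on (\<psi> \<circ> inv_into (U \<inter> D) \<phi>) ?S" by (rule holo_on_transform)
  then show "transition_holo c d" unfolding U V transition_holo_def by simp
qed

context holomorphic_action
begin

lemma holomorphic_disk_translate:
  assumes g: "g \<in> carrier G" and V: "(V, \<psi>) \<in> atlas Z"
    and h: "open W" "cball 0 1 \<subseteq> W" "continuous_map (top_of_set W) (mtop Z) h" "h ` W \<subseteq> V" "holo_curve (\<lambda>t. \<psi> (h t)) W"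
    and D: "\<And>t. t \<in> W \<Longrightarrow> act g (h t) \<in> D"
  shows "holomorphic_disk (open_submanifold Z D) (\<lambda>t. act g (h t))"
  unfolding holomorphic_disk_def
proof (intro exI[of _ W] conjI h(1,2) ballI)
  have c: "continuous_map (top_of_set W) (mtop Z) (\<lambda>t. act g (h t))"
    using continuous_map_compose[OF h(3) act_continuous[OF g]] by (simp add: o_def)
  show "continuous_map (top_of_set W) (mtop (open_submanifold Z D)) (\<lambda>t. act g (h t))"
    unfolding open_submanifold_def using c D by (simp add: continuous_map_in_subtopology Pi_iff)
  fix c assume "c \<in> atlas (open_submanifold Z D)"
  then obtain V' \<psi>' where V': "c = (V' \<inter> D, \<psi>')" "(V', \<psi>') \<in> atlas Z" unfolding open_submanifold_def by auto
  have gm: "g \<in> topspace (mtop M)" using g by simp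
  obtain U \<phi> where U: "(U, \<phi>) \<in> atlas M" "chart (mtop M) (U, \<phi>)" "g \<in> U"
    by (rule complex_manifold_chart_at[OF mfdM gm]) (rule that)
  obtain A \<Omega> where A: "open \<Omega>" "holo_on A \<Omega>"
    "\<Omega> = {vjoin (\<phi> g) (\<psi> z) | g z. g \<in> U \<and> z \<in> V \<and> act g z \<in> V'}"
    "\<And>g z. g \<in> U \<Longrightarrow> z \<in> V \<Longrightarrow> act g z \<in> V' \<Longrightarrow> A (vjoin (\<phi> g) (\<psi> z)) = \<psi>' (act g z)"
    by (rule action_in_charts[OF U(1) V V'(2)]) (rule that)
  define B where "B = {t \<in> W. act g (h t) \<in> V'}"
  have "openin (top_of_set W) {t \<in> topspace (top_of_set W). act g (h t) \<in> V'}"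
    using openin_continuous_map_preimage[OF c chart_openin[OF chartZ[OF V'(2)]]] .
  then have oB: "open B" unfolding B_def using h(1) by (simp add: openin_open_eq)
  have "holo_curve (\<lambda>t. A (vjoin (\<phi> g) (\<psi> (h t)))) B"
  proof (rule holo_curve_compose[OF A(2) _ oB])
    show "holo_curve (\<lambda>t. vjoin (\<phi> g) (\<psi> (h t))) B"
      by (rule holo_curve_vjoin[OF _ holo_curve_subset[OF h(5)]]) (auto simp: holo_curve_def B_def)
    show "(\<lambda>t. vjoin (\<phi> g) (\<psi> (h t))) ` B \<subseteq> \<Omega>"
      unfolding A(3) B_def using U(3) h(4) by blast
  qed
  then have "(\<lambda>t. A (vjoin (\<phi> g) (\<psi> (h t))) $ i) holomorphic_on B" for i unfolding holo_curve_def by blast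
  moreover have "A (vjoin (\<phi> g) (\<psi> (h t))) $ i = \<psi>' (act g (h t)) $ i" if "t \<in> B" for t i
    using A(4)[OF U(3)] that h(4) unfolding B_def by (auto simp: image_subset_iff)
  ultimately have "(\<lambda>t. \<psi>' (act g (h t)) $ i) holomorphic_on B" for i by (simp cong: holomorphic_cong)
  then have "(\<lambda>t. \<psi>' (act g (h t)) $ i) holomorphic_on (W \<inter> (\<lambda>t. act g (h t)) -` (V' \<inter> D))" for i
    by (rule holomorphic_on_subset) (auto simp: B_def)
  then show "case c of (U, \<phi>) \<Rightarrow> \<forall>i. (\<lambda>t. \<phi> (act g (h t)) $ i) holomorphic_on (W \<inter> (\<lambda>t. act g (h t)) -` U)"
    unfolding V'(1) by simp
qed

lemma holomorphic_disk_const: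
  assumes "p \<in> D" "D \<subseteq> points"
  shows "holomorphic_disk (open_submanifold Z D) (\<lambda>t. p)"
  unfolding holomorphic_disk_def
  using assms by (intro exI[of _ UNIV]) (auto simp: open_submanifold_def)

text \<open>The set swept out by the translates of \<open>C\<close> under a small coordinate ball around the identity has the
  required disks: constant ones at its own points, and translates of disks with generic boundary at
  its boundary points.\<close>

lemma pseudoconcave_if_generic_pairs:
  assumes D: "openin (mtop Z) D" "connectedin (mtop Z) D"
    and C: "complex_submanifold Z C" "connectedin (mtop Z) C" "compactin (mtop Z) C" "C \<subseteq> D" "C \<noteq> {}"
    and gen: "\<And>c. c \<in> C \<Longrightarrow> \<exists>d\<in>C. generic_pair c d"
  shows "pseudoconcave (open_submanifold Z D)"
proof -
  let ?X = "subtopology (mtop Z) D"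
  have mX: "mtop (open_submanifold Z D) = ?X" unfolding open_submanifold_def by simp
  have CZ: "C \<subseteq> points" using C(1) unfolding complex_submanifold_def by blast
  have om: "\<one> \<in> topspace (mtop M)" by simp
  obtain U \<phi> where U: "(U, \<phi>) \<in> atlas M" "chart (mtop M) (U, \<phi>)" "\<one> \<in> U"
    by (rule complex_manifold_chart_at[OF mfdM om]) (rule that)
  have UG: "U \<subseteq> carrier G" using chart_topspace[OF U(2)] by simp
  obtain N where N: "openin (mtop M) N" "\<one> \<in> N" "\<And>g k. g \<in> N \<Longrightarrow> k \<in> C \<Longrightarrow> act g k \<in> D"
    by (rule compact_moved_in_open[OF C(3) D(1) C(4)]) (rule that)
  define x0 where "x0 = \<phi> \<one>"
  have "open (\<phi> ` (U \<inter> N))" "x0 \<in> \<phi> ` (U \<inter> N)"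
    using chart_open_image[OF U(2) N(1)] U(3) N(2) unfolding x0_def by auto
  then obtain \<epsilon> where e: "0 < \<epsilon>" "cball x0 \<epsilon> \<subseteq> \<phi> ` (U \<inter> N)" using open_contains_cball by metis
  define B where "B = {g \<in> U. \<phi> g \<in> ball x0 \<epsilon>}"
  define Bc where "Bc = inv_into U \<phi> ` cball x0 \<epsilon>"
  have Bc: "Bc = {g \<in> U. \<phi> g \<in> cball x0 \<epsilon>}" "Bc \<subseteq> N"
  proof -
    have *: "inv_into U \<phi> y \<in> U \<inter> N \<and> \<phi> (inv_into U \<phi> y) = y" if "y \<in> cball x0 \<epsilon>" for y
    proof -
      obtain g where "g \<in> U \<inter> N" "y = \<phi> g" using \<open>y \<in> _\<close> e(2) by blast
      then show ?thesis using chart_inv[OF U(2)] by simp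
    qed
    show "Bc \<subseteq> N" unfolding Bc_def using * by blast
    show "Bc = {g \<in> U. \<phi> g \<in> cball x0 \<epsilon>}"
    proof (intro equalityI subsetI)
      fix g assume "g \<in> {g \<in> U. \<phi> g \<in> cball x0 \<epsilon>}"
      then have "g = inv_into U \<phi> (\<phi> g)" "\<phi> g \<in> cball x0 \<epsilon>" using chart_inv[OF U(2)] by auto
      then show "g \<in> Bc" unfolding Bc_def by blast
    next
      fix g assume "g \<in> Bc"
      then obtain y where "y \<in> cball x0 \<epsilon>" "g = inv_into U \<phi> y" unfolding Bc_def by blast
      then show "g \<in> {g \<in> U. \<phi> g \<in> cball x0 \<epsilon>}" using *[of y] by simp
    qed
  qed
  have oB: "openin (mtop M) B" unfolding B_def by (rule chart_open_preimage[OF U(2) open_ball])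
  have BBc: "B \<subseteq> Bc" unfolding B_def Bc(1) by auto
  have BcG: "Bc \<subseteq> carrier G" using Bc(1) UG by blast
  have compBc: "compactin (mtop M) Bc"
    unfolding Bc_def by (rule chart_compact[OF U(2) compact_cball]) (use e(2) in blast)
  \<comment> \<open>\<open>Y\<close> is swept out by the open ball, and its closure \<open>Yc\<close> by the closed ball\<close>
  define Y where "Y = (\<Union>c\<in>C. (\<lambda>g. act g c) ` B)"
  define Yc where "Yc = (\<lambda>(g, c). act g c) ` (Bc \<times> C)"
  have YI: "act k c \<in> Y" if "c \<in> C" "k \<in> B" for k c using that unfolding Y_def by blast
  have oY: "openin (mtop Z) Y"
    unfolding Y_def using orbit_map_open[OF _ oB] CZ by (intro openin_Union) blast
  have YYc: "Y \<subseteq> Yc" unfolding Y_def Yc_def using BBc by auto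
  have YcD: "Yc \<subseteq> D" unfolding Yc_def using N(3) Bc(2) by auto
  have "compactin (mtop Z) Yc"
    unfolding Yc_def by (rule image_compactin[OF _ act_continuous_prod]) (simp add: compactin_Times compBc C(3))
  then have clYc: "closedin (mtop Z) Yc"
    using mfdZ compactin_imp_closedin unfolding complex_manifold_def by blast
  define K where "K = mtop Z closure_of Y"
  have KYc: "K \<subseteq> Yc" unfolding K_def by (rule closure_of_minimal[OF YYc clYc])
  have YcK: "Yc \<subseteq> K"
  proof
    fix y assume "y \<in> Yc"
    then obtain g c where gc: "g \<in> Bc" "c \<in> C" "y = act g c" unfolding Yc_def by auto
    have cp: "c \<in> points" using gc(2) CZ by blast
    show "y \<in> K" unfolding K_def in_closure_of
    proof (intro conjI allI impI)
      show "y \<in> points" using gc(3) act_closed cp gc(1) BcG by blast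
      fix T assume T: "y \<in> T \<and> openin (mtop Z) T"
      have "openin (mtop M) {h \<in> topspace (mtop M). act h c \<in> T}"
        using openin_continuous_map_preimage[OF orbit_map_continuous[OF cp]] T by blast
      then have "open (\<phi> ` (U \<inter> {h \<in> topspace (mtop M). act h c \<in> T}))" by (rule chart_open_image[OF U(2)])
      moreover have "\<phi> g \<in> \<phi> ` (U \<inter> {h \<in> topspace (mtop M). act h c \<in> T})"
        using gc T BcG Bc(1) by auto
      moreover have "\<phi> g \<in> closure (ball x0 \<epsilon>)" using gc(1) e(1) unfolding Bc(1) by simp
      ultimately have "ball x0 \<epsilon> \<inter> \<phi> ` (U \<inter> {h \<in> topspace (mtop M). act h c \<in> T}) \<noteq> {}"
        by (metis (no_types, lifting) IntI Int_commute empty_iff open_Int_closure_eq_empty)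
      then obtain h where "h \<in> U" "\<phi> h \<in> ball x0 \<epsilon>" "act h c \<in> T" by blast
      then show "\<exists>y. y \<in> Y \<and> y \<in> T" using gc(2) unfolding Y_def B_def by blast
    qed
  qed
  have KD: "K \<subseteq> D" using KYc YcD by blast
  have YD: "Y \<subseteq> D" using YYc YcD by blast
  have clos: "?X closure_of Y = K"
    using KD YD unfolding K_def closure_of_subtopology by (simp add: Int_absorb1)
  have YinK: "Y \<subseteq> K" unfolding K_def by (rule closure_of_subset) (use oY openin_subset in blast)
  have "\<exists>\<psi>. holomorphic_disk (open_submanifold Z D) \<psi> \<and> \<psi> ` cball 0 1 \<subseteq> K \<and> \<psi> 0 = p \<and> \<psi> ` sphere 0 1 \<subseteq> Y"
    if p: "p \<in> K" for p
  proof (cases "p \<in> Y")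
    case True
    have "holomorphic_disk (open_submanifold Z D) (\<lambda>t. p)"
      by (rule holomorphic_disk_const) (use p KD openin_subset[OF D(1)] in auto)
    then show ?thesis using p True by (intro exI[of _ "\<lambda>t. p"]) auto
  next
    case False
    obtain g c where gc: "g \<in> Bc" "c \<in> C" "p = act g c" using p KYc unfolding Yc_def by auto
    have gU: "g \<in> U" "\<phi> g \<in> cball x0 \<epsilon>" and gG: "g \<in> carrier G" using gc(1) Bc(1) UG by auto
    have cp: "c \<in> points" using gc(2) CZ by blast
    have "\<phi> g \<notin> ball x0 \<epsilon>" using False gc gU(1) unfolding Y_def B_def by blast
    then have ng: "norm (\<phi> g - x0) = \<epsilon>" using gU(2) by (simp add: dist_norm norm_minus_commute)
    obtain d where d: "d \<in> C" "generic_pair c d" using gen[OF gc(2)] by blast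
    obtain h W V \<psi> where h: "open W" "cball 0 1 \<subseteq> W" "continuous_map (top_of_set W) (mtop Z) h" "h ` W \<subseteq> C" "h 0 = c"
      "\<And>t. t \<in> sphere 0 1 \<Longrightarrow> generic_pair c (h t)" "(V, \<psi>) \<in> atlas Z" "h ` W \<subseteq> V" "holo_curve (\<lambda>t. \<psi> (h t)) W"
      by (rule disk_with_generic_boundary[OF C(1,2) gc(2) d]) (rule that)
    have inYc: "act g (h t) \<in> Yc" if "t \<in> W" for t
      unfolding Yc_def using gc(1) h(4) that by auto
    have "holomorphic_disk (open_submanifold Z D) (\<lambda>t. act g (h t))"
      by (rule holomorphic_disk_translate[OF gG h(7,1,2,3,8,9)]) (use inYc YcD in blast)
    moreover have "(\<lambda>t. act g (h t)) ` cball 0 1 \<subseteq> K" using inYc YcK h(2) by blast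
    moreover have "act g (h 0) = p" using gc(3) h(5) by simp
    moreover have "(\<lambda>t. act g (h t)) ` sphere 0 1 \<subseteq> Y"
    proof clarify
      fix t :: complex assume t: "t \<in> sphere 0 1"
      have tW: "t \<in> W" using t h(2) by auto
      have hC: "h t \<in> C" using h(4) tW by blast
      have hp: "h t \<in> points" using hC CZ by blast
      have "\<not> (\<exists>k\<in>U. \<phi> k \<in> ball x0 \<epsilon> \<and> act k c = act g c)"
      proof
        assume "\<exists>k\<in>U. \<phi> k \<in> ball x0 \<epsilon> \<and> act k c = act g c"
        then obtain k where "k \<in> B" "act k c = p" unfolding B_def gc(3) by blast
        then show False using False YI[OF gc(2)] by metis
      qed
      then obtain k where "k \<in> U" "\<phi> k \<in> ball x0 \<epsilon>" "act k (h t) = act g (h t)"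
        using generic_pair_enters_ball[OF h(6)[OF t] U(1) cp hp gU(1) e(1) ng] by blast
      then have "k \<in> B" "act k (h t) = act g (h t)" unfolding B_def by auto
      then show "act g (h t) \<in> Y" using YI[OF hC] by metis
    qed
    ultimately show ?thesis by (intro exI[of _ "\<lambda>t. act g (h t)"]) simp
  qed
  moreover have "openin ?X Y" using oY YD by (simp add: openin_open_subtopology[OF D(1)])
  moreover have "Y \<noteq> {}"
  proof -
    have "\<one> \<in> B" unfolding B_def using U(3) e(1) x0_def by simp
    then show ?thesis using C(5) unfolding Y_def by blast
  qed
  moreover have "compactin ?X K"
    unfolding compactin_subtopology
    using closed_compactin[OF \<open>compactin (mtop Z) Yc\<close> KYc] KD unfolding K_def by simp
  moreover have "connected_space ?X" using D(2) unfolding connectedin_def by blast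
  ultimately show ?thesis
    unfolding pseudoconcave_def mX clos[symmetric]
    using complex_manifold_open_submanifold[OF mfdZ D(1)] by (intro conjI exI[of _ Y]) auto
qed

end

theorem theorem3p7:
  fixes G :: "('g, 'r) monoid_scheme" and M :: "('g, 'm::finite) mfd"
    and G\<^sub>0 K\<^sub>0 K Q :: "'g set"
    and Z :: "('z, 'n::finite) mfd" and act :: "'g \<Rightarrow> 'z \<Rightarrow> 'z"
    and \<iota> :: "'z \<Rightarrow> (complex^'k::finite) set"
    and D C\<^sub>0 :: "'z set"
  assumes "complex_lie_group G M"
    and "real_simple_lie_subgroup G M G\<^sub>0"
    and "complexification G M G\<^sub>0 (carrier G)"
    and "flag_manifold G M Q Z act \<iota>"
    and "flag_domain G G\<^sub>0 Z act D"
    and "maximal_compact_subgroup G M G\<^sub>0 K\<^sub>0"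
    and "complexification G M K\<^sub>0 K"
    and "base_cycle G K\<^sub>0 K Z act D C\<^sub>0"
    and "generically_1_connected G Z act C\<^sub>0 D"
  shows "pseudoconcave (open_submanifold Z D)"
proof -
  have "group G" using assms(1) unfolding complex_lie_group_def by blast
  then have "complex_lie G M" using assms(1) by (intro complex_lie.intro complex_lie_axioms.intro)
  moreover have "transitive_action G (topspace (mtop Z)) act" using assms(4) unfolding flag_manifold_def by blast
  moreover have "holomorphic_action_axioms M Z act"
    using assms(4) unfolding flag_manifold_def by (intro holomorphic_action_axioms.intro) blast+
  ultimately interpret holomorphic_action G M Z act by (rule holomorphic_action.intro)
  have orb: "subgroup_orbit G H act z = (\<lambda>g. act g z) ` H" for H z unfolding orbit_def by auto
  obtain z0 where z0: "z0 \<in> points" "D = (\<lambda>g. act g z0) ` G\<^sub>0" and oD: "openin (mtop Z) D"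
    using assms(5) unfolding flag_domain_def orb by blast
  obtain z1 where z1: "z1 \<in> D" "C\<^sub>0 = (\<lambda>g. act g z1) ` K\<^sub>0" "C\<^sub>0 = (\<lambda>g. act g z1) ` K"
    and C0: "C\<^sub>0 \<subseteq> D" "complex_submanifold Z C\<^sub>0"
    using assms(8) unfolding base_cycle_def orb by blast
  have z1p: "z1 \<in> points" using z1(1) openin_subset[OF oD] by blast
  have C0Z: "C\<^sub>0 \<subseteq> points" using C0(1) openin_subset[OF oD] by blast
  have K0: "subgroup K\<^sub>0 G" "compactin (mtop M) K\<^sub>0" using assms(6) unfolding maximal_compact_subgroup_def by auto
  have K0G: "K\<^sub>0 \<subseteq> carrier G" using subgroup.subset[OF K0(1)] .
  have "connectedin (mtop M) G\<^sub>0"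
    using assms(2) unfolding real_simple_lie_subgroup_def closed_connected_subgroup_def by blast
  then have conD: "connectedin (mtop Z) D"
    unfolding z0(2) by (rule connectedin_continuous_map_image[OF orbit_map_continuous[OF z0(1)]])
  have "connectedin (mtop M) K"
    using assms(7) unfolding complexification_def closed_connected_subgroup_def by blast
  then have conC: "connectedin (mtop Z) C\<^sub>0"
    unfolding z1(3) by (rule connectedin_continuous_map_image[OF orbit_map_continuous[OF z1p]])
  have compC: "compactin (mtop Z) C\<^sub>0"
    unfolding z1(2) by (rule image_compactin[OF K0(2) orbit_map_continuous[OF z1p]])
  have neC: "C\<^sub>0 \<noteq> {}" unfolding z1(2) using subgroup.one_closed[OF K0(1)] by blast
  obtain p g q r where p: "p \<in> D" "g \<in> carrier G" "p \<in> act g ` C\<^sub>0" and q: "q \<in> points"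
    and op: "openin (mtop Z) (subgroup_orbit G (stabilizer G act p) act q)"
    and r: "r \<in> act g ` C\<^sub>0" "r \<in> (\<lambda>g. act g q) ` stabilizer G act p"
    using assms(9) unfolding generically_1_connected_def cycles_def orb by blast
  have pp: "p \<in> points" using p(1) openin_subset[OF oD] by blast
  obtain k where k: "k \<in> carrier G" "act k p = p" "r = act k q" using r(2) unfolding stabilizer_def by auto
  obtain c0 d0 where c0: "c0 \<in> C\<^sub>0" "p = act g c0" and d0: "d0 \<in> C\<^sub>0" "r = act g d0" using p(3) r(1) by blast
  have cd: "c0 \<in> points" "d0 \<in> points" using c0(1) d0(1) C0Z by auto
  have "generic_pair p q" by (rule generic_pair_if_open_stabilizer_orbit[OF pp q op])
  then have "generic_pair p r" using generic_pair_translate[of p q k] k pp q by simp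
  then have "generic_pair (act (inv\<^bsub>G\<^esub> g) p) (act (inv\<^bsub>G\<^esub> g) r)"
    by (rule generic_pair_translate) (use p(2) pp k(1,3) q act_closed in auto)
  then have gen0: "generic_pair c0 d0" unfolding c0(2) d0(2) using p(2) cd by simp
  \<comment> \<open>the transitive action of \<open>K\<^sub>0\<close> on \<open>C\<^sub>0\<close> carries \<open>(c0, d0)\<close> to a pair with any given first component\<close>
  have "\<exists>d\<in>C\<^sub>0. generic_pair c d" if "c \<in> C\<^sub>0" for c
  proof -
    obtain a b e where a: "a \<in> K\<^sub>0" "c = act a z1" and b: "b \<in> K\<^sub>0" "c0 = act b z1" and e: "e \<in> K\<^sub>0" "d0 = act e z1"
      using \<open>c \<in> C\<^sub>0\<close> c0(1) d0(1) unfolding z1(2) by blast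
    define t where "t = a \<otimes>\<^bsub>G\<^esub> inv\<^bsub>G\<^esub> b"
    have t: "t \<in> K\<^sub>0" unfolding t_def using a(1) b(1) K0(1) by (simp add: subgroup.m_closed subgroup.m_inv_closed)
    have ab: "a \<in> carrier G" "b \<in> carrier G" "e \<in> carrier G" "t \<in> carrier G" using a b e t K0G by auto
    have "act t c0 = c" unfolding t_def b(2) a(2) using ab z1p act_closed by (simp add: act_mult)
    moreover have "act t d0 \<in> C\<^sub>0"
    proof -
      have "act t d0 = act (t \<otimes>\<^bsub>G\<^esub> e) z1" unfolding e(2) using ab z1p by (simp add: act_mult)
      then show ?thesis unfolding z1(2) using subgroup.m_closed[OF K0(1) t e(1)] by blast
    qed
    ultimately show ?thesis using generic_pair_translate[OF gen0 ab(4) cd] by auto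
  qed
  then show ?thesis
    by (rule pseudoconcave_if_generic_pairs[OF oD conD C0(2) conC compC C0(1) neC])
qed

end
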